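(* Let $k\ge-2$ be an integer and let the profiles $(u_n)_{n\ge0}$ and residual profiles $(w_n)_{n\ge-2}$ (as in the context) satisfy $(I-\pi)w_j=0$ for $-2\le j\le k$ (equivalently, $(I-\pi)u_\ell=\sum_{n=1}^\ell\chi_n\pi u_{\ell-n}$ for $0\le\ell\le k+2$). Then $\pi w_{-2}=\pi w_{-1}=0$ and for $0\le j\le k+1$, $$\pi w_j=\sum_{n=0}^{j}a_{n+2}^*(\partial_t,\partial_x)\,\pi u_{j-n}.$$
   Context: Let $d\ge1$, ${\mathbb T}^d$ the unit torus. Let $\rho\in L^\infty({\mathbb T}^d)$ be real valued and $a\in L^\infty({\mathbb T}^d)$ take values in real symmetric $d\times d$ matrices, with $m_1>0$ such that $a(y)\xi\cdot\xi\ge m_1|\xi|^2$ for all $\xi$ and $\rho(y)\ge m_1$ a.e. For $g(t,x,y)$ periodic in $y$, $(\pi g)(t,x)=\frac1{|{\mathbb T}^d|}\int_{{\mathbb T}^d}g(t,x,y)dy$. ${\mathcal A}_{yy}=\mathrm{div}_y a(y)\mathrm{grad}_y$, ${\mathcal A}_{xx}=\mathrm{div}_x a(y)\mathrm{grad}_x$, ${\mathcal A}_{xy}=\mathrm{div}_x a(y)\mathrm{grad}_y+\mathrm{div}_y a(y)\mathrm{grad}_x$; ${\mathcal A}_{yy}^{-1}$ is the inverse of the bijection ${\mathcal A}_{yy}:(I-\pi)H^1({\mathbb T}^d)\to(I-\pi)H^{-1}({\mathbb T}^d)$. $\chi_{-1}=0$, $\chi_0=I$, and for $k\ge1$, $\chi_k=-{\mathcal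 A}_{yy}^{-1}(I-\pi)[{\mathcal A}_{xy}\chi_{k-1}+({\mathcal A}_{xx}-\rho(y)\partial_t^2)\chi_{k-2}]$. For $n\ge1$, $a_n^*(\partial_t,\partial_x)=\pi\big((\rho(y)\partial_t^2-{\mathcal A}_{xx})\chi_{n-2}-{\mathcal A}_{xy}\chi_{n-1}\big)$ (a constant-coefficient operator in $(t,x)$). Profiles $u_n(t,x,y)$, $n\ge0$, are smooth in $(t,x)$ with values in $H^1({\mathbb T}^d)$; $w_{-2}=-{\mathcal A}_{yy}u_0$, $w_{-1}=-{\mathcal A}_{yy}u_1-{\mathcal A}_{xy}u_0$, and $w_k=\rho(y)\partial_t^2u_k-{\mathcal A}_{yy}u_{k+2}-{\mathcal A}_{xy}u_{k+1}-{\mathcal A}_{xx}u_k$ for $k\ge0$ (the coefficients of $\epsilon^n$ in $[\rho\partial_t^2-\epsilon^{-2}{\mathcal A}_{yy}-\epsilon^{-1}{\mathcal A}_{xy}-{\mathcal A}_{xx}]\sum_n\epsilon^nu_n$). *)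

theory Defs
  imports "HOL-Analysis.Analysis"
begin

text \<open>Conventions. The unit torus T^d is modelled by the unit cube [0,1]^d
  (cbox 0 One in real^'d) together with 1-periodic test functions; this encodes the
  periodic boundary behaviour. |T^d| = 1, so the mean pi is the integral over the cube.
  Time t :: real, slow variable x :: real^'d, fast variable y :: real^'d.\<close>

type_synonym 'd yfun = "real^'d \<Rightarrow> real"
type_synonym 'd ydist = "'d yfun \<Rightarrow> real"   \<comment> \<open>action on periodic test functions\<close>
type_synonym 'd prof = "real \<Rightarrow> real^'d \<Rightarrow> 'd yfun"
type_synonym 'd dprof = "real \<Rightarrow> real^'d \<Rightarrow> 'd ydist"

definition cube :: "(real^'d::finite) set" where "cube = cbox 0 One"

definition yint :: "('d::finite) yfun \<Rightarrow> real" where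
  "yint f = integral\<^sup>L (lebesgue_on cube) f"

definition sq_int :: "('d::finite) yfun \<Rightarrow> bool" where
  "sq_int f \<longleftrightarrow> f \<in> borel_measurable (lebesgue_on cube)
      \<and> integrable (lebesgue_on cube) (\<lambda>y. (f y)^2)"

definition pd :: "('d::finite) \<Rightarrow> 'd yfun \<Rightarrow> 'd yfun" where
  "pd i \<phi> = (\<lambda>y. deriv (\<lambda>s. \<phi> (y + s *\<^sub>R axis i 1)) 0)"

definition ygrad :: "('d::finite) yfun \<Rightarrow> real^'d \<Rightarrow> real^'d" where
  "ygrad \<phi> y = (\<chi> i. pd i \<phi> y)"

definition smooth_fun :: "('d::finite) yfun \<Rightarrow> bool" where
  "smooth_fun \<phi> \<longleftrightarrow> (\<forall>is::'d list. continuous_on UNIV (foldr pd is \<phi>) \<and>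
      (\<forall>i y. (\<lambda>s. foldr pd is \<phi> (y + s *\<^sub>R axis i 1)) differentiable (at 0)))"

definition ptest :: "('d::finite) yfun \<Rightarrow> bool" where
  "ptest \<phi> \<longleftrightarrow> smooth_fun \<phi> \<and> (\<forall>i y. \<phi> (y + axis i 1) = \<phi> y)"

definition is_wgrad :: "('d::finite) yfun \<Rightarrow> (real^'d \<Rightarrow> real^'d) \<Rightarrow> bool" where
  "is_wgrad v G \<longleftrightarrow> sq_int v \<and> (\<forall>i. sq_int (\<lambda>y. G y $ i)) \<and>
     (\<forall>\<phi> i. ptest \<phi> \<longrightarrow> yint (\<lambda>y. v y * pd i \<phi> y) = - yint (\<lambda>y. G y $ i * \<phi> y))"

definition in_H1 :: "('d::finite) yfun \<Rightarrow> bool" where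
  "in_H1 v \<longleftrightarrow> (\<exists>G. is_wgrad v G)"

definition wgrad :: "('d::finite) yfun \<Rightarrow> real^'d \<Rightarrow> real^'d" where
  "wgrad v = (SOME G. is_wgrad v G)"

definition h1norm2 :: "('d::finite) yfun \<Rightarrow> real" where
  "h1norm2 v = yint (\<lambda>y. (v y)^2) + yint (\<lambda>y. (norm (wgrad v y))^2)"

definition shift :: "('d::finite) option \<Rightarrow> real \<Rightarrow> real \<times> (real^'d) \<Rightarrow> real \<times> (real^'d)" where
  "shift p h tx = (case p of None \<Rightarrow> (fst tx + h, snd tx)
                           | Some i \<Rightarrow> (fst tx, snd tx + h *\<^sub>R axis i 1))"

definition has_hpd :: "('d::finite) prof \<Rightarrow> 'd option \<Rightarrow> 'd prof \<Rightarrow> bool" where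
  "has_hpd U p V \<longleftrightarrow> (\<forall>t x. in_H1 (U t x) \<and> in_H1 (V t x) \<and>
     ((\<lambda>h. h1norm2 (\<lambda>y. (case shift p h (t, x) of (s, z) \<Rightarrow> U s z y - U t x y) / h
                        - V t x y)) \<longlongrightarrow> 0) (at 0))"

definition h1_continuous :: "('d::finite) prof \<Rightarrow> bool" where
  "h1_continuous U \<longleftrightarrow> (\<forall>t x. ((\<lambda>(s, z). h1norm2 (\<lambda>y. U s z y - U t x y)) \<longlongrightarrow> 0) (at (t, x)))"

definition hsmooth :: "('d::finite) prof \<Rightarrow> bool" where
  "hsmooth U \<longleftrightarrow> (\<exists>D :: 'd option list \<Rightarrow> 'd prof. D [] = U \<and>
      (\<forall>ps p. has_hpd (D ps) p (D (p # ps))) \<and> (\<forall>ps. h1_continuous (D ps)))"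

definition hpd :: "('d::finite) option \<Rightarrow> 'd prof \<Rightarrow> 'd prof" where
  "hpd p U = (SOME V. has_hpd U p V)"

definition fdist :: "('d::finite) yfun \<Rightarrow> 'd ydist" where
  "fdist g = (\<lambda>\<phi>. yint (\<lambda>y. g y * \<phi> y))"

definition pid :: "('d::finite) ydist \<Rightarrow> real" where
  "pid F = F (\<lambda>_. 1)"

definition Ipi :: "('d::finite) ydist \<Rightarrow> 'd ydist" where
  "Ipi F = (\<lambda>\<phi>. F \<phi> - pid F * yint \<phi>)"

definition dzero :: "('d::finite) ydist \<Rightarrow> bool" where
  "dzero F \<longleftrightarrow> (\<forall>\<phi>. ptest \<phi> \<longrightarrow> F \<phi> = 0)"

definition ayy :: "(real^('d::finite) \<Rightarrow> real^'d^'d) \<Rightarrow> 'd yfun \<Rightarrow> 'd ydist" where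
  "ayy a v = (\<lambda>\<phi>. - yint (\<lambda>y. (a y *v wgrad v y) \<bullet> ygrad \<phi> y))"

definition Ayy :: "(real^('d::finite) \<Rightarrow> real^'d^'d) \<Rightarrow> 'd prof \<Rightarrow> 'd dprof" where
  "Ayy a U t x = ayy a (U t x)"

definition Axy :: "(real^('d::finite) \<Rightarrow> real^'d^'d) \<Rightarrow> 'd prof \<Rightarrow> 'd dprof" where
  "Axy a U t x = (\<lambda>\<phi>.
      yint (\<lambda>y. (\<Sum>i\<in>UNIV. (a y *v wgrad (hpd (Some i) U t x) y) $ i) * \<phi> y)
    - yint (\<lambda>y. (a y *v (\<chi> j. hpd (Some j) U t x y)) \<bullet> ygrad \<phi> y))"

definition Axx :: "(real^('d::finite) \<Rightarrow> real^'d^'d) \<Rightarrow> 'd prof \<Rightarrow> 'd dprof" where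
  "Axx a U t x = fdist (\<lambda>y. \<Sum>i\<in>UNIV. \<Sum>j\<in>UNIV.
      a y $ i $ j * hpd (Some i) (hpd (Some j) U) t x y)"

definition Rtt :: "('d::finite) yfun \<Rightarrow> 'd prof \<Rightarrow> 'd dprof" where
  "Rtt \<rho> U t x = fdist (\<lambda>y. \<rho> y * hpd None (hpd None U) t x y)"

definition ayy_inv :: "(real^('d::finite) \<Rightarrow> real^'d^'d) \<Rightarrow> 'd ydist \<Rightarrow> 'd yfun" where
  "ayy_inv a F = (SOME v. in_H1 v \<and> yint v = 0 \<and> (\<forall>\<phi>. ptest \<phi> \<longrightarrow> ayy a v \<phi> = F \<phi>))"

text \<open>Correctors: chiX k f = chi_{k-1} f  (so chiX 0 = chi_{-1} = 0, chiX 1 = chi_0 = I)\<close>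
fun chiX :: "(real^('d::finite) \<Rightarrow> real^'d^'d) \<Rightarrow> 'd yfun \<Rightarrow> nat \<Rightarrow> (real \<Rightarrow> real^'d \<Rightarrow> real) \<Rightarrow> 'd prof" where
  "chiX a \<rho> 0 f = (\<lambda>t x y. 0)"
| "chiX a \<rho> (Suc 0) f = (\<lambda>t x y. f t x)"
| "chiX a \<rho> (Suc (Suc k)) f = (\<lambda>t x y. - ayy_inv a (Ipi (\<lambda>\<phi>.
      Axy a (chiX a \<rho> (Suc k) f) t x \<phi> + Axx a (chiX a \<rho> k f) t x \<phi>
      - Rtt \<rho> (chiX a \<rho> k f) t x \<phi>)) y)"

text \<open>a*_n(d_t,d_x) f = pi((rho d_t^2 - A_xx) chi_{n-2} f - A_xy chi_{n-1} f), n >= 1\<close>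
definition astar :: "(real^('d::finite) \<Rightarrow> real^'d^'d) \<Rightarrow> 'd yfun \<Rightarrow> nat \<Rightarrow> (real \<Rightarrow> real^'d \<Rightarrow> real)
    \<Rightarrow> real \<Rightarrow> real^'d \<Rightarrow> real" where
  "astar a \<rho> n f t x = pid (\<lambda>\<phi>. Rtt \<rho> (chiX a \<rho> (n - 1) f) t x \<phi>
       - Axx a (chiX a \<rho> (n - 1) f) t x \<phi> - Axy a (chiX a \<rho> n f) t x \<phi>)"

definition wres :: "(real^('d::finite) \<Rightarrow> real^'d^'d) \<Rightarrow> 'd yfun \<Rightarrow> (nat \<Rightarrow> 'd prof) \<Rightarrow> int \<Rightarrow> 'd dprof" where
  "wres a \<rho> u j t x =
     (if j = -2 then (\<lambda>\<phi>. - Ayy a (u 0) t x \<phi>)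
      else if j = -1 then (\<lambda>\<phi>. - Ayy a (u 1) t x \<phi> - Axy a (u 0) t x \<phi>)
      else (\<lambda>\<phi>. Rtt \<rho> (u (nat j)) t x \<phi> - Ayy a (u (nat j + 2)) t x \<phi>
              - Axy a (u (nat j + 1)) t x \<phi> - Axx a (u (nat j)) t x \<phi>))"

definition ymean :: "('d::finite) prof \<Rightarrow> real \<Rightarrow> real^'d \<Rightarrow> real" where
  "ymean U t x = yint (U t x)"

end

theory Submission
  imports Defs
begin

text \<open>Profiles are viewed as functions of \<open>(t, x)\<close> with values in the Hilbert space of pairs
  \<open>(v, G)\<close> in \<open>L\<^sup>2\<close> of the cube, in which the pairs with \<open>G\<close> the weak gradient of \<open>v\<close> form a closed
  subspace. Density of trigonometric polynomials yields uniqueness of weak gradients, density of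
  smooth functions in \<open>H\<^sup>1\<close> and Poincare's inequality, so that the cell problem has a unique solution
  depending on its data through a bounded operator; hence the correctors are smooth in \<open>(t, x)\<close>.
  By induction on \<open>\<ell>\<close>, the vanishing of the oscillating part of \<open>w\<^sub>\<ell>\<^sub>-\<^sub>2\<close> says that \<open>u\<^sub>\<ell>\<close> and
  \<open>\<Sum>\<^sub>n \<chi>\<^sub>n \<pi> u\<^sub>\<ell>\<^sub>-\<^sub>n\<close> solve the same cell problem with the same mean. Inserting this expansion in
  \<open>\<pi> w\<^sub>j\<close>, where the term \<open>A\<^sub>y\<^sub>y u\<^sub>j\<^sub>+\<^sub>2\<close> has mean zero, gives the formula.\<close>

section \<open>The Hilbert space of square integrable functions on the torus\<close>

text \<open>\<open>wgrad\<close>, \<open>hpd\<close> and \<open>ayy_inv\<close> are choices: at a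
  given (t, x) only the class of their value up to null sets is determined, so no algebraic law can
  be read off the definitions. On classes, however, the weak gradient, the derivative in (t, x) and
  the mean-zero solution of the cell problem are unique, and each chosen value is identified
  afterwards through its class. Keeping the gradient inside the vector turns differentiation in y
  into multiplication by a bounded field, so that the operators of the equation become bounded and
  pass through limits of difference quotients; as the coefficients depend on y alone, they commute
  with derivatives in (t, x). A second obstacle is that the equation differentiates the profiles in
  (t, x): an expansion of \<open>u l\<close> known for values must be known for all derivatives
  before it can be inserted, hence functions travel with the whole family of their derivatives.
  Finally, the weak equation is given for smooth tests only, whereas the energy argument for
  uniqueness tests with the solution itself; this is where density of smooth functions
  enters.\<close>

interpretation cube: finite_measure "lebesgue_on (cube :: (real^'d::finite) set)"
  by standard (simp add: cube_def emeasure_restrict_space)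

lemma measure_cube: "measure (lebesgue_on cube) (cube :: (real^'d::finite) set) = 1"
  by (simp add: cube_def measure_restrict_space content_cbox_if mem_box box_eq_empty)

definition square_integrable :: "(real^'d::finite \<Rightarrow> 'b::euclidean_space) \<Rightarrow> bool" where
  "square_integrable f \<longleftrightarrow> f \<in> borel_measurable (lebesgue_on cube) \<and>
     integrable (lebesgue_on cube) (\<lambda>y. (norm (f y))\<^sup>2)"

lemma square_integrable_measurable [measurable_dest]:
  "square_integrable f \<Longrightarrow> f \<in> borel_measurable (lebesgue_on cube)"
  by (simp add: square_integrable_def)

lemma square_integrable_bound:
  fixes f :: "real^'d::finite \<Rightarrow> 'b::euclidean_space" and g :: "real^'d \<Rightarrow> 'c::euclidean_space"
  assumes f: "square_integrable f" and [measurable]: "g \<in> borel_measurable (lebesgue_on cube)"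
    and le: "AE y in lebesgue_on cube. norm (g y) \<le> C * norm (f y)"
  shows "square_integrable g"
proof -
  have "integrable (lebesgue_on cube) (\<lambda>y. (norm (g y))\<^sup>2)"
  proof (rule Bochner_Integration.integrable_bound)
    show "integrable (lebesgue_on cube) (\<lambda>y. C\<^sup>2 * (norm (f y))\<^sup>2)"
      using f by (simp add: square_integrable_def)
    show "AE y in lebesgue_on cube. norm ((norm (g y))\<^sup>2) \<le> norm (C\<^sup>2 * (norm (f y))\<^sup>2)"
      using le
    proof (rule eventually_mono)
      fix y assume "norm (g y) \<le> C * norm (f y)"
      then have "(norm (g y))\<^sup>2 \<le> (C * norm (f y))\<^sup>2"
        by (intro power_mono) auto
      then show "norm ((norm (g y))\<^sup>2) \<le> norm (C\<^sup>2 * (norm (f y))\<^sup>2)"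
        by (simp add: power_mult_distrib)
    qed
  qed simp
  then show ?thesis by (simp add: square_integrable_def)
qed

lemma square_integrable_inner:
  fixes f g :: "real^'d::finite \<Rightarrow> 'b::euclidean_space"
  assumes "square_integrable f" "square_integrable g"
  shows "integrable (lebesgue_on cube) (\<lambda>y. f y \<bullet> g y)"
proof (rule Bochner_Integration.integrable_bound)
  show "integrable (lebesgue_on cube) (\<lambda>y. (norm (f y))\<^sup>2 + (norm (g y))\<^sup>2)"
    using assms by (simp add: square_integrable_def)
  show "(\<lambda>y. f y \<bullet> g y) \<in> borel_measurable (lebesgue_on cube)"
    using assms by (intro borel_measurable_inner) (auto simp: square_integrable_def)
  have "\<bar>f y \<bullet> g y\<bar> \<le> (norm (f y))\<^sup>2 + (norm (g y))\<^sup>2" for y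
  proof -
    have "\<bar>f y \<bullet> g y\<bar> \<le> norm (f y) * norm (g y)" by (rule Cauchy_Schwarz_ineq2)
    moreover have "2 * (norm (f y) * norm (g y)) \<le> (norm (f y))\<^sup>2 + (norm (g y))\<^sup>2"
      using sum_squares_bound[of "norm (f y)" "norm (g y)"] by (simp add: algebra_simps)
    moreover have "0 \<le> norm (f y) * norm (g y)" by simp
    ultimately show ?thesis by linarith
  qed
  then show "AE y in lebesgue_on cube. norm (f y \<bullet> g y) \<le> norm ((norm (f y))\<^sup>2 + (norm (g y))\<^sup>2)"
    by simp
qed

lemma square_integrable_zero [simp]: "square_integrable (\<lambda>_. 0)"
  by (simp add: square_integrable_def)

lemma square_integrable_scaleR:
  "square_integrable f \<Longrightarrow> square_integrable (\<lambda>y. c *\<^sub>R f y)"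
  by (rule square_integrable_bound[where C = "\<bar>c\<bar>"]) (auto simp: square_integrable_def)

lemma square_integrable_uminus: "square_integrable f \<Longrightarrow> square_integrable (\<lambda>y. - f y)"
  using square_integrable_scaleR[of f "-1"] by simp

lemma square_integrable_add:
  assumes f: "square_integrable f" and g: "square_integrable g"
  shows "square_integrable (\<lambda>y. f y + g y)"
proof -
  have eq: "(norm (f y + g y))\<^sup>2 = (norm (f y))\<^sup>2 + 2 * (f y \<bullet> g y) + (norm (g y))\<^sup>2" for y
    by (simp add: power2_norm_eq_inner inner_add_left inner_add_right inner_commute)
  show ?thesis
    unfolding square_integrable_def eq
    using assms square_integrable_inner[OF f g] by (auto simp: square_integrable_def)
qed

lemma square_integrable_diff:
  "square_integrable f \<Longrightarrow> square_integrable g \<Longrightarrow> square_integrable (\<lambda>y. f y - g y)"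
  using square_integrable_add[of f "\<lambda>y. - g y"] square_integrable_uminus[of g] by simp

lemma square_integrable_bounded:
  assumes "f \<in> borel_measurable (lebesgue_on cube)" "AE y in lebesgue_on cube. norm (f y) \<le> C"
  shows "square_integrable f"
proof -
  have "square_integrable (\<lambda>_. 1::real)" by (simp add: square_integrable_def)
  then show ?thesis
    by (rule square_integrable_bound[where C = C]) (use assms in auto)
qed

lemma square_integrable_continuous:
  assumes "continuous_on UNIV f"
  shows "square_integrable (f :: real^'d::finite \<Rightarrow> 'b::euclidean_space)"
proof -
  have "compact (f ` cube)"
    using assms by (intro compact_continuous_image) (auto simp: cube_def intro: continuous_on_subset)
  then obtain C where "\<And>y. y \<in> cube \<Longrightarrow> norm (f y) \<le> C"
    using bounded_iff compact_imp_bounded by (metis imageI)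
  moreover have "f \<in> borel_measurable (lebesgue_on cube)"
    by (rule continuous_imp_measurable_on_sets_lebesgue)
       (use assms in \<open>auto simp: cube_def intro: continuous_on_subset\<close>)
  ultimately show ?thesis
    by (intro square_integrable_bounded[where C = C]) auto
qed

text \<open>A function is related to itself exactly when it is square integrable, so one partial
  relation both cuts out the space and identifies functions up to null sets.\<close>

definition l2rel :: "(real^'d::finite \<Rightarrow> 'b::euclidean_space) \<Rightarrow> (real^'d \<Rightarrow> 'b) \<Rightarrow> bool" where
  "l2rel f g \<longleftrightarrow> square_integrable f \<and> square_integrable g \<and> (AE y in lebesgue_on cube. f y = g y)"

lemma part_equivp_l2rel: "part_equivp l2rel"
proof (rule part_equivpI)
  show "\<exists>f. l2rel f f" by (intro exI[of _ "\<lambda>_. 0"]) (simp add: l2rel_def)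
  show "symp l2rel" by (rule sympI) (auto simp: l2rel_def elim: eventually_mono)
  show "transp l2rel" 
  proof (rule transpI)
    fix f g h assume "l2rel f g" "l2rel g h"
    moreover from this have "AE y in lebesgue_on cube. f y = g y" "AE y in lebesgue_on cube. g y = h y"
      by (auto simp: l2rel_def)
    then have "AE y in lebesgue_on cube. f y = h y" by eventually_elim simp
    ultimately show "l2rel f h" by (simp add: l2rel_def)
  qed
qed

quotient_type (overloaded) ('d, 'b) l2 = "real^'d::finite \<Rightarrow> 'b::euclidean_space" / partial: l2rel
  by (rule part_equivp_l2rel)

instantiation l2 :: (finite, euclidean_space) real_vector
begin

lift_definition zero_l2 :: "('a, 'b) l2" is "\<lambda>_. 0"
  by (simp add: l2rel_def)

lift_definition plus_l2 :: "('a, 'b) l2 \<Rightarrow> ('a, 'b) l2 \<Rightarrow> ('a, 'b) l2" is "\<lambda>f g y. f y + g y"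
  by (auto simp: l2rel_def intro: square_integrable_add)

lift_definition minus_l2 :: "('a, 'b) l2 \<Rightarrow> ('a, 'b) l2 \<Rightarrow> ('a, 'b) l2" is "\<lambda>f g y. f y - g y"
  by (auto simp: l2rel_def intro: square_integrable_diff)

lift_definition uminus_l2 :: "('a, 'b) l2 \<Rightarrow> ('a, 'b) l2" is "\<lambda>f y. - f y"
  by (auto simp: l2rel_def intro: square_integrable_uminus)

lift_definition scaleR_l2 :: "real \<Rightarrow> ('a, 'b) l2 \<Rightarrow> ('a, 'b) l2" is "\<lambda>c f y. c *\<^sub>R f y"
  by (auto simp: l2rel_def intro: square_integrable_scaleR)

instance
proof
  fix x y z :: "('a, 'b) l2" and r s :: real
  show "x + y + z = x + (y + z)" by transfer (auto simp: l2rel_def algebra_simps intro: square_integrable_add)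
  show "x + y = y + x" by transfer (auto simp: l2rel_def algebra_simps intro: square_integrable_add)
  show "0 + x = x" by transfer (auto simp: l2rel_def)
  show "- x + x = 0" by transfer (auto simp: l2rel_def)
  show "x - y = x + - y" by transfer (auto simp: l2rel_def intro: square_integrable_diff)
  show "r *\<^sub>R (x + y) = r *\<^sub>R x + r *\<^sub>R y"
    by transfer (auto simp: l2rel_def scaleR_add_right intro: square_integrable_add square_integrable_scaleR)
  show "(r + s) *\<^sub>R x = r *\<^sub>R x + s *\<^sub>R x"
    by transfer (auto simp: l2rel_def scaleR_add_left intro: square_integrable_add square_integrable_scaleR)
  show "r *\<^sub>R s *\<^sub>R x = (r * s) *\<^sub>R x"
    by transfer (auto simp: l2rel_def intro: square_integrable_scaleR)
  show "1 *\<^sub>R x = x" by transfer (auto simp: l2rel_def)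
qed

end

instantiation l2 :: (finite, euclidean_space) real_inner
begin

lift_definition inner_l2 :: "('a, 'b) l2 \<Rightarrow> ('a, 'b) l2 \<Rightarrow> real"
  is "\<lambda>f g. integral\<^sup>L (lebesgue_on cube) (\<lambda>y. f y \<bullet> g y)"
proof -
  fix f f' g g' :: "real^'a \<Rightarrow> 'b"
  assume "l2rel f f'" "l2rel g g'"
  then show "(LINT y|lebesgue_on cube. f y \<bullet> g y) = (LINT y|lebesgue_on cube. f' y \<bullet> g' y)"
    by (intro integral_cong_AE) (auto simp: l2rel_def square_integrable_def)
qed

definition norm_l2 :: "('a, 'b) l2 \<Rightarrow> real" where "norm_l2 x = sqrt (x \<bullet> x)"
definition dist_l2 :: "('a, 'b) l2 \<Rightarrow> ('a, 'b) l2 \<Rightarrow> real" where "dist_l2 x y = norm (x - y)"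
definition sgn_l2 :: "('a, 'b) l2 \<Rightarrow> ('a, 'b) l2" where "sgn_l2 x = x /\<^sub>R norm x"
definition uniformity_l2 :: "(('a, 'b) l2 \<times> ('a, 'b) l2) filter" where
  "uniformity_l2 = (INF e\<in>{0 <..}. principal {(x, y). dist x y < e})"
definition open_l2 :: "('a, 'b) l2 set \<Rightarrow> bool" where
  "open_l2 U = (\<forall>x\<in>U. eventually (\<lambda>(x', y). x' = x \<longrightarrow> y \<in> U) uniformity)"

instance
proof
  fix x y z :: "('a, 'b) l2" and r :: real and U :: "('a, 'b) l2 set"
  show "x \<bullet> y = y \<bullet> x" by transfer (simp add: inner_commute)
  show "(x + y) \<bullet> z = x \<bullet> z + y \<bullet> z"
    by transfer (auto simp: l2rel_def inner_add_left square_integrable_inner)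
  show "r *\<^sub>R x \<bullet> y = r * (x \<bullet> y)"
    by transfer auto
  show "0 \<le> x \<bullet> x" by transfer simp
  show "x \<bullet> x = 0 \<longleftrightarrow> x = 0"
  proof transfer
    fix f :: "real^'a \<Rightarrow> 'b" assume "l2rel f f"
    then have f: "square_integrable f" by (simp add: l2rel_def)
    have "integral\<^sup>L (lebesgue_on cube) (\<lambda>y. f y \<bullet> f y) = 0 \<longleftrightarrow> (AE y in lebesgue_on cube. f y \<bullet> f y = 0)"
      by (rule integral_nonneg_eq_0_iff_AE) (simp_all add: square_integrable_inner f)
    then show "(integral\<^sup>L (lebesgue_on cube) (\<lambda>y. f y \<bullet> f y) = 0) = l2rel f (\<lambda>_. 0)"
      by (simp add: l2rel_def f)
  qed
  show "norm x = sqrt (x \<bullet> x)" by (rule norm_l2_def)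
  show "dist x y = norm (x - y)" by (rule dist_l2_def)
  show "sgn x = x /\<^sub>R norm x" by (rule sgn_l2_def)
  show "(uniformity :: (('a, 'b) l2 \<times> ('a, 'b) l2) filter) = (INF e\<in>{0 <..}. principal {(x, y). dist x y < e})"
    by (rule uniformity_l2_def)
  show "open U = (\<forall>x\<in>U. eventually (\<lambda>(x', y). x' = x \<longrightarrow> y \<in> U) uniformity)"
    by (rule open_l2_def)
qed

end

text \<open>Total on functions: outside the square integrable ones its value carries no information,
  hence the integrability premises in the rules that follow.\<close>

definition cl :: "(real^'d::finite \<Rightarrow> 'b::euclidean_space) \<Rightarrow> ('d, 'b) l2" where
  "cl f = abs_l2 f"

lemma cl_eq_iff:
  assumes "square_integrable f" "square_integrable g"
  shows "cl f = cl g \<longleftrightarrow> (AE y in lebesgue_on cube. f y = g y)"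
  using Quotient3_rel[OF Quotient3_l2, of f g] assms by (auto simp: cl_def l2rel_def)

lemma cl_eqI: "square_integrable f \<Longrightarrow> square_integrable g \<Longrightarrow>
    (AE y in lebesgue_on cube. f y = g y) \<Longrightarrow> cl f = cl g"
  by (simp add: cl_eq_iff)

lemma cl_cases [case_names cl, cases type: l2]:
  obtains f where "square_integrable f" "x = cl f"
  by (induction x rule: l2.abs_induct) (auto simp: cl_def l2rel_def)

lemma cl_zero: "cl (\<lambda>_. 0) = 0"
  by (simp add: cl_def zero_l2_def)

lemma cl_add: "square_integrable f \<Longrightarrow> square_integrable g \<Longrightarrow> cl f + cl g = cl (\<lambda>y. f y + g y)"
  by (simp add: cl_def plus_l2.abs_eq l2rel_def)

lemma cl_diff: "square_integrable f \<Longrightarrow> square_integrable g \<Longrightarrow> cl f - cl g = cl (\<lambda>y. f y - g y)"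
  by (simp add: cl_def minus_l2.abs_eq l2rel_def)

lemma cl_uminus: "square_integrable f \<Longrightarrow> - cl f = cl (\<lambda>y. - f y)"
  by (simp add: cl_def uminus_l2.abs_eq l2rel_def)

lemma cl_scaleR: "square_integrable f \<Longrightarrow> c *\<^sub>R cl f = cl (\<lambda>y. c *\<^sub>R f y)"
  by (simp add: cl_def scaleR_l2.abs_eq l2rel_def)

lemma inner_cl: "square_integrable f \<Longrightarrow> square_integrable g \<Longrightarrow>
    cl f \<bullet> cl g = integral\<^sup>L (lebesgue_on cube) (\<lambda>y. f y \<bullet> g y)"
  by (simp add: cl_def inner_l2.abs_eq l2rel_def)

lemma norm_cl: "square_integrable f \<Longrightarrow>
    (norm (cl f))\<^sup>2 = integral\<^sup>L (lebesgue_on cube) (\<lambda>y. (norm (f y))\<^sup>2)"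
  by (simp add: power2_norm_eq_inner inner_cl)

lemma norm_cl_le:
  assumes f: "square_integrable f" and le: "AE y in lebesgue_on cube. norm (f y) \<le> C" and C: "0 \<le> C"
  shows "norm (cl f) \<le> C"
proof -
  have "(norm (cl f))\<^sup>2 \<le> integral\<^sup>L (lebesgue_on (cube :: (real^'a) set)) (\<lambda>y. C\<^sup>2)"
    unfolding norm_cl[OF f]
    using f le by (intro integral_mono_AE) (auto simp: square_integrable_def elim!: eventually_mono intro: power_mono)
  also have "\<dots> = C\<^sup>2" by (simp add: measure_cube)
  finally show ?thesis using C by (simp add: power2_le_iff_abs_le)
qed

lemma norm_le_pointwise:
  assumes f: "square_integrable f" and g: "square_integrable g"
    and le: "AE y in lebesgue_on cube. norm (f y) \<le> C * norm (g y)" and C: "0 \<le> C"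
  shows "norm (cl f) \<le> C * norm (cl g)"
proof -
  have "(norm (cl f))\<^sup>2 \<le> integral\<^sup>L (lebesgue_on cube) (\<lambda>y. C\<^sup>2 * (norm (g y))\<^sup>2)"
    unfolding norm_cl[OF f]
  proof (rule integral_mono_AE)
    show "AE y in lebesgue_on cube. (norm (f y))\<^sup>2 \<le> C\<^sup>2 * (norm (g y))\<^sup>2"
      using le
    proof (rule eventually_mono)
      fix y assume "norm (f y) \<le> C * norm (g y)"
      then have "(norm (f y))\<^sup>2 \<le> (C * norm (g y))\<^sup>2" by (intro power_mono) auto
      then show "(norm (f y))\<^sup>2 \<le> C\<^sup>2 * (norm (g y))\<^sup>2" by (simp add: power_mult_distrib)
    qed
  qed (use f g in \<open>auto simp: square_integrable_def\<close>)
  also have "\<dots> = (C * norm (cl g))\<^sup>2" by (simp add: power_mult_distrib norm_cl[OF g])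
  finally show ?thesis
    using C by (auto intro: power2_le_imp_le)
qed

text \<open>Riesz-Fischer: a rapidly converging subsequence converges almost everywhere because
  the \<open>L\<^sup>1\<close> norms of its increments are summable; Fatou's lemma makes the
  pointwise limit a limit in mean square.\<close>

lemma nn_integral_le_norm_cl:
  fixes f :: "real^'d::finite \<Rightarrow> 'b::euclidean_space"
  assumes f: "square_integrable f"
  shows "(\<integral>\<^sup>+ y. ennreal (norm (f y)) \<partial>lebesgue_on cube) \<le> ennreal (norm (cl f))"
proof -
  have 1: "square_integrable (\<lambda>_::real^'d. 1::real)" by (simp add: square_integrable_def)
  have g: "square_integrable (\<lambda>y. norm (f y))"
    by (rule square_integrable_bound[OF f, where C = 1]) (use f in \<open>auto simp: square_integrable_def\<close>)
  \<comment> \<open>The L^1 norm is a pairing with the constant one, whose norm is at most one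
    because the cube has unit measure.\<close>
  have "cl (\<lambda>y. norm (f y)) \<bullet> cl (\<lambda>_. 1) \<le> norm (cl (\<lambda>y. norm (f y))) * norm (cl (\<lambda>_::real^'d. 1::real))"
    by (rule norm_cauchy_schwarz)
  also have "norm (cl (\<lambda>_::real^'d. 1::real)) \<le> 1" by (rule norm_cl_le[OF 1]) auto
  hence "norm (cl (\<lambda>y. norm (f y))) * norm (cl (\<lambda>_::real^'d. 1::real)) \<le> norm (cl (\<lambda>y. norm (f y))) * 1"
    by (intro mult_left_mono) auto
  also have "norm (cl (\<lambda>y. norm (f y))) \<le> 1 * norm (cl f)"
    by (rule norm_le_pointwise[OF g f]) auto
  finally have *: "integral\<^sup>L (lebesgue_on cube) (\<lambda>y. norm (f y)) \<le> norm (cl f)"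
    by (simp add: inner_cl[OF g 1])
  have "integrable (lebesgue_on cube) (\<lambda>y. norm (f y))"
    using square_integrable_inner[OF g 1] by simp
  then show ?thesis
    using * by (subst nn_integral_eq_integral) (auto intro: ennreal_leI)
qed

lemma AE_convergent_if_rapidly_Cauchy:
  fixes f :: "nat \<Rightarrow> real^'d::finite \<Rightarrow> 'b::euclidean_space"
  assumes f: "\<And>n. square_integrable (f n)"
    and C: "\<And>n. norm (cl (f (Suc n)) - cl (f n)) \<le> (1/2)^n"
  shows "AE y in lebesgue_on cube. convergent (\<lambda>n. f n y)"
proof -
  define d where "d n y = norm (f (Suc n) y - f n y)" for n y
  have [measurable]: "f n \<in> borel_measurable (lebesgue_on cube)" for n
    using f by (simp add: square_integrable_def)
  have dm [measurable]: "d n \<in> borel_measurable (lebesgue_on cube)" for n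
    unfolding d_def by measurable
  have "(\<integral>\<^sup>+ y. (\<Sum>n. ennreal (d n y)) \<partial>lebesgue_on cube) = (\<Sum>n. \<integral>\<^sup>+ y. ennreal (d n y) \<partial>lebesgue_on cube)"
    by (rule nn_integral_suminf) measurable
  also have "\<dots> \<le> (\<Sum>n. ennreal ((1/2)^n))"
  proof (rule suminf_le)
    fix n
    have "(\<integral>\<^sup>+ y. ennreal (d n y) \<partial>lebesgue_on cube) \<le> ennreal (norm (cl (\<lambda>y. f (Suc n) y - f n y)))"
      unfolding d_def by (rule nn_integral_le_norm_cl[OF square_integrable_diff[OF f f]])
    also have "\<dots> \<le> ennreal ((1/2)^n)"
      using C[of n] by (intro ennreal_leI) (simp add: cl_diff[OF f f])
    finally show "(\<integral>\<^sup>+ y. ennreal (d n y) \<partial>lebesgue_on cube) \<le> ennreal ((1/2)^n)" .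
  qed auto
  also have "\<dots> = ennreal (\<Sum>n. (1/2)^n)"
    by (rule suminf_ennreal2) (auto intro: summable_geometric)
  also have "\<dots> < \<infinity>" by simp
  finally have "(\<integral>\<^sup>+ y. (\<Sum>n. ennreal (d n y)) \<partial>lebesgue_on cube) \<noteq> \<infinity>" by simp
  then have "AE y in lebesgue_on cube. (\<Sum>n. ennreal (d n y)) \<noteq> \<infinity>"
    by (intro nn_integral_PInf_AE) measurable
  then show ?thesis
  proof (rule eventually_mono)
    fix y assume "(\<Sum>n. ennreal (d n y)) \<noteq> \<infinity>"
    then have "summable (\<lambda>n. d n y)"
      by (intro summable_suminf_not_top) (auto simp: d_def)
    then have "summable (\<lambda>n. f (Suc n) y - f n y)"
      unfolding d_def by (rule summable_norm_cancel)
    then have "convergent (\<lambda>n. \<Sum>i<n. f (Suc i) y - f i y)"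
      by (simp add: summable_iff_convergent)
    then have "convergent (\<lambda>n. f 0 y + (\<Sum>i<n. f (Suc i) y - f i y))"
      by (intro convergent_add convergent_const)
    also have "(\<lambda>n. f 0 y + (\<Sum>i<n. f (Suc i) y - f i y)) = (\<lambda>n. f n y)"
      by (simp add: sum_lessThan_telescope[of "\<lambda>i. f i y"])
    finally show "convergent (\<lambda>n. f n y)" .
  qed
qed

text \<open>The bound is asked only from \<open>N\<close> on because completeness applies it to the
  differences f_m - f_n with n fixed, which are controlled only for m at least n.\<close>

lemma Fatou_cl:
  fixes f :: "nat \<Rightarrow> real^'d::finite \<Rightarrow> 'b::euclidean_space"
  assumes f: "\<And>n. square_integrable (f n)" and [measurable]: "g \<in> borel_measurable (lebesgue_on cube)"
    and lim: "AE y in lebesgue_on cube. (\<lambda>n. f n y) \<longlonglongrightarrow> g y"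
    and le: "\<And>n. n \<ge> N \<Longrightarrow> norm (cl (f n)) \<le> e"
  shows "square_integrable g" "norm (cl g) \<le> e"
proof -
  have [measurable]: "f n \<in> borel_measurable (lebesgue_on cube)" for n
    using f by (simp add: square_integrable_def)
  have e: "e \<ge> 0" using le[of N] norm_ge_zero[of "cl (f N)"] by linarith
  have "(\<integral>\<^sup>+ y. ennreal ((norm (g y))\<^sup>2) \<partial>lebesgue_on cube) =
        (\<integral>\<^sup>+ y. liminf (\<lambda>n. ennreal ((norm (f n y))\<^sup>2)) \<partial>lebesgue_on cube)"
  proof (rule nn_integral_cong_AE)
    show "AE y in lebesgue_on cube. ennreal ((norm (g y))\<^sup>2) = liminf (\<lambda>n. ennreal ((norm (f n y))\<^sup>2))"
      using lim
    proof (rule eventually_mono)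
      fix y assume "(\<lambda>n. f n y) \<longlonglongrightarrow> g y"
      then have "(\<lambda>n. ennreal ((norm (f n y))\<^sup>2)) \<longlonglongrightarrow> ennreal ((norm (g y))\<^sup>2)"
        by (intro tendsto_intros)
      then show "ennreal ((norm (g y))\<^sup>2) = liminf (\<lambda>n. ennreal ((norm (f n y))\<^sup>2))"
        by (intro lim_imp_Liminf[symmetric]) auto
    qed
  qed
  also have "\<dots> \<le> liminf (\<lambda>n. \<integral>\<^sup>+ y. ennreal ((norm (f n y))\<^sup>2) \<partial>lebesgue_on cube)"
    by (rule nn_integral_liminf) measurable
  also have "\<dots> \<le> ennreal (e\<^sup>2)"
  proof (rule Liminf_le)
    show "eventually (\<lambda>n. (\<integral>\<^sup>+ y. ennreal ((norm (f n y))\<^sup>2) \<partial>lebesgue_on cube) \<le> ennreal (e\<^sup>2)) sequentially"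
    proof (rule eventually_sequentiallyI[of N])
      fix n assume "N \<le> n"
      have "(\<integral>\<^sup>+ y. ennreal ((norm (f n y))\<^sup>2) \<partial>lebesgue_on cube) = ennreal ((norm (cl (f n)))\<^sup>2)"
        unfolding norm_cl[OF f] using f by (intro nn_integral_eq_integral) (auto simp: square_integrable_def)
      also have "\<dots> \<le> ennreal (e\<^sup>2)"
        using le[OF \<open>N \<le> n\<close>] by (intro ennreal_leI power_mono) auto
      finally show "(\<integral>\<^sup>+ y. ennreal ((norm (f n y))\<^sup>2) \<partial>lebesgue_on cube) \<le> ennreal (e\<^sup>2)" .
    qed
  qed auto
  finally have bd: "(\<integral>\<^sup>+ y. ennreal ((norm (g y))\<^sup>2) \<partial>lebesgue_on cube) \<le> ennreal (e\<^sup>2)" .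
  then have "integrable (lebesgue_on cube) (\<lambda>y. (norm (g y))\<^sup>2)"
    by (intro integrableI_nonneg) (auto elim!: order.strict_trans1)
  then show g: "square_integrable g" by (simp add: square_integrable_def)
  have "ennreal ((norm (cl g))\<^sup>2) \<le> ennreal (e\<^sup>2)"
    using bd g unfolding norm_cl[OF g]
    by (subst (asm) nn_integral_eq_integral) (auto simp: square_integrable_def)
  then show "norm (cl g) \<le> e"
    using e by (auto intro: power2_le_imp_le)
qed

instance l2 :: (finite, euclidean_space) complete_space
proof
  fix X :: "nat \<Rightarrow> ('a, 'b) l2"
  assume X: "Cauchy X"
  have "\<exists>k. strict_mono k \<and> (\<forall>n. \<forall>m\<ge>k n. \<forall>m'\<ge>k n. dist (X m) (X m') < (1/2)^n)"
  proof -
    have "\<exists>K. \<forall>m\<ge>K. \<forall>m'\<ge>K. dist (X m) (X m') < (1/2)^n" for n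
      using X by (intro metric_CauchyD) auto
    then obtain K where K: "\<And>n m m'. m \<ge> K n \<Longrightarrow> m' \<ge> K n \<Longrightarrow> dist (X m) (X m') < (1/2)^n" by metis
    \<comment> \<open>The sum dominates \<open>K n\<close>, and the summand n makes the sequence
      strictly increasing.\<close>
    define k where "k n = n + (\<Sum>i\<le>n. K i)" for n
    have "K n \<le> k n" for n unfolding k_def by (simp add: member_le_sum trans_le_add2)
    moreover have "strict_mono k" by (rule strict_mono_Suc_iff[THEN iffD2]) (simp add: k_def)
    ultimately show ?thesis using K by (meson order_trans)
  qed
  then obtain k where k: "strict_mono k"
    and kX: "\<And>n m m'. m \<ge> k n \<Longrightarrow> m' \<ge> k n \<Longrightarrow> dist (X m) (X m') < (1/2)^n" by blast
  have "\<forall>n. \<exists>f. square_integrable f \<and> X (k n) = cl f" by (metis cl_cases)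
  then obtain f where f: "\<And>n. square_integrable (f n)" and Xf: "\<And>n. X (k n) = cl (f n)" by metis
  have cauchy: "norm (cl (f m) - cl (f n)) < (1/2)^n" if "m \<ge> n" for m n
    using kX[of n "k m" "k n"] that k by (simp add: Xf dist_norm strict_mono_less_eq)
  have conv: "AE y in lebesgue_on cube. convergent (\<lambda>n. f n y)"
    by (rule AE_convergent_if_rapidly_Cauchy[OF f]) (use cauchy in \<open>simp add: less_imp_le\<close>)
  \<comment> \<open>The value zero off the convergence set keeps the limit total and measurable; by
    \<open>conv\<close> that set has full measure.\<close>
  define g where "g y = (if convergent (\<lambda>n. f n y) then lim (\<lambda>n. f n y) else 0)" for y
  have [measurable]: "f n \<in> borel_measurable (lebesgue_on cube)" for n
    using f by (simp add: square_integrable_def)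
  have gm [measurable]: "g \<in> borel_measurable (lebesgue_on cube)"
    unfolding g_def convergent_def[symmetric] by (simp add: Cauchy_convergent_iff[symmetric])
  have lim: "AE y in lebesgue_on cube. (\<lambda>n. f n y) \<longlonglongrightarrow> g y"
    using conv by (rule eventually_mono) (simp add: g_def convergent_LIMSEQ_iff)
  have *: "square_integrable (\<lambda>y. g y - f n y)" "norm (cl (\<lambda>y. g y - f n y)) \<le> (1/2)^n" for n
  proof -
    have 1: "square_integrable (\<lambda>y. f m y - f n y)" for m by (intro square_integrable_diff f)
    have 2: "AE y in lebesgue_on cube. (\<lambda>m. f m y - f n y) \<longlonglongrightarrow> g y - f n y"
      using lim by (rule eventually_mono) (intro tendsto_intros)
    have 3: "norm (cl (\<lambda>y. f m y - f n y)) \<le> (1/2)^n" if "m \<ge> n" for m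
      using cauchy[OF that] by (simp add: cl_diff[OF f f])
    show "square_integrable (\<lambda>y. g y - f n y)" "norm (cl (\<lambda>y. g y - f n y)) \<le> (1/2)^n"
      using Fatou_cl[OF 1 _ 2 3, of n] by auto
  qed
  have g: "square_integrable g" using square_integrable_add[OF *(1)[of 0] f[of 0]] by simp
  have "(\<lambda>n. X (k n)) \<longlonglongrightarrow> cl g"
  proof (rule metric_tendsto_imp_tendsto)
    show "(\<lambda>n. (1/2::real)^n) \<longlonglongrightarrow> 0" by (rule LIMSEQ_power_zero) simp
    have "dist (cl (f n)) (cl g) \<le> (1/2)^n" for n
      using *(2)[of n] by (subst dist_commute) (simp add: dist_norm cl_diff[OF g f])
    then show "eventually (\<lambda>n. dist (X (k n)) (cl g) \<le> dist ((1/2::real)^n) 0) sequentially"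
      by (simp add: Xf)
  qed
  then have "X \<longlonglongrightarrow> cl g"
    using Cauchy_converges_subseq[of X k "cl g"] X k by (simp add: o_def)
  then show "convergent X" by (rule convergentI)
qed

section \<open>Pointwise linear operators\<close>

text \<open>Models an essentially bounded matrix coefficient: the bound holds only almost
  everywhere, and measurability is asked for one fixed vector at a time, which is all that
  measurable entries give directly.\<close>

definition bounded_field :: "(real^'d::finite \<Rightarrow> 'b::euclidean_space \<Rightarrow> 'c::euclidean_space) \<Rightarrow> bool" where
  "bounded_field B \<longleftrightarrow> (\<forall>y. linear (B y)) \<and> (\<forall>v. (\<lambda>y. B y v) \<in> borel_measurable (lebesgue_on cube)) \<and>
     (\<exists>C. AE y in lebesgue_on cube. \<forall>v. norm (B y v) \<le> C * norm v)"

text \<open>The field acts on functions, so a representative has to be chosen;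
  \<open>mulop_cl\<close> shows that the resulting class does not depend on it.\<close>

definition mulop :: "(real^'d::finite \<Rightarrow> 'b::euclidean_space \<Rightarrow> 'c::euclidean_space) \<Rightarrow> ('d, 'b) l2 \<Rightarrow> ('d, 'c) l2" where
  "mulop B x = cl (\<lambda>y. B y ((SOME f. square_integrable f \<and> x = cl f) y))"

lemma bounded_field_const: "linear f \<Longrightarrow> bounded_field (\<lambda>_. f)"
  using linear_bounded[of f] by (auto simp: bounded_field_def)

lemma square_integrable_bounded_field:
  fixes B :: "real^'d::finite \<Rightarrow> 'b::euclidean_space \<Rightarrow> 'c::euclidean_space"
  assumes B: "bounded_field B" and f: "square_integrable f"
  shows "square_integrable (\<lambda>y. B y (f y))"
proof -
  have lin: "linear (B y)" for y using B by (simp add: bounded_field_def)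
  have Bm: "(\<lambda>y. B y v) \<in> borel_measurable (lebesgue_on cube)" for v
    using B unfolding bounded_field_def by blast
  obtain C where C: "AE y in lebesgue_on cube. \<forall>v. norm (B y v) \<le> C * norm v"
    using B unfolding bounded_field_def by blast
  \<comment> \<open>Expanding the argument in the basis reduces measurability of
    \<open>B y (f y)\<close> to that of the finitely many functions \<open>B y b\<close> and of the
    coordinates of \<open>f\<close>.\<close>
  have "B y (\<Sum>b\<in>Basis. (f y \<bullet> b) *\<^sub>R b) = (\<Sum>b\<in>Basis. (f y \<bullet> b) *\<^sub>R B y b)" for y
    by (simp only: linear_sum[OF lin] linear_cmul[OF lin])
  then have "B y (f y) = (\<Sum>b\<in>Basis. (f y \<bullet> b) *\<^sub>R B y b)" for y
    by (simp only: euclidean_representation)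
  moreover have "(\<lambda>y. \<Sum>b\<in>Basis. (f y \<bullet> b) *\<^sub>R B y b) \<in> borel_measurable (lebesgue_on cube)"
    by (intro borel_measurable_sum borel_measurable_scaleR borel_measurable_inner
          square_integrable_measurable[OF f] Bm borel_measurable_const)
  ultimately have "(\<lambda>y. B y (f y)) \<in> borel_measurable (lebesgue_on cube)" by simp
  then show ?thesis
    by (rule square_integrable_bound[OF f, where C = C]) (use C in \<open>auto elim: eventually_mono\<close>)
qed

lemma mulop_cl:
  assumes B: "bounded_field B" and f: "square_integrable f"
  shows "mulop B (cl f) = cl (\<lambda>y. B y (f y))"
proof -
  define g where "g = (SOME g. square_integrable g \<and> cl f = cl g)"
  have g: "square_integrable g" "cl f = cl g"
    using someI[of "\<lambda>g. square_integrable g \<and> cl f = cl g" f] f by (auto simp: g_def)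
  then have "AE y in lebesgue_on cube. f y = g y" using f by (simp add: cl_eq_iff)
  then have "AE y in lebesgue_on cube. B y (g y) = B y (f y)" by (rule eventually_mono) simp
  then have "cl (\<lambda>y. B y (g y)) = cl (\<lambda>y. B y (f y))"
    by (rule cl_eqI[OF square_integrable_bounded_field[OF B g(1)] square_integrable_bounded_field[OF B f]])
  then show ?thesis by (simp add: mulop_def g_def)
qed

lemma bounded_linear_mulop:
  assumes B: "bounded_field B"
  shows "bounded_linear (mulop B)"
proof -
  have lin: "linear (B y)" for y using B by (simp add: bounded_field_def)
  note [simp] = mulop_cl[OF B] square_integrable_bounded_field[OF B]
  obtain C where C: "AE y in lebesgue_on cube. \<forall>v. norm (B y v) \<le> C * norm v"
    using B by (auto simp: bounded_field_def)
  show ?thesis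
  proof (rule bounded_linear_intro)
    fix x y :: "('a, 'b) l2" and r :: real
    show "mulop B (x + y) = mulop B x + mulop B y"
      by (cases x, cases y)
         (simp add: cl_add square_integrable_add linear_add[OF lin])
    show "mulop B (r *\<^sub>R x) = r *\<^sub>R mulop B x"
      by (cases x) (simp add: cl_scaleR square_integrable_scaleR linear_cmul[OF lin])
    \<comment> \<open>The essential bound \<open>C\<close> comes without a sign, while
      \<open>norm_le_pointwise\<close> wants a nonnegative constant.\<close>
    show "norm (mulop B x) \<le> norm x * max C 0"
    proof (cases x)
      case (cl f)
      have "norm (cl (\<lambda>y. B y (f y))) \<le> max C 0 * norm (cl f)"
      proof (rule norm_le_pointwise)
        show "AE y in lebesgue_on cube. norm (B y (f y)) \<le> max C 0 * norm (f y)"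
          using C
        proof (rule eventually_mono)
          fix y assume "\<forall>v. norm (B y v) \<le> C * norm v"
          then have "norm (B y (f y)) \<le> C * norm (f y)" by blast
          also have "\<dots> \<le> max C 0 * norm (f y)" by (intro mult_right_mono) auto
          finally show "norm (B y (f y)) \<le> max C 0 * norm (f y)" .
        qed
      qed (use cl in auto)
      then show ?thesis by (simp add: cl mult.commute)
    qed
  qed
qed

section \<open>Integration by parts on the torus\<close>

lemma cube_lebesgue [simp]: "cube \<in> sets lebesgue"
  by (simp add: cube_def)

lemma integrable_continuous_cube:
  fixes f :: "real^'d::finite \<Rightarrow> real"
  assumes "continuous_on UNIV f"
  shows "integrable (lebesgue_on cube) f"
  using square_integrable_inner[OF square_integrable_continuous[OF assms] square_integrable_continuous[of "\<lambda>_. 1"]]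
  by simp

lemma yint_eq_integral:
  assumes "continuous_on UNIV f"
  shows "yint f = integral cube f"
  unfolding yint_def using integrable_continuous_cube[OF assms]
  by (intro lebesgue_integral_eq_integral) simp_all

text \<open>The box stretched by s in direction e is cut in two ways: at height 1 into the cube and
  a top slab, at height s into a bottom slab and the shifted cube. Periodicity makes the two slabs
  contribute equally.\<close>

lemma integral_cube_shift:
  fixes f :: "real^'d::finite \<Rightarrow> real"
  assumes f: "continuous_on UNIV f" and per: "\<And>y. f (y + axis i 1) = f y"
    and s: "0 \<le> s" "s \<le> 1"
  shows "integral cube (\<lambda>y. f (y + s *\<^sub>R axis i 1)) = integral cube f"
proof -
  define e :: "real^'d" where "e = axis i 1"
  have e: "e \<in> Basis" by (simp add: e_def axis_in_Basis_iff)
  have eb: "e \<bullet> b = (if b = e then 1 else 0)" if "b \<in> Basis" for b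
    using e that by (simp add: inner_Basis)
  have int: "f integrable_on cbox a b" for a b
    using f by (intro integrable_continuous continuous_on_subset[OF f]) auto
  let ?I = "\<lambda>a b. integral (cbox a b) f"
  have split: "?I 0 (One + s *\<^sub>R e) = integral (cbox 0 (One + s *\<^sub>R e) \<inter> {x. x \<bullet> e \<le> c}) f
        + integral (cbox 0 (One + s *\<^sub>R e) \<inter> {x. x \<bullet> e \<ge> c}) f" for c
  proof (rule integral_unique[OF has_integral_split])
    show "(f has_integral integral (cbox 0 (One + s *\<^sub>R e) \<inter> {x. x \<bullet> e \<le> c}) f) (cbox 0 (One + s *\<^sub>R e) \<inter> {x. x \<bullet> e \<le> c})"
      using int unfolding interval_split[OF e] by (intro integrable_integral)
    show "(f has_integral integral (cbox 0 (One + s *\<^sub>R e) \<inter> {x. x \<bullet> e \<ge> c}) f) (cbox 0 (One + s *\<^sub>R e) \<inter> {x. x \<bullet> e \<ge> c})"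
      using int unfolding interval_split[OF e] by (intro integrable_integral)
  qed (rule e)
  have mem: "x \<in> cbox u v \<longleftrightarrow> (u \<bullet> e \<le> x \<bullet> e \<and> x \<bullet> e \<le> v \<bullet> e) \<and>
      (\<forall>b\<in>Basis - {e}. u \<bullet> b \<le> x \<bullet> b \<and> x \<bullet> b \<le> v \<bullet> b)" for x u v
    using e by (auto simp: mem_box)
  have eb': "e \<bullet> b = 0" if "b \<in> Basis - {e}" for b using that eb by auto
  have ee: "e \<bullet> e = 1" using eb e by simp
  note box_simps = mem inner_add_left inner_diff_left eb' ee e
  have s1: "cbox 0 (One + s *\<^sub>R e) \<inter> {x. x \<bullet> e \<le> 1} = cbox 0 One"
    by (intro set_eqI) (use s in \<open>auto simp: box_simps\<close>)
  have s2: "cbox 0 (One + s *\<^sub>R e) \<inter> {x. x \<bullet> e \<ge> 1} = cbox e (One + s *\<^sub>R e)"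
    by (intro set_eqI) (use s in \<open>auto simp: box_simps\<close>)
  have s3: "cbox 0 (One + s *\<^sub>R e) \<inter> {x. x \<bullet> e \<le> s} = cbox 0 (One + s *\<^sub>R e - e)"
    by (intro set_eqI) (use s in \<open>auto simp: box_simps\<close>)
  have s4: "cbox 0 (One + s *\<^sub>R e) \<inter> {x. x \<bullet> e \<ge> s} = cbox (s *\<^sub>R e) (One + s *\<^sub>R e)"
    by (intro set_eqI) (use s in \<open>auto simp: box_simps\<close>)
  have "?I e (One + s *\<^sub>R e) = integral (cbox 0 (One + s *\<^sub>R e - e)) (\<lambda>x. f (x + e))"
    using integral_shift_cbox[of e e "One + s *\<^sub>R e" f] by simp
  also have "\<dots> = ?I 0 (One + s *\<^sub>R e - e)" using per by (simp add: e_def)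
  finally have "?I 0 One = ?I (s *\<^sub>R e) (One + s *\<^sub>R e)"
    using split[of 1] split[of s] by (simp add: s1 s2 s3 s4)
  also have "\<dots> = integral (cbox 0 One) (\<lambda>x. f (x + s *\<^sub>R e))"
    using integral_shift_cbox[of "s *\<^sub>R e" "s *\<^sub>R e" "One + s *\<^sub>R e" f] by simp
  finally show ?thesis by (simp add: cube_def e_def)
qed

text \<open>Difference quotients of a periodic function have mean zero by translation invariance,
  and dominated convergence transfers this to the derivative.\<close>

lemma yint_partial_derivative:
  fixes h h' :: "real^'d::finite \<Rightarrow> real"
  assumes h: "continuous_on UNIV h" and h': "continuous_on UNIV h'"
    and der: "\<And>y. ((\<lambda>s. h (y + s *\<^sub>R axis i 1)) has_real_derivative h' y) (at 0)"
    and per: "\<And>y. h (y + axis i 1) = h y"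
  shows "yint h' = 0"
proof -
  define e :: "real^'d" where "e = axis i 1"
  define q where "q n y = (h (y + (1 / real (Suc n)) *\<^sub>R e) - h y) * real (Suc n)" for n y
  have derr: "((\<lambda>r. h (y + r *\<^sub>R e)) has_real_derivative h' (y + s *\<^sub>R e)) (at s)" for y s
    using der[of "y + s *\<^sub>R e"] DERIV_shift[of "\<lambda>r. h (y + r *\<^sub>R e)" "h' (y + s *\<^sub>R e)" 0 s]
    by (simp add: e_def algebra_simps)
  have hs: "continuous_on UNIV (\<lambda>y. h (y + c))" for c
    by (intro continuous_on_compose2[OF h] continuous_intros) auto
  have q0: "integral\<^sup>L (lebesgue_on cube) (q n) = 0" for n
  proof -
    have "yint (\<lambda>y. h (y + (1 / real (Suc n)) *\<^sub>R e)) = yint h"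
      using integral_cube_shift[OF h per, of "1 / real (Suc n)"]
      by (simp add: yint_eq_integral[OF hs] yint_eq_integral[OF h] e_def)
    then show ?thesis
      unfolding q_def yint_def
      by (subst integral_mult_left_zero, subst Bochner_Integration.integral_diff)
         (auto intro: integrable_continuous_cube hs h)
  qed
  \<comment> \<open>The intermediate points of the mean value theorem leave the cube by at most 1 in
    direction e, so the derivative is bounded on the doubled cube.\<close>
  have "compact (h' ` cbox 0 (2 *\<^sub>R One))"
    by (intro compact_continuous_image continuous_on_subset[OF h']) auto
  then obtain C where C: "\<And>y. y \<in> cbox 0 (2 *\<^sub>R One) \<Longrightarrow> \<bar>h' y\<bar> \<le> C"
    by (metis bounded_iff compact_imp_bounded imageI real_norm_def)
  have "(\<lambda>n. integral\<^sup>L (lebesgue_on cube) (q n)) \<longlonglongrightarrow> integral\<^sup>L (lebesgue_on cube) h'"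
  proof (rule integral_dominated_convergence[where w = "\<lambda>_. C"])
    show "h' \<in> borel_measurable (lebesgue_on cube)" using integrable_continuous_cube[OF h'] by auto
    show "q n \<in> borel_measurable (lebesgue_on cube)" for n
      unfolding q_def using integrable_continuous_cube[OF hs] integrable_continuous_cube[OF h]
      by (intro borel_measurable_times borel_measurable_diff) auto
    show "AE y in lebesgue_on cube. (\<lambda>n. q n y) \<longlonglongrightarrow> h' y"
    proof (rule AE_I2)
      fix y
      have "((\<lambda>s. (h (y + s *\<^sub>R e) - h y) / s) \<longlongrightarrow> h' y) (at 0)"
        using der[of y] by (simp add: DERIV_def e_def)
      moreover have "filterlim (\<lambda>n. 1 / real (Suc n)) (at 0) sequentially"
        by (intro filterlim_atI lim_1_over_n[THEN LIMSEQ_Suc]) auto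
      ultimately have "(\<lambda>n. (h (y + (1 / real (Suc n)) *\<^sub>R e) - h y) / (1 / real (Suc n))) \<longlonglongrightarrow> h' y"
        by (rule filterlim_compose)
      then show "(\<lambda>n. q n y) \<longlonglongrightarrow> h' y" by (simp add: q_def)
    qed
    show "AE y in lebesgue_on cube. norm (q n y) \<le> C" for n
    proof (rule AE_I2)
      fix y :: "real^'d" assume y: "y \<in> space (lebesgue_on cube)"
      define s where "s = 1 / real (Suc n)"
      have s: "0 < s" "s \<le> 1" by (auto simp: s_def)
      obtain z where z: "0 < z" "z < s" "h (y + s *\<^sub>R e) - h (y + 0 *\<^sub>R e) = (s - 0) * h' (y + z *\<^sub>R e)"
        using MVT2[of 0 s "\<lambda>r. h (y + r *\<^sub>R e)" "\<lambda>r. h' (y + r *\<^sub>R e)"] s derr by auto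
      have "q n y = h' (y + z *\<^sub>R e)"
        using z(3) s by (simp add: q_def s_def field_simps)
      moreover have "y + z *\<^sub>R e \<in> cbox 0 (2 *\<^sub>R One)"
      proof -
        have "0 \<le> (y + z *\<^sub>R e) \<bullet> b \<and> (y + z *\<^sub>R e) \<bullet> b \<le> 2" if b: "b \<in> Basis" for b
        proof -
          have "0 \<le> y \<bullet> b" "y \<bullet> b \<le> 1" using y b by (auto simp: cube_def mem_box)
          moreover have "e \<bullet> b = (if b = e then 1 else 0)"
            using b by (simp add: e_def inner_Basis axis_in_Basis_iff)
          ultimately show ?thesis using z s by (auto simp: inner_add_left)
        qed
        then show ?thesis by (simp add: mem_box inner_add_left)
      qed
      ultimately show "norm (q n y) \<le> C" using C by auto
    qed
  qed simp
  then have "(\<lambda>n::nat. 0::real) \<longlonglongrightarrow> yint h'" by (simp add: q0 yint_def)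
  then show ?thesis by (simp add: LIMSEQ_const_iff)
qed

section \<open>Smooth periodic test functions\<close>

lemma smooth_fun_pd: "smooth_fun \<phi> \<Longrightarrow> smooth_fun (pd i \<phi>)"
  unfolding smooth_fun_def
proof (intro allI)
  fix "is" assume a: "\<forall>is. continuous_on UNIV (foldr pd is \<phi>) \<and>
            (\<forall>i y. (\<lambda>s. foldr pd is \<phi> (y + s *\<^sub>R axis i 1)) differentiable at 0)"
  show "continuous_on UNIV (foldr pd is (pd i \<phi>)) \<and>
            (\<forall>ia y. (\<lambda>s. foldr pd is (pd i \<phi>) (y + s *\<^sub>R axis ia 1)) differentiable at 0)"
    \<comment> \<open>\<open>foldr\<close> applies the last list entry first, so a derivative taken
      beforehand is appended at the end of the list.\<close>
    using a[rule_format, of "is @ [i]"] by simp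
qed

lemma smooth_fun_continuous: "smooth_fun \<phi> \<Longrightarrow> continuous_on UNIV \<phi>"
  unfolding smooth_fun_def by (drule spec[of _ "[]"]) simp

lemma smooth_fun_pd_derivative:
  assumes "smooth_fun \<phi>"
  shows "((\<lambda>s. \<phi> (y + s *\<^sub>R axis i 1)) has_real_derivative pd i \<phi> y) (at 0)"
proof -
  have "(\<lambda>s. \<phi> (y + s *\<^sub>R axis i 1)) differentiable (at 0)"
    using assms unfolding smooth_fun_def by (drule_tac spec[of _ "[]"]) simp
  then show ?thesis unfolding pd_def by (simp add: DERIV_deriv_iff_real_differentiable)
qed

lemma yint_by_parts:
  assumes \<phi>: "ptest \<phi>" and \<psi>: "ptest \<psi>"
  shows "yint (\<lambda>y. \<phi> y * pd i \<psi> y) = - yint (\<lambda>y. pd i \<phi> y * \<psi> y)"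
proof -
  have s: "smooth_fun \<phi>" "smooth_fun \<psi>" using assms by (auto simp: ptest_def)
  note c = smooth_fun_continuous[OF s(1)] smooth_fun_continuous[OF s(2)]
    smooth_fun_continuous[OF smooth_fun_pd[OF s(1), of i]] smooth_fun_continuous[OF smooth_fun_pd[OF s(2), of i]]
  have "yint (\<lambda>y. pd i \<phi> y * \<psi> y + \<phi> y * pd i \<psi> y) = 0"
  proof (rule yint_partial_derivative)
    show "((\<lambda>s. \<phi> (y + s *\<^sub>R axis i 1) * \<psi> (y + s *\<^sub>R axis i 1)) has_real_derivative
        pd i \<phi> y * \<psi> y + \<phi> y * pd i \<psi> y) (at 0)" for y
      using DERIV_mult[OF smooth_fun_pd_derivative[OF s(1), of y i] smooth_fun_pd_derivative[OF s(2), of y i]]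
      by (simp add: algebra_simps)
    show "\<phi> (y + axis i 1) * \<psi> (y + axis i 1) = \<phi> y * \<psi> y" for y
      using assms by (simp add: ptest_def)
  qed (intro continuous_intros c)+
  then show ?thesis
    unfolding yint_def
    by (subst (asm) Bochner_Integration.integral_add)
       (auto intro!: integrable_continuous_cube continuous_intros c)
qed

section \<open>Trigonometric polynomials are dense\<close>

definition phase :: "int^'d::finite \<Rightarrow> real^'d \<Rightarrow> real" where
  "phase k y = 2 * pi * (\<Sum>i\<in>UNIV. of_int (k $ i) * y $ i)"

definition cosk :: "int^'d::finite \<Rightarrow> real^'d \<Rightarrow> real" where "cosk k y = cos (phase k y)"

definition sink :: "int^'d::finite \<Rightarrow> real^'d \<Rightarrow> real" where "sink k y = sin (phase k y)"

lemma phase_add: "phase (k + l) y = phase k y + phase l y"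
  by (simp add: phase_def algebra_simps sum.distrib)

lemma phase_uminus: "phase (- k) y = - phase k y"
  by (simp add: phase_def sum_negf)

lemma phase_diff: "phase (k - l) y = phase k y - phase l y"
  using phase_add[of k "- l" y] by (simp add: phase_uminus)

lemma phase_zero [simp]: "phase 0 y = 0"
  by (simp add: phase_def)

lemma phase_axis: "phase (axis i 1) y = 2 * pi * y $ i"
  by (simp add: phase_def axis_def if_distrib[of of_int] if_distrib[of "\<lambda>c. c * _"] cong: if_cong)

lemma phase_shift:
  fixes y :: "real^'d::finite"
  shows "phase k (y + s *\<^sub>R axis i 1) = phase k y + 2 * pi * of_int (k $ i) * s"
proof -
  have "(\<Sum>j\<in>UNIV. of_int (k $ j) * (s * (axis i 1 :: real^'d) $ j)) = of_int (k $ i) * s"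
    by (simp add: axis_def if_distrib[of "\<lambda>c. _ * c"] cong: if_cong)
  then show ?thesis by (simp add: phase_def algebra_simps sum.distrib)
qed

lemma continuous_phase [continuous_intros]: "continuous_on A (phase k)"
  unfolding phase_def by (intro continuous_intros)

lemma continuous_cosk [continuous_intros]: "continuous_on A (cosk k)"
  unfolding cosk_def by (intro continuous_intros)

lemma continuous_sink [continuous_intros]: "continuous_on A (sink k)"
  unfolding sink_def by (intro continuous_intros)

lemma derivative_cosk_sink:
  "((\<lambda>s. \<alpha> * cosk k (y + s *\<^sub>R axis i 1) + \<beta> * sink k (y + s *\<^sub>R axis i 1)) has_real_derivative
     2 * pi * of_int (k $ i) * (\<beta> * cosk k y - \<alpha> * sink k y)) (at 0)"
  unfolding cosk_def sink_def phase_shift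
  by (auto intro!: derivative_eq_intros simp: algebra_simps)

lemma pd_cosk_sink:
  "pd i (\<lambda>y. \<alpha> * cosk k y + \<beta> * sink k y) =
     (\<lambda>y. (2 * pi * of_int (k $ i) * \<beta>) * cosk k y + (- 2 * pi * of_int (k $ i) * \<alpha>) * sink k y)"
proof
  fix y
  show "pd i (\<lambda>y. \<alpha> * cosk k y + \<beta> * sink k y) y =
     (2 * pi * of_int (k $ i) * \<beta>) * cosk k y + (- 2 * pi * of_int (k $ i) * \<alpha>) * sink k y"
    unfolding pd_def DERIV_imp_deriv[OF derivative_cosk_sink] by (simp add: algebra_simps)
qed

text \<open>Differentiation turns cosine into sine and back, so neither is stable alone; the plane
  spanned by both is, and the induction on the list of derivatives runs in that plane.\<close>

lemma ptest_cosk_sink: "ptest (\<lambda>y. \<alpha> * cosk k y + \<beta> * sink k y)"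
proof -
  have ex: "\<exists>\<alpha>' \<beta>'. foldr pd is (\<lambda>y. \<alpha> * cosk k y + \<beta> * sink k y) = (\<lambda>y. \<alpha>' * cosk k y + \<beta>' * sink k y)"
    for "is"
  proof (induction "is")
    case (Cons i "is")
    then obtain \<alpha>' \<beta>' where "foldr pd is (\<lambda>y. \<alpha> * cosk k y + \<beta> * sink k y) = (\<lambda>y. \<alpha>' * cosk k y + \<beta>' * sink k y)"
      by blast
    then have "foldr pd (i # is) (\<lambda>y. \<alpha> * cosk k y + \<beta> * sink k y) =
        pd i (\<lambda>y. \<alpha>' * cosk k y + \<beta>' * sink k y)" by simp
    then show ?case unfolding pd_cosk_sink by blast
  qed auto
  have "smooth_fun (\<lambda>y. \<alpha> * cosk k y + \<beta> * sink k y)"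
    unfolding smooth_fun_def
  proof
    fix "is" :: "'a list"
    from ex[of "is"] obtain \<alpha>' \<beta>' where eq:
      "foldr pd is (\<lambda>y. \<alpha> * cosk k y + \<beta> * sink k y) = (\<lambda>y. \<alpha>' * cosk k y + \<beta>' * sink k y)" by blast
    show "continuous_on UNIV (foldr pd is (\<lambda>y. \<alpha> * cosk k y + \<beta> * sink k y)) \<and>
        (\<forall>i y. (\<lambda>s. foldr pd is (\<lambda>y. \<alpha> * cosk k y + \<beta> * sink k y) (y + s *\<^sub>R axis i 1)) differentiable at 0)"
      unfolding eq real_differentiable_def
    proof (intro conjI allI)
      show "\<exists>D. ((\<lambda>s. \<alpha>' * cosk k (y + s *\<^sub>R axis i 1) + \<beta>' * sink k (y + s *\<^sub>R axis i 1))
          has_real_derivative D) (at 0)" for i y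
        by (rule exI, rule derivative_cosk_sink)
    qed (intro continuous_intros)
  qed
  moreover have "cosk k (y + axis i 1) = cosk k y" "sink k (y + axis i 1) = sink k y" for y i
    using phase_shift[of k y 1 i] cos.plus_of_int[of "phase k y" "k $ i"] sin.plus_of_int[of "phase k y" "k $ i"]
    by (simp_all add: cosk_def sink_def mult_ac)
  ultimately show ?thesis by (simp add: ptest_def)
qed

lemma ptest_cosk: "ptest (cosk k)" and ptest_sink: "ptest (sink k)"
  using ptest_cosk_sink[of 1 k 0] ptest_cosk_sink[of 0 k 1] by simp_all

lemma pd_cosk: "pd i (cosk k) = (\<lambda>y. (- 2 * pi * of_int (k $ i)) * sink k y)"
  and pd_sink: "pd i (sink k) = (\<lambda>y. (2 * pi * of_int (k $ i)) * cosk k y)"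
  using pd_cosk_sink[of i 1 k 0] pd_cosk_sink[of i 0 k 1] by simp_all

lemma ptest_continuous: "ptest \<phi> \<Longrightarrow> continuous_on UNIV \<phi>"
  by (simp add: ptest_def smooth_fun_continuous)

lemma continuous_pd: "ptest \<phi> \<Longrightarrow> continuous_on UNIV (pd i \<phi>)"
  by (simp add: ptest_def smooth_fun_continuous smooth_fun_pd)

lemma ptest_one: "ptest (\<lambda>_. 1)"
  using ptest_cosk[of 0] by (simp add: cosk_def[abs_def])

lemma pd_const [simp]: "pd i (\<lambda>_. c) = (\<lambda>_. 0)"
  by (simp add: pd_def)

lemma yint_one: "yint (\<lambda>_::real^'d::finite. 1) = 1"
  by (simp add: yint_def measure_cube)

lemma yint_pd: "ptest \<phi> \<Longrightarrow> yint (pd i \<phi>) = 0"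
  using yint_by_parts[OF ptest_one, of \<phi> i] by (simp add: yint_def)

text \<open>At a nonzero frequency some component is nonzero, and then the function is a multiple of
  a partial derivative of its partner, hence has mean zero.\<close>

lemma yint_cosk: "yint (cosk k) = (if k = 0 then 1 else 0)"
  and yint_sink: "yint (sink k) = 0"
proof -
  show "yint (cosk k) = (if k = 0 then 1 else 0)"
  proof (cases "k = 0")
    case True then show ?thesis by (simp add: cosk_def[abs_def] yint_one)
  next
    case False
    then obtain i where i: "k $ i \<noteq> 0" by (auto simp: vec_eq_iff)
    then show ?thesis using yint_pd[OF ptest_sink, of i k] False
      by (simp add: pd_sink yint_def)
  qed
  show "yint (sink k) = 0"
  proof (cases "k = 0")
    case True then show ?thesis by (simp add: sink_def[abs_def] yint_def)
  next
    case False
    then obtain i where i: "k $ i \<noteq> 0" by (auto simp: vec_eq_iff)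
    then show ?thesis using yint_pd[OF ptest_cosk, of i k]
      by (simp add: pd_cosk yint_def)
  qed
qed

text \<open>The product formulas are kept as explicit linear combinations: in this shape they serve
  both the closure of \<open>trig_polys\<close> under products and the computation of inner
  products.\<close>

lemma cosk_mult_cosk: "cosk k y * cosk l y = (1/2) * cosk (k - l) y + (1/2) * cosk (k + l) y"
  by (simp add: cosk_def phase_add phase_diff cos_times_cos)

lemma sink_mult_sink: "sink k y * sink l y = (1/2) * cosk (k - l) y + (-1/2) * cosk (k + l) y"
  by (simp add: cosk_def sink_def phase_add phase_diff sin_times_sin)

lemma sink_mult_cosk: "sink k y * cosk l y = (1/2) * sink (k + l) y + (1/2) * sink (k - l) y"
  by (simp add: cosk_def sink_def phase_add phase_diff sin_times_cos)

section \<open>The algebra of trigonometric polynomials\<close>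

inductive_set trig_polys :: "(real^'d::finite \<Rightarrow> real) set" where
  cosI: "(\<lambda>y. c * cosk k y) \<in> trig_polys"
| sinI: "(\<lambda>y. c * sink k y) \<in> trig_polys"
| addI: "f \<in> trig_polys \<Longrightarrow> g \<in> trig_polys \<Longrightarrow> (\<lambda>y. f y + g y) \<in> trig_polys"

lemma trig_polys_scale: "f \<in> trig_polys \<Longrightarrow> (\<lambda>y. c * f y) \<in> trig_polys"
proof (induction rule: trig_polys.induct)
  case (cosI a k) show ?case using trig_polys.cosI[of "c * a" k] by (simp add: mult.assoc)
next
  case (sinI a k) show ?case using trig_polys.sinI[of "c * a" k] by (simp add: mult.assoc)
next
  case (addI f g) then show ?case using trig_polys.addI by (simp add: distrib_left)
qed

lemma trig_polys_mult_basis: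
  assumes "g \<in> trig_polys"
  shows "(\<lambda>y. cosk k y * g y) \<in> trig_polys" "(\<lambda>y. sink k y * g y) \<in> trig_polys"
proof -
  have "(\<lambda>y. cosk k y * g y) \<in> trig_polys \<and> (\<lambda>y. sink k y * g y) \<in> trig_polys"
    using assms
  proof (induction rule: trig_polys.induct)
    case (cosI c l)
    have "(\<lambda>y. c * ((1/2) * cosk (k - l) y + (1/2) * cosk (k + l) y)) \<in> trig_polys"
      "(\<lambda>y. c * ((1/2) * sink (k + l) y + (1/2) * sink (k - l) y)) \<in> trig_polys"
      by (intro trig_polys_scale trig_polys.intros)+
    then show ?case by (simp only: cosk_mult_cosk[symmetric] sink_mult_cosk[symmetric] mult.left_commute[of c])
  next
    case (sinI c l)
    have "(\<lambda>y. c * ((1/2) * sink (l + k) y + (1/2) * sink (l - k) y)) \<in> trig_polys"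
      "(\<lambda>y. c * ((1/2) * cosk (k - l) y + (-1/2) * cosk (k + l) y)) \<in> trig_polys"
      by (intro trig_polys_scale trig_polys.intros)+
    then show ?case
      by (simp only: sink_mult_sink[symmetric] sink_mult_cosk[symmetric] mult.left_commute[of c])
         (simp add: mult_ac)
  next
    case (addI f g) then show ?case by (auto simp: distrib_left intro: trig_polys.addI)
  qed
  then show "(\<lambda>y. cosk k y * g y) \<in> trig_polys" "(\<lambda>y. sink k y * g y) \<in> trig_polys" by auto
qed

lemma trig_polys_mult:
  assumes "f \<in> trig_polys" "g \<in> trig_polys"
  shows "(\<lambda>y. f y * g y) \<in> trig_polys"
  using assms
proof (induction rule: trig_polys.induct)
  case (cosI c k) then show ?case
    using trig_polys_scale[OF trig_polys_mult_basis(1)[OF cosI], of c k] by (simp add: mult.assoc)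
next
  case (sinI c k) then show ?case
    using trig_polys_scale[OF trig_polys_mult_basis(2)[OF sinI], of c k] by (simp add: mult.assoc)
next
  case (addI f h) then show ?case using trig_polys.addI by (simp add: distrib_right)
qed

lemma continuous_trig_polys: "f \<in> trig_polys \<Longrightarrow> continuous_on A f"
  by (induction rule: trig_polys.induct) (auto intro!: continuous_intros)

definition Ck :: "int^'d::finite \<Rightarrow> ('d, real) l2" where "Ck k = cl (cosk k)"
definition Sk :: "int^'d::finite \<Rightarrow> ('d, real) l2" where "Sk k = cl (sink k)"

lemma square_integrable_cosk [simp]: "square_integrable (cosk k)"
  and square_integrable_sink [simp]: "square_integrable (sink k)"
  by (intro square_integrable_continuous continuous_intros)+

lemma cl_trig_polys: "f \<in> trig_polys \<Longrightarrow> cl f \<in> span (range Ck \<union> range Sk)"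
proof (induction rule: trig_polys.induct)
  case (cosI c k)
  have "c *\<^sub>R Ck k \<in> span (range Ck \<union> range Sk)" by (intro span_scale span_base) auto
  then show ?case by (simp add: Ck_def cl_scaleR)
next
  case (sinI c k)
  have "c *\<^sub>R Sk k \<in> span (range Ck \<union> range Sk)" by (intro span_scale span_base) auto
  then show ?case by (simp add: Sk_def cl_scaleR)
next
  case (addI f g)
  then have "cl f + cl g \<in> span (range Ck \<union> range Sk)" by (intro span_add) auto
  then show ?case using addI
    by (simp add: cl_add square_integrable_continuous continuous_trig_polys)
qed

text \<open>A continuous function supported inside the cube factors through the torus \<open>T\<close>,
  where Stone-Weierstrass applies.\<close>

definition torus_map :: "real^'d::finite \<Rightarrow> (real^'d) \<times> (real^'d)" where
  "torus_map y = ((\<chi> i. cos (2 * pi * y $ i)), (\<chi> i. sin (2 * pi * y $ i)))"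

lemma continuous_torus_map: "continuous_on A torus_map"
  unfolding torus_map_def by (intro continuous_intros)

lemma mem_cube: "y \<in> cube \<longleftrightarrow> (\<forall>i. 0 \<le> y $ i \<and> y $ i \<le> 1)"
proof -
  have "(One :: real^'a) $ i = 1" for i
    by (simp add: cart_eq_inner_axis axis_in_Basis_iff)
  then show ?thesis by (simp add: cube_def mem_box_cart)
qed

lemma mem_open_cube: "y \<in> box 0 One \<longleftrightarrow> (\<forall>i. 0 < y $ i \<and> y $ i < (1::real))"
proof -
  have "(One :: real^'a) $ i = 1" for i
    by (simp add: cart_eq_inner_axis axis_in_Basis_iff)
  then show ?thesis by (simp add: mem_box_cart)
qed

text \<open>Coordinates with equal cosine and sine differ by an integer, which inside the cube is 0
  or a jump between opposite faces. Identifications thus occur only on the boundary, where the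
  functions to be approximated vanish.\<close>

lemma torus_map_eq:
  assumes "torus_map y = torus_map z" "y \<in> cube" "z \<in> cube"
  shows "y = z \<or> (y \<notin> box 0 One \<and> z \<notin> box 0 One)"
proof (cases "y = z")
  case False
  then obtain i where i: "y $ i \<noteq> z $ i" by (auto simp: vec_eq_iff)
  have "cos (2 * pi * y $ i) = cos (2 * pi * z $ i)" "sin (2 * pi * y $ i) = sin (2 * pi * z $ i)"
    using assms(1) by (auto simp: torus_map_def vec_eq_iff)
  then obtain n :: int where "2 * pi * y $ i = 2 * pi * z $ i + 2 * pi * of_int n"
    using sin_cos_eq_iff by metis
  then have "2 * pi * (y $ i - z $ i - of_int n) = 0" by (simp add: algebra_simps)
  then have n: "y $ i - z $ i = of_int n" by simp
  have "0 \<le> y $ i" "y $ i \<le> 1" "0 \<le> z $ i" "z $ i \<le> 1"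
    using assms by (auto simp: mem_cube)
  moreover from this n i have "n = 1 \<or> n = -1"
  proof -
    have "\<bar>of_int n :: real\<bar> \<le> 1" using n calculation by linarith
    then have "\<bar>n\<bar> \<le> 1" by linarith
    moreover have "n \<noteq> 0" using n i by auto
    ultimately show ?thesis by linarith
  qed
  ultimately have "(y $ i = 1 \<and> z $ i = 0) \<or> (y $ i = 0 \<and> z $ i = 1)" using n by auto
  then show ?thesis unfolding mem_open_cube by (metis less_irrefl)
qed simp

lemma trig_approx_compact_support:
  fixes h :: "real^'d::finite \<Rightarrow> real"
  assumes h: "continuous_on UNIV h" and supp: "\<And>y. y \<notin> box 0 One \<Longrightarrow> h y = 0" and e: "e > 0"
  obtains q where "q \<in> trig_polys" "\<And>y. y \<in> cube \<Longrightarrow> \<bar>h y - q y\<bar> < e"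
proof -
  define T where "T = torus_map ` (cube :: (real^'d) set)"
  have cc: "compact (cube :: (real^'d) set)" by (simp add: cube_def)
  \<comment> \<open>The chosen preimage is ambiguous only for boundary points, and there
    \<open>h\<close> is zero.\<close>
  define F where "F t = h (SOME y. y \<in> cube \<and> torus_map y = t)" for t
  have F: "F (torus_map y) = h y" if "y \<in> cube" for y
  proof -
    define z where "z = (SOME z. z \<in> cube \<and> torus_map z = torus_map y)"
    have "z \<in> cube \<and> torus_map z = torus_map y"
      unfolding z_def by (rule someI[of _ y]) (use that in simp)
    then have "z = y \<or> (z \<notin> box 0 One \<and> y \<notin> box 0 One)" using that by (intro torus_map_eq) auto
    then have "h z = h y" using supp by auto
    then show ?thesis by (simp add: F_def z_def)
  qed
  have torus_mem: "torus_map y \<in> T" if "y \<in> cube" for y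
    using that by (simp add: T_def)
  \<comment> \<open>A continuous map from a compact set onto its Hausdorff image is a quotient map,
    so openness of a preimage under \<open>F\<close> can be tested upstairs in the cube, where it is
    continuity of \<open>h\<close>.\<close>
  have contF: "continuous_on T F"
    unfolding continuous_on_open
  proof (intro allI impI)
    fix U assume "openin (top_of_set (F ` T)) U"
    moreover have "F ` T = h ` cube" unfolding T_def by (auto simp: F image_iff)
    ultimately have "openin (top_of_set cube) (cube \<inter> h -` U)"
      using continuous_on_subset[OF h, of cube] by (simp add: continuous_on_open)
    also have "cube \<inter> h -` U = cube \<inter> torus_map -` (T \<inter> F -` U)"
      by (rule set_eqI) (simp add: F torus_mem cong: conj_cong)
    finally show "openin (top_of_set T) (T \<inter> F -` U)"
      using Abstract_Topology_2.continuous_imp_quotient_map[OF continuous_torus_map T_def[symmetric] cc, of "T \<inter> F -` U"]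
      by auto
  qed
  define R where "R = {g. continuous_on T g \<and> (\<lambda>y. g (torus_map y)) \<in> trig_polys}"
  interpret function_ring_on R T
  proof
    show "compact T" unfolding T_def by (intro compact_continuous_image continuous_torus_map cc)
    show "continuous_on T f" if "f \<in> R" for f using that by (simp add: R_def)
    show "(\<lambda>x. f x + g x) \<in> R" if "f \<in> R" "g \<in> R" for f g
      using that by (auto simp: R_def intro!: continuous_intros trig_polys.addI)
    show "(\<lambda>x. f x * g x) \<in> R" if "f \<in> R" "g \<in> R" for f g
      using that by (auto simp: R_def intro!: continuous_intros trig_polys_mult)
    show "(\<lambda>_. c) \<in> R" for c
      using trig_polys.cosI[of c 0] by (simp add: R_def cosk_def)
    show "\<exists>f\<in>R. f x \<noteq> f y" if "x \<in> T" "y \<in> T" "x \<noteq> y" for x y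
    proof -
      \<comment> \<open>The coordinates of the torus are the cosine and sine at the unit
        frequencies; together they separate points.\<close>
      have c: "(\<lambda>t. fst t $ i) \<in> R" for i
        using trig_polys.cosI[of 1 "axis i 1"]
        by (auto simp: R_def torus_map_def cosk_def phase_axis intro!: continuous_intros)
      have s: "(\<lambda>t. snd t $ i) \<in> R" for i
        using trig_polys.sinI[of 1 "axis i 1"]
        by (auto simp: R_def torus_map_def sink_def phase_axis intro!: continuous_intros)
      from that(3) consider i where "fst x $ i \<noteq> fst y $ i" | i where "snd x $ i \<noteq> snd y $ i"
        unfolding prod_eq_iff vec_eq_iff by metis
      then show ?thesis
      proof cases
        case (1 i) then show ?thesis by (intro bexI[OF _ c[of i]])
      next
        case (2 i) then show ?thesis by (intro bexI[OF _ s[of i]])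
      qed
    qed
  qed
  obtain g where "g \<in> R" "\<forall>x\<in>T. \<bar>F x - g x\<bar> < e"
    using Stone_Weierstrass_basic[OF contF e] by blast
  then show ?thesis
    using that[of "\<lambda>y. g (torus_map y)"] F by (auto simp: R_def T_def)
qed

section \<open>From continuous functions to all square integrable ones\<close>

lemma tendsto_cl_dominated:
  fixes f :: "nat \<Rightarrow> real^'d::finite \<Rightarrow> 'b::euclidean_space"
  assumes f: "\<And>n. square_integrable (f n)" and g: "square_integrable g" and w: "square_integrable w"
    and lim: "AE y in lebesgue_on cube. (\<lambda>n. f n y) \<longlonglongrightarrow> g y"
    and dom: "\<And>n. AE y in lebesgue_on cube. norm (f n y) \<le> w y"
  shows "(\<lambda>n. cl (f n)) \<longlonglongrightarrow> cl g"
proof -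
  have [measurable]: "f n \<in> borel_measurable (lebesgue_on cube)" "g \<in> borel_measurable (lebesgue_on cube)" for n
    using f g by (auto simp: square_integrable_def)
  have ng: "square_integrable (\<lambda>y. norm (g y))"
    by (rule square_integrable_bound[OF g, where C = 1]) auto
  have wg: "square_integrable (\<lambda>y. w y + norm (g y))"
    by (rule square_integrable_add[OF w ng])
  have "(\<lambda>n. integral\<^sup>L (lebesgue_on cube) (\<lambda>y. (norm (f n y - g y))\<^sup>2)) \<longlonglongrightarrow>
      integral\<^sup>L (lebesgue_on (cube :: (real^'d) set)) (\<lambda>y. 0::real)"
  proof (rule integral_dominated_convergence[where w = "\<lambda>y. (norm (w y + norm (g y)))\<^sup>2"])
    show "integrable (lebesgue_on cube) (\<lambda>y. (norm (w y + norm (g y)))\<^sup>2)"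
      using wg by (simp only: square_integrable_def)
    show "AE y in lebesgue_on cube. (\<lambda>n. (norm (f n y - g y))\<^sup>2) \<longlonglongrightarrow> 0"
      using lim
    proof (rule eventually_mono)
      fix y assume "(\<lambda>n. f n y) \<longlonglongrightarrow> g y"
      then have "(\<lambda>n. (norm (f n y - g y))\<^sup>2) \<longlonglongrightarrow> (norm (g y - g y))\<^sup>2" by (intro tendsto_intros)
      then show "(\<lambda>n. (norm (f n y - g y))\<^sup>2) \<longlonglongrightarrow> 0" by simp
    qed
    show "AE y in lebesgue_on cube. norm ((norm (f n y - g y))\<^sup>2) \<le> (norm (w y + norm (g y)))\<^sup>2" for n
      using dom[of n]
    proof (rule eventually_mono)
      fix y assume "norm (f n y) \<le> w y"
      then have "norm (f n y - g y) \<le> norm (w y + norm (g y))"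
        using norm_triangle_ineq4[of "f n y" "g y"] by simp
      then show "norm ((norm (f n y - g y))\<^sup>2) \<le> (norm (w y + norm (g y)))\<^sup>2"
        by (simp only: real_norm_def abs_power2) (rule power_mono, auto)
    qed
  qed measurable
  then have "(\<lambda>n. (norm (cl (f n) - cl g))\<^sup>2) \<longlonglongrightarrow> 0"
    by (simp add: cl_diff[OF f g] norm_cl[OF square_integrable_diff[OF f g]])
  then have "(\<lambda>n. sqrt ((norm (cl (f n) - cl g))\<^sup>2)) \<longlonglongrightarrow> sqrt 0" by (rule tendsto_real_sqrt)
  then have "(\<lambda>n. norm (cl (f n) - cl g)) \<longlonglongrightarrow> 0" by simp
  then show ?thesis by (simp add: tendsto_norm_zero_iff LIM_zero_cancel)
qed

lemma trig_dense_bounded: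
  fixes f :: "real^'d::finite \<Rightarrow> real"
  assumes f: "f \<in> borel_measurable (lebesgue_on cube)" and M: "\<And>y. \<bar>f y\<bar> \<le> M"
  shows "cl f \<in> closure (span (range Ck \<union> range Sk))"
proof -
  let ?S = "span (range Ck \<union> range Sk) :: ('d, real) l2 set"
  have "f measurable_on cube" using f by (simp add: measurable_on_iff_borel_measurable)
  then obtain N g where N: "negligible N" and g: "\<And>n. continuous_on UNIV (g n)"
    and lim: "\<And>y. y \<notin> N \<Longrightarrow> (\<lambda>n. g n y) \<longlonglongrightarrow> (if y \<in> cube then f y else 0)"
    unfolding measurable_on_def by metis
  have M0: "M \<ge> 0" using M[of 0] by linarith
  \<comment> \<open>The distance factor forces \<open>h n\<close> to vanish outside the open cube
    and equals 1 at each interior point once n is large. Clipping at height M provides a constant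
    dominating function and leaves the limit unchanged.\<close>
  define h where "h n y = min 1 (real n * infdist y (- box 0 One)) * max (- M) (min M (g n y))" for n y
  have ne: "- box 0 (One::real^'d) \<noteq> {}"
  proof -
    have "(0::real^'d) \<in> - box 0 One" by (auto simp: mem_open_cube)
    then show ?thesis by blast
  qed
  have h: "continuous_on UNIV (h n)" for n
    unfolding h_def by (intro continuous_intros g continuous_on_infdist)
  have hb: "\<bar>h n y\<bar> \<le> M" for n y
  proof -
    have "\<bar>h n y\<bar> \<le> 1 * M"
      unfolding h_def abs_mult using M0 infdist_nonneg[of y "- box 0 One"] by (intro mult_mono) auto
    then show ?thesis by simp
  qed
  have h0: "h n y = 0" if "y \<notin> box 0 One" for n y
    using that by (simp add: h_def)
  have sf: "square_integrable f" using f M by (intro square_integrable_bounded[where C = M]) auto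
  have "(\<lambda>n. cl (h n)) \<longlonglongrightarrow> cl f"
  proof (rule tendsto_cl_dominated[where w = "\<lambda>_. M"])
    have "negligible (N \<union> (cbox 0 One - box 0 (One::real^'d)))"
      using N negligible_frontier_interval by (rule negligible_Un)
    then have "AE y in lebesgue. y \<notin> N \<union> (cbox 0 One - box 0 One)"
      by (simp only: negligible_iff_null_sets AE_not_in)
    then have "AE y in lebesgue. y \<in> cube \<longrightarrow> (\<lambda>n. h n y) \<longlonglongrightarrow> f y"
    proof (rule eventually_mono, intro impI)
      fix y :: "real^'d" assume y: "y \<notin> N \<union> (cbox 0 One - box 0 One)" and yc: "y \<in> cube"
      then have yb: "y \<in> box 0 One" and yN: "y \<notin> N" by (auto simp: cube_def)
      have "closed (- box 0 (One::real^'d))" by (intro closed_Compl open_box)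
      then have pos: "infdist y (- box 0 One) > 0"
        using yb ne by (metis ComplD infdist_pos_not_in_closed)
      obtain m where m: "real m * infdist y (- box 0 One) > 1"
        using reals_Archimedean3[OF pos] by blast
      have "eventually (\<lambda>n. max (- M) (min M (g n y)) = h n y) sequentially"
      proof (rule eventually_sequentiallyI[of m])
        fix n assume "m \<le> n"
        then have "real m * infdist y (- box 0 One) \<le> real n * infdist y (- box 0 One)"
          using pos by (intro mult_right_mono) auto
        then show "max (- M) (min M (g n y)) = h n y" using m by (simp add: h_def)
      qed
      moreover have "(\<lambda>n. max (- M) (min M (g n y))) \<longlonglongrightarrow> max (- M) (min M (f y))"
        using lim[OF yN] yc by (intro tendsto_intros) auto
      moreover have "max (- M) (min M (f y)) = f y" using M[of y] by auto
      ultimately show "(\<lambda>n. h n y) \<longlonglongrightarrow> f y"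
        using Lim_transform_eventually by metis
    qed
    then show "AE y in lebesgue_on cube. (\<lambda>n. h n y) \<longlonglongrightarrow> f y"
      by (simp add: AE_restrict_space_iff)
  qed (use hb in \<open>auto intro: square_integrable_continuous h sf continuous_intros\<close>)
  moreover have "cl (h n) \<in> closure ?S" for n
  proof (unfold closure_approachable, intro allI impI)
    fix e :: real assume "e > 0"
    then have e2: "e/2 > 0" by simp
    obtain q where q: "q \<in> trig_polys" "\<And>y. y \<in> cube \<Longrightarrow> \<bar>h n y - q y\<bar> < e/2"
      using trig_approx_compact_support[OF h[of n] h0[of _ n] e2] that by blast
    have sq: "square_integrable q" "square_integrable (h n)"
      using square_integrable_continuous[OF continuous_trig_polys[OF q(1)]]
        square_integrable_continuous[OF h[of n]] by auto
    have "norm (cl (\<lambda>y. h n y - q y)) \<le> e/2"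
      by (rule norm_cl_le[OF square_integrable_diff[OF sq(2,1)]]) (auto intro!: AE_I2 less_imp_le[OF q(2)] less_imp_le[OF e2] simp del: less_divide_eq_numeral1 le_divide_eq_numeral1)
    then have "dist (cl q) (cl (h n)) < e"
      using \<open>e > 0\<close> by (subst dist_commute) (simp add: dist_norm cl_diff sq)
    then show "\<exists>y\<in>?S. dist y (cl (h n)) < e" using cl_trig_polys[OF q(1)] by blast
  qed
  ultimately show ?thesis
    by (rule closed_sequentially[OF closed_closure, rotated])
qed

text \<open>Clipping \<open>f\<close> at height n gives bounded functions that converge to
  \<open>f\<close> under the dominating function |f|.\<close>

lemma trig_dense: "x \<in> closure (span (range Ck \<union> range Sk))"
proof (cases x)
  case (cl f)
  define g where "g n y = max (- real n) (min (real n) (f y))" for n y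
  have fm: "f \<in> borel_measurable (lebesgue_on cube)" using cl by (simp add: square_integrable_def)
  have gm: "g n \<in> borel_measurable (lebesgue_on cube)" for n
    unfolding g_def using fm by (intro borel_measurable_max borel_measurable_min borel_measurable_const)
  have gf: "\<bar>g n y\<bar> \<le> \<bar>f y\<bar>" for n y by (auto simp: g_def)
  have nf: "square_integrable (\<lambda>y. \<bar>f y\<bar>)"
    by (rule square_integrable_bound[OF cl(1), where C = 1]) (use fm in auto)
  have "(\<lambda>n. cl (g n)) \<longlonglongrightarrow> cl f"
  proof (rule tendsto_cl_dominated[OF _ cl(1) nf])
    show "square_integrable (g n)" for n
      by (rule square_integrable_bound[OF cl(1) gm, where C = 1]) (use gf in auto)
    show "AE y in lebesgue_on cube. (\<lambda>n. g n y) \<longlonglongrightarrow> f y"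
    proof (rule AE_I2)
      fix y
      obtain m :: nat where m: "\<bar>f y\<bar> \<le> real m" using real_arch_simple by blast
      have "eventually (\<lambda>n. f y = g n y) sequentially"
        by (rule eventually_sequentiallyI[of m]) (use m in \<open>auto simp: g_def\<close>)
      then show "(\<lambda>n. g n y) \<longlonglongrightarrow> f y" by (rule Lim_transform_eventually[OF tendsto_const])
    qed
  qed (use gf in auto)
  moreover have "cl (g n) \<in> closure (span (range Ck \<union> range Sk))" for n
    by (rule trig_dense_bounded[OF gm, of n "real n"]) (auto simp: g_def)
  ultimately show ?thesis
    unfolding cl(2) by (rule closed_sequentially[OF closed_closure, rotated])
qed

section \<open>Fourier truncation\<close>

lemma inner_cl_real: "square_integrable f \<Longrightarrow> square_integrable g \<Longrightarrow> cl f \<bullet> cl g = yint (\<lambda>y. f y * g y)"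
  by (simp add: inner_cl yint_def)

lemma yint_cosk_combination:
  "yint (\<lambda>y. \<alpha> * cosk k y + \<beta> * cosk l y) = \<alpha> * yint (cosk k) + \<beta> * yint (cosk l)"
  "yint (\<lambda>y. \<alpha> * sink k y + \<beta> * sink l y) = \<alpha> * yint (sink k) + \<beta> * yint (sink l)"
proof -
  have [simp]: "integrable (lebesgue_on cube) (cosk k)" "integrable (lebesgue_on cube) (sink k)" for k
    by (intro integrable_continuous_cube continuous_intros)+
  show "yint (\<lambda>y. \<alpha> * cosk k y + \<beta> * cosk l y) = \<alpha> * yint (cosk k) + \<beta> * yint (cosk l)"
    "yint (\<lambda>y. \<alpha> * sink k y + \<beta> * sink l y) = \<alpha> * yint (sink k) + \<beta> * yint (sink l)"
    by (simp_all add: yint_def)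
qed

text \<open>Opposite frequencies carry the same cosine and opposite sines, whence the second
  indicator here and its minus sign for the sines. At frequency zero the two indicators add up to
  the norm of the constant one, and cancel for the sine, which is zero.\<close>

lemma inner_Ck_Ck: "Ck k \<bullet> Ck l = (if k = l then 1/2 else 0) + (if l = - k then 1/2 else 0)"
proof -
  have "k + l = 0 \<longleftrightarrow> l = - k" by (simp add: eq_neg_iff_add_eq_0 add.commute)
  then show ?thesis
    by (simp only: Ck_def inner_cl_real square_integrable_cosk cosk_mult_cosk yint_cosk_combination
        yint_cosk right_minus_eq) simp
qed

lemma inner_Sk_Sk: "Sk k \<bullet> Sk l = (if k = l then 1/2 else 0) - (if l = - k then 1/2 else 0)"
proof -
  have "k + l = 0 \<longleftrightarrow> l = - k" by (simp add: eq_neg_iff_add_eq_0 add.commute)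
  then show ?thesis
    by (simp only: Sk_def inner_cl_real square_integrable_sink sink_mult_sink yint_cosk_combination
        yint_cosk right_minus_eq) simp
qed

lemma inner_Sk_Ck: "Sk k \<bullet> Ck l = 0"
  by (simp only: Ck_def Sk_def inner_cl_real square_integrable_cosk square_integrable_sink
      sink_mult_cosk yint_cosk_combination yint_sink)

lemma Ck_uminus: "Ck (- k) = Ck k"
  unfolding Ck_def by (rule arg_cong[of _ _ cl]) (simp add: fun_eq_iff cosk_def phase_uminus)

lemma Sk_uminus: "Sk (- k) = - Sk k"
  unfolding Sk_def cl_uminus[OF square_integrable_sink]
  by (rule arg_cong[of _ _ cl]) (simp add: fun_eq_iff sink_def phase_uminus)

definition fourier_sum :: "(int^'d::finite) set \<Rightarrow> ('d, real) l2 \<Rightarrow> ('d, real) l2" where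
  "fourier_sum F f = (\<Sum>k\<in>F. (f \<bullet> Ck k) *\<^sub>R Ck k + (f \<bullet> Sk k) *\<^sub>R Sk k)"

text \<open>Each frequency is counted together with its opposite, so the normalisation \<open>1/2\<close> of the
  inner products above makes the truncation to a symmetric set of frequencies a projection.\<close>

lemma fourier_sum_Ck:
  assumes F: "finite F" "uminus ` F = F" "l \<in> F"
  shows "fourier_sum F (Ck l) = Ck l" "fourier_sum F (Sk l) = Sk l"
proof -
  have ml: "- l \<in> F" using F by blast
  have d1: "(\<Sum>k\<in>F. (if l = k then 1/2 else 0) *\<^sub>R g k) = (1/2::real) *\<^sub>R (g l :: 'c::real_vector)" for g
  proof -
    have "(\<Sum>k\<in>F. (if l = k then 1/2 else 0) *\<^sub>R g k) = (\<Sum>k\<in>F. if l = k then (1/2) *\<^sub>R g k else 0)"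
      by (rule sum.cong) auto
    then show ?thesis using F by simp
  qed
  have d2: "(\<Sum>k\<in>F. (if k = - l then 1/2 else 0) *\<^sub>R g k) = (1/2::real) *\<^sub>R (g (- l) :: 'c::real_vector)" for g
  proof -
    have "(\<Sum>k\<in>F. (if k = - l then 1/2 else 0) *\<^sub>R g k) = (\<Sum>k\<in>F. if k = - l then (1/2) *\<^sub>R g k else 0)"
      by (rule sum.cong) auto
    then show ?thesis using F ml by simp
  qed
  have half: "(1/2::real) *\<^sub>R x + (1/2) *\<^sub>R x = x" for x :: "('a, real) l2"
    by (simp flip: scaleR_add_left)
  show "fourier_sum F (Ck l) = Ck l"
    using d1[of Ck] d2[of Ck]
    by (simp add: fourier_sum_def inner_Ck_Ck inner_Sk_Ck inner_commute[of "Ck l" "Sk _"]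
        scaleR_add_left sum.distrib Ck_uminus half)
  show "fourier_sum F (Sk l) = Sk l"
    using d1[of Sk] d2[of Sk]
    by (simp add: fourier_sum_def inner_Sk_Sk inner_Sk_Ck scaleR_diff_left sum_subtractf Sk_uminus half)
qed

lemma linear_fourier_sum: "linear (fourier_sum F)"
  by (rule linearI)
     (simp_all add: fourier_sum_def inner_add_left scaleR_add_left sum.distrib scaleR_sum_right
        scaleR_add_right add_ac)

lemma fourier_sum_span:
  assumes F: "finite F" "uminus ` F = F" and q: "q \<in> span (Ck ` F \<union> Sk ` F)"
  shows "fourier_sum F q = q"
  using q
proof (induction rule: span_induct)
  case base
  show ?case
    by (auto simp: subspace_def linear_0[OF linear_fourier_sum] linear_add[OF linear_fourier_sum]
        linear_cmul[OF linear_fourier_sum])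
next
  case (step x) then show ?case using fourier_sum_Ck[OF F] by auto
qed

lemma fourier_sum_in_span: "fourier_sum F f \<in> span (Ck ` F \<union> Sk ` F)"
  unfolding fourier_sum_def by (intro span_sum span_add span_scale span_base) auto

lemma fourier_sum_adjoint: "fourier_sum F f \<bullet> g = f \<bullet> fourier_sum F g"
  by (simp add: fourier_sum_def inner_sum_left inner_sum_right inner_add_left inner_add_right
      inner_commute mult.commute)

text \<open>A self-adjoint idempotent is an orthogonal projection: the squared norm of the image is
  its pairing with \<open>f\<close>. This is at once the sum of squared coefficients and, by
  Cauchy-Schwarz, the contraction property.\<close>

lemma norm_fourier_sum:
  assumes F: "finite F" "uminus ` F = F"
  shows "(norm (fourier_sum F f))\<^sup>2 = (\<Sum>k\<in>F. (f \<bullet> Ck k)\<^sup>2 + (f \<bullet> Sk k)\<^sup>2)" 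
    and "norm (fourier_sum F f) \<le> norm f"
proof -
  have "(norm (fourier_sum F f))\<^sup>2 = f \<bullet> fourier_sum F (fourier_sum F f)"
    by (simp add: power2_norm_eq_inner fourier_sum_adjoint)
  also have "fourier_sum F (fourier_sum F f) = fourier_sum F f"
    by (intro fourier_sum_span F fourier_sum_in_span)
  finally have eq: "(norm (fourier_sum F f))\<^sup>2 = f \<bullet> fourier_sum F f" .
  then show "(norm (fourier_sum F f))\<^sup>2 = (\<Sum>k\<in>F. (f \<bullet> Ck k)\<^sup>2 + (f \<bullet> Sk k)\<^sup>2)"
    by (simp add: fourier_sum_def inner_sum_right inner_add_right power2_eq_square)
  have "(norm (fourier_sum F f))\<^sup>2 \<le> norm f * norm (fourier_sum F f)"
    unfolding eq by (rule norm_cauchy_schwarz)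
  then show "norm (fourier_sum F f) \<le> norm f"
    by (cases "norm (fourier_sum F f) = 0") (auto simp: power2_eq_square)
qed

text \<open>Take for \<open>F0\<close> the frequencies of a good approximation q. Every larger
  symmetric set reproduces q, and contraction bounds the error by twice the distance to q. Allowing
  every larger set lets several functions share one truncation.\<close>

lemma fourier_sum_converges:
  assumes "e > 0"
  obtains F0 where "finite F0"
    "\<And>F. finite F \<Longrightarrow> uminus ` F = F \<Longrightarrow> F0 \<subseteq> F \<Longrightarrow> norm (x - fourier_sum F x) < e"
proof -
  obtain q where q: "q \<in> span (range Ck \<union> range Sk)" "dist q x < e/2"
    using trig_dense[of x] assms unfolding closure_approachable by (meson half_gt_zero)
  obtain t r where t: "finite t" "t \<subseteq> range Ck \<union> range Sk" "q = (\<Sum>a\<in>t. r a *\<^sub>R a)"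
    using q(1) unfolding span_explicit by blast
  have "\<exists>k. a = Ck k \<or> a = Sk k" if "a \<in> t" for a using t(2) that by blast
  then obtain \<kappa> where \<kappa>: "\<And>a. a \<in> t \<Longrightarrow> a = Ck (\<kappa> a) \<or> a = Sk (\<kappa> a)" by metis
  show ?thesis
  proof (rule that[of "\<kappa> ` t"])
    fix F assume F: "finite F" "uminus ` F = F" and sub: "\<kappa> ` t \<subseteq> F"
    have "a \<in> span (Ck ` F \<union> Sk ` F)" if "a \<in> t" for a
    proof (rule span_base)
      show "a \<in> Ck ` F \<union> Sk ` F" using \<kappa>[OF that] sub that by blast
    qed
    then have "q \<in> span (Ck ` F \<union> Sk ` F)"
      unfolding t(3) by (intro span_sum span_scale)
    then have "fourier_sum F q = q" by (intro fourier_sum_span F)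
    then have eq: "x - fourier_sum F x = (x - q) - fourier_sum F (x - q)"
      by (simp add: linear_diff[OF linear_fourier_sum])
    have "norm (x - fourier_sum F x) \<le> norm (x - q) + norm (fourier_sum F (x - q))"
      unfolding eq by (rule norm_triangle_ineq4)
    also have "\<dots> \<le> norm (x - q) + norm (x - q)"
      by (intro add_left_mono norm_fourier_sum(2)[OF F])
    finally have "norm (x - fourier_sum F x) \<le> norm (x - q) + norm (x - q)" .
    then show "norm (x - fourier_sum F x) < e"
      using q(2) by (simp add: dist_norm norm_minus_commute)
  qed (use t in simp)
qed

lemma finite_symmetric_superset:
  fixes G :: "(int^'d::finite) set"
  assumes "finite G"
  obtains F where "finite F" "uminus ` F = F" "G \<subseteq> F"
  by (rule that[of "G \<union> uminus ` G"]) (use assms in \<open>auto simp: image_Un image_image\<close>)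

section \<open>The Sobolev space as a closed subspace\<close>

text \<open>An element of \<open>H\<^sup>1\<close> is represented by the pair of the function and its weak gradient.\<close>

type_synonym 'd jets = "('d, real \<times> (real^'d)) l2"

definition c0 :: "('d::finite) jets \<Rightarrow> ('d, real) l2" where "c0 = mulop (\<lambda>_. fst)"
definition ci :: "'d::finite \<Rightarrow> 'd jets \<Rightarrow> ('d, real) l2" where "ci i = mulop (\<lambda>_ w. snd w $ i)"

definition jet :: "('d::finite) yfun \<Rightarrow> 'd jets" where "jet \<phi> = cl (\<lambda>y. (\<phi> y, ygrad \<phi> y))"

text \<open>Each test contributes an equation between continuous linear functionals of the pair,
  which makes closedness and linearity immediate.\<close>

definition H1S :: "('d::finite) jets set" where
  "H1S = {w. \<forall>\<phi> i. ptest \<phi> \<longrightarrow> c0 w \<bullet> cl (pd i \<phi>) = - (ci i w \<bullet> cl \<phi>)}"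

lemma bounded_field_fst: "bounded_field (\<lambda>_. fst)"
  by (intro bounded_field_const bounded_linear.linear bounded_linear_fst)

lemma bounded_field_snd_nth: "bounded_field (\<lambda>_ w. snd w $ i)"
  by (intro bounded_field_const bounded_linear.linear bounded_linear_vec_nth[THEN bounded_linear_compose] bounded_linear_snd)

lemma bounded_linear_c0: "bounded_linear c0"
  unfolding c0_def by (intro bounded_linear_mulop bounded_field_fst)

lemma bounded_linear_ci: "bounded_linear (ci i)"
  unfolding ci_def by (intro bounded_linear_mulop bounded_field_snd_nth)

lemma c0_cl: "square_integrable f \<Longrightarrow> c0 (cl f) = cl (\<lambda>y. fst (f y))"
  unfolding c0_def by (rule mulop_cl[OF bounded_field_fst])

lemma ci_cl: "square_integrable f \<Longrightarrow> ci i (cl f) = cl (\<lambda>y. snd (f y) $ i)"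
  unfolding ci_def by (rule mulop_cl[OF bounded_field_snd_nth])

lemma square_integrable_fst: "square_integrable f \<Longrightarrow> square_integrable (\<lambda>y. fst (f y))"
  using square_integrable_bounded_field[OF bounded_field_fst] .

lemma square_integrable_snd_nth: "square_integrable f \<Longrightarrow> square_integrable (\<lambda>y. snd (f y) $ i)"
  using square_integrable_bounded_field[OF bounded_field_snd_nth] .

lemma inner_jets: "v \<bullet> w = c0 v \<bullet> c0 w + (\<Sum>i\<in>UNIV. ci i v \<bullet> ci i w)"
proof (cases v, cases w)
  fix f g assume f: "square_integrable f" "v = cl f" and g: "square_integrable g" "w = cl g"
  note [simp] = f g c0_cl ci_cl square_integrable_fst square_integrable_snd_nth
  note int = square_integrable_inner[OF square_integrable_fst[OF f(1)] square_integrable_fst[OF g(1)]]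
    square_integrable_inner[OF square_integrable_snd_nth[OF f(1)] square_integrable_snd_nth[OF g(1)]]
  have "f y \<bullet> g y = fst (f y) * fst (g y) + (\<Sum>i\<in>UNIV. snd (f y) $ i * snd (g y) $ i)" for y
    by (simp add: inner_prod_def inner_vec_def)
  then show ?thesis
    using int by (simp add: inner_cl)
qed

lemma norm_jets: "(norm w)\<^sup>2 = (norm (c0 w))\<^sup>2 + (\<Sum>i\<in>UNIV. (norm (ci i w))\<^sup>2)"
  by (simp add: power2_norm_eq_inner inner_jets[of w w])

lemma square_integrable_jet:
  assumes "ptest \<phi>"
  shows "square_integrable (\<lambda>y. (\<phi> y, ygrad \<phi> y))"
  unfolding ygrad_def using assms
  by (intro square_integrable_continuous continuous_intros ptest_continuous continuous_pd)

lemma c0_jet: "ptest \<phi> \<Longrightarrow> c0 (jet \<phi>) = cl \<phi>"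
  by (simp add: jet_def c0_cl square_integrable_jet)

lemma ci_jet: "ptest \<phi> \<Longrightarrow> ci i (jet \<phi>) = cl (pd i \<phi>)"
  unfolding jet_def by (subst ci_cl[OF square_integrable_jet]) (simp_all add: ygrad_def)

lemma jet_in_H1S: "ptest \<phi> \<Longrightarrow> jet \<phi> \<in> H1S"
  by (simp add: H1S_def c0_jet ci_jet inner_cl_real square_integrable_continuous ptest_continuous
      continuous_pd yint_by_parts)

lemma subspace_H1S: "subspace H1S"
  unfolding subspace_def H1S_def
  by (auto simp: linear_0[OF bounded_linear.linear[OF bounded_linear_c0]]
      linear_0[OF bounded_linear.linear[OF bounded_linear_ci]]
      linear_add[OF bounded_linear.linear[OF bounded_linear_c0]]
      linear_add[OF bounded_linear.linear[OF bounded_linear_ci]]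
      linear_cmul[OF bounded_linear.linear[OF bounded_linear_c0]]
      linear_cmul[OF bounded_linear.linear[OF bounded_linear_ci]] inner_add_left)

lemma closed_H1S: "closed (H1S :: ('d::finite) jets set)"
proof -
  have cls: "closed {w :: 'd jets. c0 w \<bullet> cl (pd i \<phi>) = - (ci i w \<bullet> cl \<phi>)}" for i \<phi>
    by (intro closed_Collect_eq continuous_intros linear_continuous_on[OF bounded_linear_c0]
        linear_continuous_on[OF bounded_linear_ci])
  have eq: "(H1S :: 'd jets set) =
      (\<Inter>\<phi>\<in>Collect ptest. \<Inter>i. {w. c0 w \<bullet> cl (pd i \<phi>) = - (ci i w \<bullet> cl \<phi>)})"
    by (auto simp: H1S_def)
  show ?thesis unfolding eq by (intro closed_INT ballI cls)
qed

lemma cl_pd_trig: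
  "cl (pd i (cosk k)) = (- 2 * pi * of_int (k $ i)) *\<^sub>R Sk k"
  "cl (pd i (sink k)) = (2 * pi * of_int (k $ i)) *\<^sub>R Ck k"
  by (simp_all only: pd_cosk pd_sink Ck_def Sk_def cl_scaleR square_integrable_cosk
      square_integrable_sink real_scaleR_def)

text \<open>The Fourier multiplier of a weak derivative, obtained by testing with cosine and
  sine.\<close>

lemma ci_inner_trig:
  assumes "w \<in> H1S"
  shows "ci i w \<bullet> Ck k = 2 * pi * of_int (k $ i) * (c0 w \<bullet> Sk k)"
    "ci i w \<bullet> Sk k = - 2 * pi * of_int (k $ i) * (c0 w \<bullet> Ck k)"
proof -
  have "c0 w \<bullet> cl (pd i (cosk k)) = - (ci i w \<bullet> Ck k)" "c0 w \<bullet> cl (pd i (sink k)) = - (ci i w \<bullet> Sk k)"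
    using assms ptest_cosk ptest_sink by (auto simp: H1S_def Ck_def Sk_def)
  then show "ci i w \<bullet> Ck k = 2 * pi * of_int (k $ i) * (c0 w \<bullet> Sk k)"
    "ci i w \<bullet> Sk k = - 2 * pi * of_int (k $ i) * (c0 w \<bullet> Ck k)"
    by (simp_all add: cl_pd_trig)
qed

definition fourier_jet :: "(int^'d::finite) set \<Rightarrow> 'd jets \<Rightarrow> 'd jets" where
  "fourier_jet F w = (\<Sum>k\<in>F. (c0 w \<bullet> Ck k) *\<^sub>R jet (cosk k) + (c0 w \<bullet> Sk k) *\<^sub>R jet (sink k))"

text \<open>Truncation commutes with weak differentiation, because a derivative mixes only the
  cosine and sine of one frequency. So truncating the function alone approximates function and
  gradient simultaneously.\<close>

lemma fourier_jet_components:
  assumes "w \<in> H1S"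
  shows "c0 (fourier_jet F w) = fourier_sum F (c0 w)" "ci i (fourier_jet F w) = fourier_sum F (ci i w)"
proof -
  note lin = bounded_linear.linear[OF bounded_linear_c0] bounded_linear.linear[OF bounded_linear_ci]
  show "c0 (fourier_jet F w) = fourier_sum F (c0 w)"
    by (simp add: fourier_jet_def fourier_sum_def linear_sum[OF lin(1)] linear_add[OF lin(1)]
        linear_cmul[OF lin(1)] c0_jet ptest_cosk ptest_sink Ck_def Sk_def)
  have "ci i (jet (cosk k)) = (- 2 * pi * of_int (k $ i)) *\<^sub>R Sk k"
    "ci i (jet (sink k)) = (2 * pi * of_int (k $ i)) *\<^sub>R Ck k" for k
    by (simp_all only: ci_jet ptest_cosk ptest_sink cl_pd_trig)
  then show "ci i (fourier_jet F w) = fourier_sum F (ci i w)"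
    by (simp add: fourier_jet_def fourier_sum_def linear_sum[OF lin(2)] linear_add[OF lin(2)]
        linear_cmul[OF lin(2)] ci_inner_trig[OF assms] mult_ac add.commute)
qed

text \<open>Density of smooth functions in H^1 in dual form: a functional that kills every test jet
  kills the whole space. It allows a weak equation to be tested with its own solution.\<close>

lemma H1S_density:
  assumes w: "w \<in> H1S" and h: "\<And>\<phi>. ptest \<phi> \<Longrightarrow> h \<bullet> jet \<phi> = 0"
  shows "h \<bullet> w = 0"
proof -
  have "\<bar>h \<bullet> w\<bar> \<le> e" if e: "e > 0" for e
  proof -
    \<comment> \<open>Chosen so that the final product
      \<open>(norm h + 1) * ((1 + real CARD('a)) * \<delta>)\<close> equals e; adding 1 to the norm
      avoids a division by zero.\<close>
    define \<delta> where "\<delta> = e / ((norm h + 1) * (1 + real CARD('a)))"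
    have nh: "norm h + 1 > 0" using norm_ge_zero[of h] by linarith
    then have \<delta>: "\<delta> > 0" using e by (simp add: \<delta>_def)
    \<comment> \<open>The option index lists the function and all gradient components, so that one
      finite frequency set serves them all.\<close>
    define f where "f p = (case p of None \<Rightarrow> c0 w | Some i \<Rightarrow> ci i w)" for p
    have "\<forall>p. \<exists>F0. finite F0 \<and> (\<forall>F. finite F \<longrightarrow> uminus ` F = F \<longrightarrow> F0 \<subseteq> F \<longrightarrow>
        norm (f p - fourier_sum F (f p)) < \<delta>)"
      by (rule allI, rule fourier_sum_converges[OF \<delta>]) blast
    from choice[OF this] obtain F0 where F0': "\<forall>p. finite (F0 p) \<and>
        (\<forall>F. finite F \<longrightarrow> uminus ` F = F \<longrightarrow> F0 p \<subseteq> F \<longrightarrow> norm (f p - fourier_sum F (f p)) < \<delta>)" ..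
    have F0: "finite (F0 p)"
      "finite F \<Longrightarrow> uminus ` F = F \<Longrightarrow> F0 p \<subseteq> F \<Longrightarrow> norm (f p - fourier_sum F (f p)) < \<delta>" for p F
      using F0'[rule_format, of p] by auto
    have "finite (\<Union>p. F0 p)" by (intro finite_UN_I finite_class.finite_UNIV F0(1))
    then obtain F where F: "finite F" "uminus ` F = F" "(\<Union>p. F0 p) \<subseteq> F"
      by (rule finite_symmetric_superset)
    define d where "d = w - fourier_jet F w"
    note lin = bounded_linear.linear[OF bounded_linear_c0] bounded_linear.linear[OF bounded_linear_ci]
    have "norm (c0 d) < \<delta>" using F0(2)[OF F(1,2), of None] F(3)
      by (auto simp: d_def linear_diff[OF lin(1)] fourier_jet_components[OF w] f_def)
    moreover have "norm (ci i d) < \<delta>" for i using F0(2)[OF F(1,2), of "Some i"] F(3)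
      by (auto simp: d_def linear_diff[OF lin(2)] fourier_jet_components[OF w] f_def)
    ultimately have "(norm (c0 d))\<^sup>2 \<le> \<delta>\<^sup>2" "(norm (ci i d))\<^sup>2 \<le> \<delta>\<^sup>2" for i
      by (simp_all add: power_mono less_imp_le)
    then have "(norm d)\<^sup>2 \<le> \<delta>\<^sup>2 + (\<Sum>i\<in>(UNIV::'a set). \<delta>\<^sup>2)"
      unfolding norm_jets[of d] by (intro add_mono sum_mono)
    also have "\<dots> = (1 + real CARD('a)) * \<delta>\<^sup>2" by (simp add: algebra_simps)
    also have "\<dots> \<le> (1 + real CARD('a))\<^sup>2 * \<delta>\<^sup>2"
      by (intro mult_right_mono) (auto simp: power2_eq_square algebra_simps)
    finally have "(norm d)\<^sup>2 \<le> ((1 + real CARD('a)) * \<delta>)\<^sup>2" by (simp add: power_mult_distrib)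
    then have nd: "norm d \<le> (1 + real CARD('a)) * \<delta>"
      using \<delta> by (intro power2_le_imp_le[OF _ mult_nonneg_nonneg]) auto
    have "h \<bullet> fourier_jet F w = 0"
      by (simp add: fourier_jet_def inner_sum_right inner_add_right h ptest_cosk ptest_sink)
    then have "\<bar>h \<bullet> w\<bar> = \<bar>h \<bullet> d\<bar>" by (simp add: d_def inner_diff_right)
    also have "\<dots> \<le> norm h * norm d" by (rule Cauchy_Schwarz_ineq2)
    also have "\<dots> \<le> (norm h + 1) * ((1 + real CARD('a)) * \<delta>)"
      using nd \<delta> by (intro mult_mono) auto
    also have "\<dots> = e" using nh by (simp add: \<delta>_def)
    finally show ?thesis .
  qed
  then show ?thesis using field_le_epsilon[of "\<bar>h \<bullet> w\<bar>" 0] by simp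
qed

text \<open>The gradient of a constant vanishes, so pairing with this jet computes the mean of the
  function part.\<close>

lemma inner_jet_one: "w \<bullet> jet (\<lambda>_. 1) = c0 w \<bullet> Ck 0"
proof -
  have "c0 (jet (\<lambda>_. 1) :: 'a jets) = Ck 0" "ci i (jet (\<lambda>_. 1) :: 'a jets) = 0" for i
    by (simp_all add: c0_jet ci_jet ptest_one Ck_def cosk_def[abs_def] cl_zero)
  then show ?thesis by (simp add: inner_jets)
qed

text \<open>It holds frequency by frequency: the zero coefficient vanishes by the mean condition,
  and at any other frequency some component satisfies |k_i| >= 1, so its multiplier 2 pi k_i has
  square at least 1. This is why the constant is one.\<close>

lemma Poincare:
  assumes w: "w \<in> H1S" and mean: "w \<bullet> jet (\<lambda>_. 1) = 0"
  shows "(norm (c0 w))\<^sup>2 \<le> (\<Sum>i\<in>UNIV. (norm (ci i w))\<^sup>2)"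
proof -
  let ?R = "\<Sum>i\<in>UNIV. (norm (ci i w))\<^sup>2"
  have S0: "Sk 0 = (0 :: ('a, real) l2)" by (simp add: Sk_def sink_def[abs_def] cl_zero)
  have coeff: "(c0 w \<bullet> Ck k)\<^sup>2 + (c0 w \<bullet> Sk k)\<^sup>2 \<le> (\<Sum>i\<in>UNIV. (ci i w \<bullet> Ck k)\<^sup>2 + (ci i w \<bullet> Sk k)\<^sup>2)" for k
  proof (cases "k = 0")
    case True
    then show ?thesis using mean by (simp add: inner_jet_one S0 sum_nonneg)
  next
    case False
    then obtain i where i: "k $ i \<noteq> 0" by (auto simp: vec_eq_iff)
    have "\<bar>real_of_int (k $ i)\<bar> \<ge> 1" using i by linarith
    then have "2 * pi * \<bar>real_of_int (k $ i)\<bar> \<ge> 1 * 1" using pi_gt3 by (intro mult_mono) auto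
    then have "(2 * pi * \<bar>real_of_int (k $ i)\<bar>)\<^sup>2 \<ge> 1\<^sup>2" by (intro power_mono) auto
    then have ge: "(2 * pi * of_int (k $ i))\<^sup>2 \<ge> (1::real)" by (simp add: power_mult_distrib)
    have "1 * ((c0 w \<bullet> Ck k)\<^sup>2 + (c0 w \<bullet> Sk k)\<^sup>2) \<le> (2 * pi * of_int (k $ i))\<^sup>2 * ((c0 w \<bullet> Ck k)\<^sup>2 + (c0 w \<bullet> Sk k)\<^sup>2)"
      using ge by (intro mult_right_mono) auto
    also have "\<dots> = (ci i w \<bullet> Ck k)\<^sup>2 + (ci i w \<bullet> Sk k)\<^sup>2"
      by (simp add: ci_inner_trig[OF w] power_mult_distrib algebra_simps)
    also have "\<dots> \<le> (\<Sum>i\<in>UNIV. (ci i w \<bullet> Ck k)\<^sup>2 + (ci i w \<bullet> Sk k)\<^sup>2)"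
      by (rule member_le_sum[where f = "\<lambda>i. (ci i w \<bullet> Ck k)\<^sup>2 + (ci i w \<bullet> Sk k)\<^sup>2"]) auto
    finally show ?thesis by simp
  qed
  have "norm (c0 w) \<le> sqrt ?R + e" if e: "e > 0" for e
  proof -
    obtain F0 where F0: "finite F0"
      "\<And>F. finite F \<Longrightarrow> uminus ` F = F \<Longrightarrow> F0 \<subseteq> F \<Longrightarrow> norm (c0 w - fourier_sum F (c0 w)) < e"
      using fourier_sum_converges[OF e, of "c0 w"] by blast
    obtain F where F: "finite F" "uminus ` F = F" "F0 \<subseteq> F" using finite_symmetric_superset[OF F0(1)] .
    have "(norm (fourier_sum F (c0 w)))\<^sup>2 \<le> (\<Sum>k\<in>F. \<Sum>i\<in>UNIV. (ci i w \<bullet> Ck k)\<^sup>2 + (ci i w \<bullet> Sk k)\<^sup>2)"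
      unfolding norm_fourier_sum(1)[OF F(1,2)] by (intro sum_mono coeff)
    also have "\<dots> = (\<Sum>i\<in>UNIV. (norm (fourier_sum F (ci i w)))\<^sup>2)"
      unfolding norm_fourier_sum(1)[OF F(1,2)] by (rule sum.swap)
    also have "\<dots> \<le> ?R"
      by (intro sum_mono power_mono norm_fourier_sum(2) F(1,2) norm_ge_zero)
    finally have "norm (fourier_sum F (c0 w)) \<le> sqrt ?R" by (intro real_le_rsqrt)
    moreover have "norm (c0 w) \<le> norm (c0 w - fourier_sum F (c0 w)) + norm (fourier_sum F (c0 w))"
      using norm_triangle_sub[of "c0 w" "fourier_sum F (c0 w)"] by simp
    ultimately show ?thesis using F0(2)[OF F] by linarith
  qed
  then have "norm (c0 w) \<le> sqrt ?R" by (rule field_le_epsilon)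
  then have "(norm (c0 w))\<^sup>2 \<le> (sqrt ?R)\<^sup>2" by (intro power_mono) auto
  then show ?thesis by (simp add: sum_nonneg)
qed

text \<open>If the function part of the difference is zero, all Fourier coefficients of its gradient
  part vanish, and density makes each component orthogonal to itself. Hence the class of the pair
  does not depend on the gradient chosen by \<open>wgrad\<close>.\<close>

lemma H1S_gradient_unique:
  assumes v: "v \<in> H1S" and w: "w \<in> H1S" and eq: "c0 v = c0 w"
  shows "v = w"
proof -
  note lin = bounded_linear.linear[OF bounded_linear_c0] bounded_linear.linear[OF bounded_linear_ci]
  define d where "d = v - w"
  have d: "d \<in> H1S" "c0 d = 0"
    using v w eq subspace_diff[OF subspace_H1S] by (auto simp: d_def linear_diff[OF lin(1)])
  have "ci i d = 0" for i
  proof -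
    have "ci i d \<bullet> x = 0" if "x \<in> span (range Ck \<union> range Sk)" for x
      using that
    proof (induction rule: span_induct)
      case base
      show ?case by (auto simp: subspace_def inner_add_right)
    next
      case (step x) then show ?case using ci_inner_trig[OF d(1)] d(2) by auto
    qed
    then have "closure (span (range Ck \<union> range Sk)) \<subseteq> {x. ci i d \<bullet> x = 0}"
      by (intro closure_minimal closed_Collect_eq continuous_intros) auto
    then have "ci i d \<bullet> ci i d = 0" using trig_dense by blast
    then show ?thesis by simp
  qed
  then have "d = 0" using norm_jets[of d] d by simp
  then show ?thesis by (simp add: d_def)
qed

section \<open>A symmetric Lax-Milgram theorem\<close>

text \<open>By symmetry the equation is the Euler equation of the quadratic functional
  \<open>J\<close>, so a solution is found by minimising \<open>J\<close> over the closed
  subspace.\<close>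

lemma Lax_Milgram_symmetric:
  fixes T :: "'h::{real_inner, complete_space} \<Rightarrow> 'h" and h :: 'h
  assumes T: "bounded_linear T" and S: "closed S" "subspace S"
    and sym: "\<And>u v. u \<in> S \<Longrightarrow> v \<in> S \<Longrightarrow> T u \<bullet> v = T v \<bullet> u"
    and c: "c > 0" and coercive: "\<And>v. v \<in> S \<Longrightarrow> c * (norm v)\<^sup>2 \<le> T v \<bullet> v"
  obtains v where "v \<in> S" "\<And>s. s \<in> S \<Longrightarrow> T v \<bullet> s = h \<bullet> s"
proof -
  note lin = bounded_linear.linear[OF T]
  define J where "J v = T v \<bullet> v - 2 * (h \<bullet> v)" for v
  \<comment> \<open>Completing the square: expand \<open>(c * norm v - norm h)\<^sup>2\<close> and
    use coercivity.\<close>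
  have bd: "J v \<ge> - (norm h)\<^sup>2 / c" if "v \<in> S" for v
  proof -
    have "0 \<le> (c * norm v - norm h)\<^sup>2" by simp
    then have "c * (2 * norm h * norm v) \<le> c * (c * (norm v)\<^sup>2) + (norm h)\<^sup>2"
      by (simp add: power2_eq_square algebra_simps)
    then have "2 * norm h * norm v \<le> c * (norm v)\<^sup>2 + (norm h)\<^sup>2 / c"
      using c by (simp add: field_simps)
    moreover have "h \<bullet> v \<le> norm h * norm v" by (rule norm_cauchy_schwarz)
    ultimately show ?thesis using coercive[OF that] by (simp add: J_def)
  qed
  have S0: "0 \<in> S" using S(2) by (rule subspace_0)
  define m where "m = Inf (J ` S)"
  have bdd: "bdd_below (J ` S)" using bd by (intro bdd_belowI2)
  have m: "m \<le> J v" if "v \<in> S" for v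
    unfolding m_def using bdd that by (intro cInf_lower) auto
  have "\<exists>v\<in>S. J v < m + inverse (real (Suc n))" for n
  proof -
    have "Inf (J ` S) < m + inverse (real (Suc n))" by (simp add: m_def)
    then show ?thesis using S0 bdd by (subst (asm) cInf_less_iff) auto
  qed
  then obtain X where X: "\<And>n. X n \<in> S" "\<And>n. J (X n) < m + inverse (real (Suc n))" by metis
  \<comment> \<open>Parallelogram identity for \<open>J\<close>: the midpoint also has value at
    least m, so two near-minimisers are close to each other.\<close>
  have par: "c / 2 * (norm (u - v))\<^sup>2 \<le> J u + J v - 2 * m" if uv: "u \<in> S" "v \<in> S" for u v
  proof -
    let ?p = "(1/2) *\<^sub>R (u + v)"
    have pS: "?p \<in> S" "u - v \<in> S" using uv S(2) by (auto intro: subspace_scale subspace_add subspace_diff)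
    have "J u + J v = 2 * J ?p + 1/2 * (T (u - v) \<bullet> (u - v))"
      using sym[OF uv]
      by (simp add: J_def linear_cmul[OF lin] linear_add[OF lin] linear_diff[OF lin] inner_add_left
          inner_add_right inner_diff_left inner_diff_right) (simp add: field_simps)
    then show ?thesis using m[OF pS(1)] coercive[OF pS(2)] by simp
  qed
  have "Cauchy X"
  proof (rule metric_CauchyI)
    fix e :: real assume e: "e > 0"
    \<comment> \<open>Each of the two excesses over m is below c/4 times e squared; their sum
      matches the factor c/2 in \<open>par\<close>.\<close>
    obtain N where N: "inverse (real (Suc N)) < c / 4 * e\<^sup>2"
      using reals_Archimedean[of "c / 4 * e\<^sup>2"] c e by auto
    show "\<exists>N. \<forall>n\<ge>N. \<forall>k\<ge>N. dist (X n) (X k) < e"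
    proof (intro exI allI impI)
      fix n k assume nk: "n \<ge> N" "k \<ge> N"
      have "inverse (real (Suc n)) \<le> inverse (real (Suc N))" "inverse (real (Suc k)) \<le> inverse (real (Suc N))"
        using nk by (auto intro!: le_imp_inverse_le)
      then have "c / 2 * (norm (X n - X k))\<^sup>2 < c / 2 * e\<^sup>2"
        using par[OF X(1) X(1), of n k] X(2)[of n] X(2)[of k] N by linarith
      then have "(norm (X n - X k))\<^sup>2 < e\<^sup>2" using c by simp
      then show "dist (X n) (X k) < e" using e by (simp add: dist_norm power_less_imp_less_base)
    qed
  qed
  then obtain v where v: "X \<longlonglongrightarrow> v" using Cauchy_convergent_iff convergent_def by blast
  have vS: "v \<in> S" by (rule closed_sequentially[OF S(1) X(1) v])
  have "(\<lambda>n. J (X n)) \<longlonglongrightarrow> J v"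
    unfolding J_def by (intro tendsto_intros v bounded_linear.tendsto[OF T])
  moreover have "(\<lambda>n. m + inverse (real (Suc n))) \<longlonglongrightarrow> m + 0"
    by (intro tendsto_intros LIMSEQ_inverse_real_of_nat)
  ultimately have Jv: "J v \<le> m" 
    using X(2) by (intro LIMSEQ_le) (auto intro: less_imp_le exI[of _ 0])
  show ?thesis
  proof (rule that[OF vS])
    fix s assume s: "s \<in> S"
    define \<beta> where "\<beta> = T v \<bullet> s - h \<bullet> s"
    \<comment> \<open>Minimality along the line through v in direction s; the linear coefficient is
      twice the residual \<open>\<beta>\<close>.\<close>
    have quad: "0 \<le> 2 * t * \<beta> + t\<^sup>2 * (T s \<bullet> s)" for t
    proof -
      have "v + t *\<^sub>R s \<in> S" using vS s S(2) by (intro subspace_add subspace_scale)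
      then have "J v \<le> J (v + t *\<^sub>R s)" using m Jv order_trans by blast
      then show ?thesis
        using sym[OF vS s]
        by (simp add: J_def \<beta>_def linear_cmul[OF lin] linear_add[OF lin] inner_add_left
          inner_add_right power2_eq_square algebra_simps)
    qed
    have "\<beta> = 0"
    proof (rule ccontr)
      assume "\<beta> \<noteq> 0"
      \<comment> \<open>Strictly positive and at least the quadratic coefficient, so that t =
        -\<open>\<beta>\<close>/K makes the quadratic negative unless the residual vanishes.\<close>
      define K where "K = \<bar>T s \<bullet> s\<bar> + 1"
      have K: "K > 0" by (simp add: K_def add_nonneg_pos)
      have "0 \<le> 2 * (- \<beta> / K) * \<beta> + (- \<beta> / K)\<^sup>2 * (T s \<bullet> s)" by (rule quad)
      also have "\<dots> \<le> 2 * (- \<beta> / K) * \<beta> + (- \<beta> / K)\<^sup>2 * K"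
        by (intro add_left_mono mult_left_mono) (auto simp: K_def)
      also have "\<dots> = - (\<beta>\<^sup>2 / K)" using K by (simp add: power2_eq_square field_simps)
      finally show False using \<open>\<beta> \<noteq> 0\<close> K by (simp add: field_simps)
    qed
    then show "T v \<bullet> s = h \<bullet> s" by (simp add: \<beta>_def)
  qed
qed

section \<open>Weak gradients as elements of the Hilbert space\<close>

lemma sq_int_iff: "sq_int f \<longleftrightarrow> square_integrable f"
  by (simp add: sq_int_def square_integrable_def)

lemma square_integrable_sum:
  "(\<And>i. i \<in> A \<Longrightarrow> square_integrable (f i)) \<Longrightarrow> square_integrable (\<lambda>y. \<Sum>i\<in>A. f i y)"
proof (induction A rule: infinite_finite_induct)
  case (insert x F) then show ?case using square_integrable_add[of "f x"] by simp
qed simp_all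

lemma square_integrable_scaleR_const: "square_integrable f \<Longrightarrow> square_integrable (\<lambda>y. f y *\<^sub>R b)"
  by (rule square_integrable_bounded_field[OF bounded_field_const])
     (auto intro: bounded_linear.linear bounded_linear_scaleR_left)

lemma square_integrable_pair:
  fixes v :: "real^'d::finite \<Rightarrow> real" and G :: "real^'d \<Rightarrow> real^'d"
  assumes v: "square_integrable v" and G: "\<And>i. square_integrable (\<lambda>y. G y $ i)"
  shows "square_integrable (\<lambda>y. (v y, G y))"
proof -
  have "(v y, G y) = v y *\<^sub>R (1, 0) + (\<Sum>i\<in>UNIV. (G y $ i) *\<^sub>R (0, axis i 1))" for y
    by (simp add: prod_eq_iff fst_sum snd_sum vec_eq_iff axis_def if_distrib[of "\<lambda>c. _ * c"] cong: if_cong)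
  then show ?thesis
    by (simp only:) (intro square_integrable_add square_integrable_sum square_integrable_scaleR_const v G)
qed

lemma is_wgrad_iff:
  "is_wgrad v G \<longleftrightarrow> square_integrable (\<lambda>y. (v y, G y)) \<and> cl (\<lambda>y. (v y, G y)) \<in> H1S"
proof (cases "square_integrable v \<and> (\<forall>i. square_integrable (\<lambda>y. G y $ i))")
  case True
  then have p: "square_integrable (\<lambda>y. (v y, G y))" by (intro square_integrable_pair) auto
  show ?thesis
    using True p
    by (simp add: is_wgrad_def sq_int_iff H1S_def c0_cl ci_cl inner_cl_real square_integrable_continuous
        ptest_continuous continuous_pd cong: conj_cong)
next
  case False
  moreover have "square_integrable v" "\<And>i. square_integrable (\<lambda>y. G y $ i)"
    if "square_integrable (\<lambda>y. (v y, G y))"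
    using square_integrable_fst[OF that] square_integrable_snd_nth[OF that] by auto
  ultimately show ?thesis by (auto simp: is_wgrad_def sq_int_iff)
qed

text \<open>The gradient is the one picked by \<open>wgrad\<close>; by
  \<open>H1S_gradient_unique\<close> another choice would give the same vector.\<close>

definition emb :: "('d::finite) yfun \<Rightarrow> 'd jets" where
  "emb v = cl (\<lambda>y. (v y, wgrad v y))"

lemma in_H1D:
  assumes "in_H1 v"
  shows "square_integrable (\<lambda>y. (v y, wgrad v y))" "emb v \<in> H1S" "c0 (emb v) = cl v" "square_integrable v"
proof -
  have "is_wgrad v (wgrad v)" using assms unfolding in_H1_def wgrad_def by (rule someI_ex)
  then show *: "square_integrable (\<lambda>y. (v y, wgrad v y))" "emb v \<in> H1S"
    by (auto simp: is_wgrad_iff emb_def)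
  show "c0 (emb v) = cl v" unfolding emb_def by (simp add: c0_cl[OF *(1)])
  show "square_integrable v" using square_integrable_fst[OF *(1)] by simp
qed

text \<open>A chosen gradient obeys no visible rules, so every later computation of
  \<open>emb\<close> exhibits a vector of \<open>H1S\<close> over the class of \<open>v\<close> and
  concludes by uniqueness.\<close>

lemma in_H1I:
  assumes w: "w \<in> H1S" and v: "square_integrable v" and eq: "c0 w = cl v"
  shows "in_H1 v" "emb v = w"
proof -
  obtain f where f: "square_integrable f" "w = cl f" by (rule cl_cases)
  have "cl (\<lambda>y. fst (f y)) = cl v" using eq f by (simp add: c0_cl)
  then have ae: "AE y in lebesgue_on cube. fst (f y) = v y"
    by (simp add: cl_eq_iff square_integrable_fst f v)
  have p: "square_integrable (\<lambda>y. (v y, snd (f y)))"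
    by (intro square_integrable_pair v square_integrable_snd_nth f)
  have "cl f = cl (\<lambda>y. (v y, snd (f y)))"
    by (rule cl_eqI[OF f(1) p]) (use ae in \<open>auto elim!: eventually_mono simp: prod_eq_iff\<close>)
  then have "is_wgrad v (\<lambda>y. snd (f y))" using p w f by (simp add: is_wgrad_iff)
  then show H: "in_H1 v" by (auto simp: in_H1_def)
  show "emb v = w" by (rule H1S_gradient_unique) (simp_all add: in_H1D[OF H] w eq)
qed

lemma H1S_representative:
  assumes "w \<in> H1S"
  obtains v where "in_H1 v" "emb v = w"
proof -
  obtain f where f: "square_integrable f" "w = cl f" by (rule cl_cases)
  have "c0 w = cl (\<lambda>y. fst (f y))" using f by (simp add: c0_cl)
  note in_H1I[OF assms square_integrable_fst[OF f(1)] this]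
  then show ?thesis by (rule that)
qed

lemma linear_c0: "linear c0" and linear_ci: "linear (ci i)"
  using bounded_linear_c0 bounded_linear_ci by (auto intro: bounded_linear.linear)

lemma emb_diff:
  assumes "in_H1 v" "in_H1 w"
  shows "in_H1 (\<lambda>y. v y - w y)" "emb (\<lambda>y. v y - w y) = emb v - emb w"
proof -
  have 1: "emb v - emb w \<in> H1S" using in_H1D(2)[OF assms(1)] in_H1D(2)[OF assms(2)] subspace_H1S subspace_diff by blast
  have 2: "square_integrable (\<lambda>y. v y - w y)" by (intro square_integrable_diff in_H1D assms)
  have 3: "c0 (emb v - emb w) = cl (\<lambda>y. v y - w y)"
    using assms by (simp add: linear_diff[OF linear_c0] in_H1D cl_diff)
  show "in_H1 (\<lambda>y. v y - w y)" "emb (\<lambda>y. v y - w y) = emb v - emb w" using in_H1I[OF 1 2 3] by auto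
qed

lemma emb_scale:
  assumes "in_H1 v"
  shows "in_H1 (\<lambda>y. c * v y)" "emb (\<lambda>y. c * v y) = c *\<^sub>R emb v"
proof -
  have 1: "c *\<^sub>R emb v \<in> H1S" using in_H1D(2)[OF assms] subspace_H1S subspace_scale by blast
  have 2: "square_integrable (\<lambda>y. c * v y)" using square_integrable_scaleR[OF in_H1D(4)[OF assms], of c] by simp
  have 3: "c0 (c *\<^sub>R emb v) = cl (\<lambda>y. c * v y)"
    using assms cl_scaleR[OF in_H1D(4)[OF assms], of c] by (simp add: linear_cmul[OF linear_c0] in_H1D)
  show "in_H1 (\<lambda>y. c * v y)" "emb (\<lambda>y. c * v y) = c *\<^sub>R emb v" using in_H1I[OF 1 2 3] by auto
qed

lemma emb_const: "in_H1 (\<lambda>_::real^'a::finite. c)" "emb (\<lambda>_::real^'a::finite. c) = c *\<^sub>R jet (\<lambda>_. 1)"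
proof -
  have 1: "c *\<^sub>R jet (\<lambda>_. 1) \<in> H1S" using jet_in_H1S[OF ptest_one] subspace_H1S subspace_scale by blast
  have 2: "square_integrable (\<lambda>_::real^'a. c)" by (intro square_integrable_continuous continuous_intros)
  have 3: "c0 (c *\<^sub>R jet (\<lambda>_::real^'a. 1)) = cl (\<lambda>_. c)"
    using cl_scaleR[OF square_integrable_continuous[of "\<lambda>_::real^'a. 1::real"], of c]
    by (simp add: linear_cmul[OF linear_c0] c0_jet ptest_one)
  show "in_H1 (\<lambda>_::real^'a. c)" "emb (\<lambda>_::real^'a. c) = c *\<^sub>R jet (\<lambda>_. 1)" using in_H1I[OF 1 2 3] by auto
qed

lemma h1norm2_eq:
  assumes "in_H1 v"
  shows "h1norm2 v = (norm (emb v))\<^sup>2"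
proof -
  note p = in_H1D(1)[OF assms]
  have i1: "integrable (lebesgue_on cube) (\<lambda>y. (v y)\<^sup>2)"
    using in_H1D(4)[OF assms] by (simp add: square_integrable_def)
  have i2: "integrable (lebesgue_on cube) (\<lambda>y. (norm (wgrad v y))\<^sup>2)"
    using square_integrable_bounded_field[OF bounded_field_const[OF bounded_linear.linear[OF bounded_linear_snd]] p]
    by (simp add: square_integrable_def)
  have "(norm (v y, wgrad v y))\<^sup>2 = (v y)\<^sup>2 + (norm (wgrad v y))\<^sup>2" for y
    by (simp add: norm_Pair)
  then show ?thesis unfolding emb_def norm_cl[OF p] h1norm2_def yint_def using i1 i2 by simp
qed

lemma yint_eq_inner: "in_H1 v \<Longrightarrow> yint v = emb v \<bullet> jet (\<lambda>_. 1)"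
  by (simp add: inner_jet_one in_H1D(3,4) Ck_def inner_cl_real) (simp add: cosk_def)

lemma yint_eq_inner_jet: "ptest \<phi> \<Longrightarrow> yint \<phi> = jet \<phi> \<bullet> jet (\<lambda>_. 1)"
  by (simp add: inner_jet_one c0_jet Ck_def inner_cl_real square_integrable_continuous ptest_continuous)
     (simp add: cosk_def)

lemma inner_jet_one_one: "jet (\<lambda>_. 1) \<bullet> (jet (\<lambda>_. 1) :: ('d::finite) jets) = 1"
  using yint_eq_inner_jet[OF ptest_one] yint_one by metis

section \<open>Partial derivatives of Hilbert space valued functions\<close>

definition hder :: "(real \<times> (real^'d::finite) \<Rightarrow> 'h::real_normed_vector) \<Rightarrow> 'd option \<Rightarrow>
    (real \<times> (real^'d) \<Rightarrow> 'h) \<Rightarrow> bool" where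
  "hder \<Phi> p \<Psi> \<longleftrightarrow> (\<forall>tx. ((\<lambda>h. (\<Phi> (shift p h tx) - \<Phi> tx) /\<^sub>R h) \<longlongrightarrow> \<Psi> tx) (at 0))"

lemma hder_unique: "hder \<Phi> p \<Psi> \<Longrightarrow> hder \<Phi> p \<Psi>' \<Longrightarrow> \<Psi> = \<Psi>'"
  unfolding hder_def by (blast intro: tendsto_unique[OF at_neq_bot] ext)

lemma hder_bounded_linear:
  assumes L: "bounded_linear L" and d: "hder \<Phi> p \<Psi>"
  shows "hder (\<lambda>tx. L (\<Phi> tx)) p (\<lambda>tx. L (\<Psi> tx))"
  unfolding hder_def
proof
  fix tx
  have "((\<lambda>h. L ((\<Phi> (shift p h tx) - \<Phi> tx) /\<^sub>R h)) \<longlongrightarrow> L (\<Psi> tx)) (at 0)"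
    by (intro bounded_linear.tendsto[OF L] spec[OF d[unfolded hder_def]])
  then show "((\<lambda>h. (L (\<Phi> (shift p h tx)) - L (\<Phi> tx)) /\<^sub>R h) \<longlongrightarrow> L (\<Psi> tx)) (at 0)"
    by (simp add: linear_diff[OF bounded_linear.linear[OF L]] linear_cmul[OF bounded_linear.linear[OF L]])
qed

lemma hder_add:
  assumes \<Phi>: "hder \<Phi> p \<Phi>'" and \<Psi>: "hder \<Psi> p \<Psi>'"
  shows "hder (\<lambda>tx. \<Phi> tx + \<Psi> tx) p (\<lambda>tx. \<Phi>' tx + \<Psi>' tx)"
  unfolding hder_def
proof
  fix tx
  have "((\<lambda>h. (\<Phi> (shift p h tx) - \<Phi> tx) /\<^sub>R h + (\<Psi> (shift p h tx) - \<Psi> tx) /\<^sub>R h) \<longlongrightarrow> \<Phi>' tx + \<Psi>' tx) (at 0)"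
    by (intro tendsto_add spec[OF \<Phi>[unfolded hder_def]] spec[OF \<Psi>[unfolded hder_def]])
  then show "((\<lambda>h. (\<Phi> (shift p h tx) + \<Psi> (shift p h tx) - (\<Phi> tx + \<Psi> tx)) /\<^sub>R h) \<longlongrightarrow> \<Phi>' tx + \<Psi>' tx) (at 0)"
    by (simp add: scaleR_add_right[symmetric] add_diff_add)
qed

lemma hder_uminus: "hder \<Phi> p \<Phi>' \<Longrightarrow> hder (\<lambda>tx. - \<Phi> tx) p (\<lambda>tx. - \<Phi>' tx)"
  by (rule hder_bounded_linear) (rule bounded_linear_minus[OF bounded_linear_ident])

lemma hder_diff: "hder \<Phi> p \<Phi>' \<Longrightarrow> hder \<Psi> p \<Psi>' \<Longrightarrow> hder (\<lambda>tx. \<Phi> tx - \<Psi> tx) p (\<lambda>tx. \<Phi>' tx - \<Psi>' tx)"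
  using hder_add[OF _ hder_uminus, of \<Phi> p \<Phi>' \<Psi> \<Psi>'] by simp

lemma hder_zero: "hder (\<lambda>_. 0) p (\<lambda>_. 0)"
  by (simp add: hder_def)

lemma hder_sum:
  "(\<And>i. i \<in> A \<Longrightarrow> hder (\<Phi> i) p (\<Psi> i)) \<Longrightarrow> hder (\<lambda>tx. \<Sum>i\<in>A. \<Phi> i tx) p (\<lambda>tx. \<Sum>i\<in>A. \<Psi> i tx)"
proof (induction A rule: infinite_finite_induct)
  case (insert x F) then show ?case using hder_add[of "\<Phi> x"] by simp
qed (simp_all add: hder_zero)

text \<open>Ties a profile to its Hilbert space valued counterpart; only classes in y are recorded,
  so different choices of derivatives may share one counterpart.\<close>

definition represents :: "('d::finite) prof \<Rightarrow> (real \<times> (real^'d) \<Rightarrow> 'd jets) \<Rightarrow> bool" where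
  "represents U \<Psi> \<longleftrightarrow> (\<forall>t x. in_H1 (U t x) \<and> emb (U t x) = \<Psi> (t, x))"

text \<open>\<open>h1norm2\<close> is the squared norm of the embedded function, so the derivative
  of profiles is the norm limit of difference quotients in the Hilbert space.\<close>

lemma has_hpd_iff:
  assumes U: "represents U \<Phi>" and V: "represents V \<Psi>"
  shows "has_hpd U p V \<longleftrightarrow> hder \<Phi> p \<Psi>"
proof -
  have H: "in_H1 (U t x)" "in_H1 (V t x)" "emb (U t x) = \<Phi> (t, x)" "emb (V t x) = \<Psi> (t, x)" for t x
    using U V by (auto simp: represents_def)
  have eq: "h1norm2 (\<lambda>y. (case shift p h (t, x) of (s, z) \<Rightarrow> U s z y - U t x y) / h - V t x y) =
      (norm ((\<Phi> (shift p h (t, x)) - \<Phi> (t, x)) /\<^sub>R h - \<Psi> (t, x)))\<^sup>2" for t x h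
  proof -
    obtain s z where sz: "shift p h (t, x) = (s, z)" by (cases "shift p h (t, x)")
    note d1 = emb_diff[OF H(1)[of s z] H(1)[of t x]]
    note d2 = emb_scale[OF d1(1), of "inverse h"]
    note d3 = emb_diff[OF d2(1) H(2)[of t x]]
    show ?thesis
      using h1norm2_eq[OF d3(1)] unfolding d3(2) d2(2) d1(2)
      by (simp add: sz H divide_inverse mult.commute)
  qed
  have "((\<lambda>h. (norm ((\<Phi> (shift p h (t, x)) - \<Phi> (t, x)) /\<^sub>R h - \<Psi> (t, x)))\<^sup>2) \<longlongrightarrow> 0) (at 0) \<longleftrightarrow>
      ((\<lambda>h. (\<Phi> (shift p h (t, x)) - \<Phi> (t, x)) /\<^sub>R h) \<longlongrightarrow> \<Psi> (t, x)) (at 0)" (is "?L \<longleftrightarrow> ?R") for t x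
  proof
    assume ?L
    then have "((\<lambda>h. sqrt ((norm ((\<Phi> (shift p h (t, x)) - \<Phi> (t, x)) /\<^sub>R h - \<Psi> (t, x)))\<^sup>2)) \<longlongrightarrow> sqrt 0) (at 0)"
      by (rule tendsto_real_sqrt)
    then have "((\<lambda>h. norm ((\<Phi> (shift p h (t, x)) - \<Phi> (t, x)) /\<^sub>R h - \<Psi> (t, x))) \<longlongrightarrow> 0) (at 0)" by simp
    then show ?R by (rule LIM_zero_cancel[OF tendsto_norm_zero_cancel])
  next
    assume ?R
    then have "((\<lambda>h. (norm ((\<Phi> (shift p h (t, x)) - \<Phi> (t, x)) /\<^sub>R h - \<Psi> (t, x)))\<^sup>2) \<longlongrightarrow> (norm (\<Psi> (t, x) - \<Psi> (t, x)))\<^sup>2) (at 0)"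
      by (rule tendsto_power[OF tendsto_norm[OF tendsto_diff[OF _ tendsto_const]]])
    then show ?L by simp
  qed
  then show ?thesis by (simp add: has_hpd_def eq H(1,2) hder_def)
qed

text \<open>A smooth function is carried together with all its iterated partial derivatives, indexed by the
  list of differentiations with the outermost one first; their order is never interchanged.\<close>

definition smooth_family :: "('d::finite option list \<Rightarrow> real \<times> (real^'d) \<Rightarrow> 'h::real_normed_vector) \<Rightarrow> bool" where
  "smooth_family \<Phi> \<longleftrightarrow> (\<forall>ps p. hder (\<Phi> ps) p (\<Phi> (p # ps)))"

lemma smooth_familyD: "smooth_family \<Phi> \<Longrightarrow> hder (\<Phi> ps) p (\<Phi> (p # ps))"
  by (simp add: smooth_family_def)

text \<open>Uniqueness of limits propagates an equality of values to all derivatives. This later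
  allows an expansion proved pointwise to be inserted in operators that differentiate.\<close>

lemma smooth_family_eq:
  assumes "smooth_family \<Phi>" "smooth_family \<Psi>" "\<Phi> [] = \<Psi> []"
  shows "\<Phi> ps = \<Psi> ps"
proof (induction ps)
  case (Cons p ps)
  have "hder (\<Phi> ps) p (\<Psi> (p # ps))"
    unfolding Cons.IH by (rule smooth_familyD[OF assms(2)])
  then show ?case by (rule hder_unique[OF smooth_familyD[OF assms(1)]])
qed (rule assms)

definition H1_family :: "('d::finite option list \<Rightarrow> real \<times> (real^'d) \<Rightarrow> 'd jets) \<Rightarrow> bool" where
  "H1_family \<Phi> \<longleftrightarrow> smooth_family \<Phi> \<and> (\<forall>ps tx. \<Phi> ps tx \<in> H1S)"

text \<open>The family supplies some derivative, so the choice in \<open>hpd\<close> is a genuine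
  one; uniqueness in the Hilbert space then fixes its class.\<close>

lemma represents_hpd:
  assumes F: "H1_family \<Phi>" and U: "represents U (\<Phi> ps)"
  shows "represents (hpd p U) (\<Phi> (p # ps))"
proof -
  have "\<exists>v. in_H1 v \<and> emb v = \<Phi> (p # ps) (t, x)" for t x
    using F H1S_representative unfolding H1_family_def by metis
  then obtain V where V: "represents V (\<Phi> (p # ps))"
    unfolding represents_def by metis
  have der: "hder (\<Phi> ps) p (\<Phi> (p # ps))" using F by (simp add: H1_family_def smooth_family_def)
  have "has_hpd U p V" using has_hpd_iff[OF U V] der by simp
  then have hpd: "has_hpd U p (hpd p U)" unfolding hpd_def by (rule someI[of "has_hpd U p"])
  then have rep: "represents (hpd p U) (\<lambda>tx. emb (hpd p U (fst tx) (snd tx)))"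
    by (simp add: represents_def has_hpd_def)
  have "(\<lambda>tx. emb (hpd p U (fst tx) (snd tx))) = \<Phi> (p # ps)"
    using has_hpd_iff[OF U rep, of p] hpd der hder_unique by blast
  then show ?thesis using rep by simp
qed

lemma hsmooth_family:
  assumes "hsmooth U"
  obtains \<Phi> where "H1_family \<Phi>" "represents U (\<Phi> [])"
proof -
  obtain D where D: "D [] = U" "\<And>ps p. has_hpd (D ps) p (D (p # ps))"
    using assms unfolding hsmooth_def by blast
  define \<Phi> where "\<Phi> ps tx = emb (D ps (fst tx) (snd tx))" for ps tx
  have H: "in_H1 (D ps t x)" for ps t x using D(2)[of ps] by (auto simp: has_hpd_def)
  then have rep: "represents (D ps) (\<Phi> ps)" for ps by (simp add: represents_def \<Phi>_def)
  have "H1_family \<Phi>"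
    using has_hpd_iff[OF rep rep] D(2) in_H1D(2)[OF H]
    by (auto simp: H1_family_def smooth_family_def \<Phi>_def)
  then show ?thesis using that rep[of "[]"] D(1) by simp
qed

section \<open>The operators and correctors on the Hilbert space\<close>

lemma bounded_field_add:
  assumes A: "bounded_field A" and B: "bounded_field B"
  shows "bounded_field (\<lambda>y w. A y w + B y w)"
proof -
  obtain C D where C: "AE y in lebesgue_on cube. \<forall>v. norm (A y v) \<le> C * norm v"
    and D: "AE y in lebesgue_on cube. \<forall>v. norm (B y v) \<le> D * norm v"
    using A B unfolding bounded_field_def by blast
  have "AE y in lebesgue_on cube. \<forall>v. norm (A y v + B y v) \<le> (C + D) * norm v"
    using C D
  proof eventually_elim
    case (elim y)
    show ?case
    proof
      fix v
      have "norm (A y v + B y v) \<le> norm (A y v) + norm (B y v)" by (rule norm_triangle_ineq)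
      also have "\<dots> \<le> C * norm v + D * norm v" using elim by (intro add_mono) auto
      finally show "norm (A y v + B y v) \<le> (C + D) * norm v" by (simp add: distrib_right)
    qed
  qed
  moreover have "linear (\<lambda>w. A y w + B y w)" for y
    using A B unfolding bounded_field_def by (intro linear_compose_add) auto
  moreover have "(\<lambda>y. A y v + B y v) \<in> borel_measurable (lebesgue_on cube)" for v
    using A B unfolding bounded_field_def by (intro borel_measurable_add) auto
  ultimately show ?thesis unfolding bounded_field_def by blast
qed

lemma bounded_field_sum:
  fixes B :: "'i \<Rightarrow> real^'d::finite \<Rightarrow> 'b::euclidean_space \<Rightarrow> 'c::euclidean_space"
  shows "finite I \<Longrightarrow> (\<And>i. i \<in> I \<Longrightarrow> bounded_field (B i)) \<Longrightarrow> bounded_field (\<lambda>y w. \<Sum>i\<in>I. B i y w)"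
proof (induction I rule: finite_induct)
  case empty
  have "linear (\<lambda>_::'b. 0::'c)" by (rule linearI) simp_all
  then show ?case using bounded_field_const by simp
next
  case (insert i I)
  then show ?case using bounded_field_add[of "B i" "\<lambda>y w. \<Sum>i\<in>I. B i y w"] by simp
qed

lemma bounded_field_scale:
  fixes g :: "real^'d::finite \<Rightarrow> real"
  assumes g: "g \<in> borel_measurable (lebesgue_on cube)" and C: "AE y in lebesgue_on cube. \<bar>g y\<bar> \<le> C"
    and L: "linear L"
  shows "bounded_field (\<lambda>y w. g y *\<^sub>R L w)"
proof -
  obtain K where K: "\<And>w. norm (L w) \<le> K * norm w" using linear_bounded[OF L] by blast
  have "AE y in lebesgue_on cube. \<forall>w. norm (g y *\<^sub>R L w) \<le> (C * K) * norm w"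
    using C
  proof (rule eventually_mono, intro allI)
    fix y w assume "\<bar>g y\<bar> \<le> C"
    then have "\<bar>g y\<bar> * norm (L w) \<le> C * (K * norm w)" using K by (intro mult_mono) auto
    then show "norm (g y *\<^sub>R L w) \<le> (C * K) * norm w" by (simp add: mult.assoc)
  qed
  moreover have "(\<lambda>y. g y *\<^sub>R L v) \<in> borel_measurable (lebesgue_on cube)" for v
    using g by (intro borel_measurable_scaleR) auto
  ultimately show ?thesis
    using linear_compose_scale_right[OF L] unfolding bounded_field_def by blast
qed

lemma inner_mulop_emb:
  assumes B: "bounded_field B" and v: "in_H1 v" and \<phi>: "ptest \<phi>"
  shows "mulop B (emb v) \<bullet> jet \<phi> = yint (\<lambda>y. B y (v y, wgrad v y) \<bullet> (\<phi> y, ygrad \<phi> y))"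
    "integrable (lebesgue_on cube) (\<lambda>y. B y (v y, wgrad v y) \<bullet> (\<phi> y, ygrad \<phi> y))"
proof -
  note s = square_integrable_bounded_field[OF B in_H1D(1)[OF v]] square_integrable_jet[OF \<phi>]
  show "mulop B (emb v) \<bullet> jet \<phi> = yint (\<lambda>y. B y (v y, wgrad v y) \<bullet> (\<phi> y, ygrad \<phi> y))"
    unfolding emb_def jet_def mulop_cl[OF B in_H1D(1)[OF v]] by (simp add: inner_cl s yint_def)
  show "integrable (lebesgue_on cube) (\<lambda>y. B y (v y, wgrad v y) \<bullet> (\<phi> y, ygrad \<phi> y))"
    by (rule square_integrable_inner[OF s])
qed

lemma inner_matrix_transpose: "(A *v x) \<bullet> y = (transpose A *v y) \<bullet> (x :: real^'n)"
  by (metis dot_lmul_matrix inner_commute transpose_matrix_vector)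

locale elliptic =
  fixes a :: "real^'d::finite \<Rightarrow> real^'d^'d" and \<rho> :: "real^'d \<Rightarrow> real" and m1 :: real
  assumes m1_pos: "m1 > 0"
    and a_meas: "\<forall>i j. (\<lambda>y. a y $ i $ j) \<in> borel_measurable (lebesgue_on cube)"
    and a_bdd: "\<exists>C. AE y in lebesgue_on cube. \<forall>i j. \<bar>a y $ i $ j\<bar> \<le> C"
    and a_sym: "AE y in lebesgue_on cube. transpose (a y) = a y"
    and a_ell: "AE y in lebesgue_on cube. \<forall>\<xi>. (a y *v \<xi>) \<bullet> \<xi> \<ge> m1 * (norm \<xi>)^2"
    and rho_meas: "\<rho> \<in> borel_measurable (lebesgue_on cube)"
    and rho_bdd: "\<exists>C. AE y in lebesgue_on cube. \<bar>\<rho> y\<bar> \<le> C"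
begin

text \<open>In the weak form \<open>\<phi> \<mapsto> w \<bullet> jet \<phi>\<close> of distributions, \<open>-A\<^sub>y\<^sub>y\<close> is given by \<open>Top\<close>,
  the two halves of \<open>A\<^sub>x\<^sub>y\<close> by \<open>Div\<close> and \<open>Flux\<close>, and the zeroth order terms by \<open>Coef\<close> and \<open>Rho\<close>.\<close>

definition "Topf y w = (0::real, a y *v snd w)" for w :: "real \<times> (real^'d)"
definition "Divf i y w = ((a y *v snd w) $ i, 0::real^'d)" for w :: "real \<times> (real^'d)"
definition "Fluxf i y w = (0::real, a y *v (fst w *\<^sub>R axis i 1))" for w :: "real \<times> (real^'d)"
definition "Coeff i j y w = (a y $ i $ j * fst w, 0::real^'d)" for w :: "real \<times> (real^'d)"
definition "Rhof y w = (\<rho> y * fst w, 0::real^'d)" for w :: "real \<times> (real^'d)"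

text \<open>Building block for the fields below built from the matrix: each is a finite sum of
  matrix entries times constant linear maps.\<close>

lemma bounded_field_entry:
  "linear L \<Longrightarrow> bounded_field (\<lambda>y w. (a y $ i $ j) *\<^sub>R L w)"
proof -
  assume L: "linear L"
  obtain C where "AE y in lebesgue_on cube. \<forall>i j. \<bar>a y $ i $ j\<bar> \<le> C" using a_bdd by blast
  then have "AE y in lebesgue_on cube. \<bar>a y $ i $ j\<bar> \<le> C" by (rule eventually_mono) blast
  then show ?thesis using a_meas L by (intro bounded_field_scale) auto
qed

lemma bounded_field_Topf: "bounded_field Topf"
proof -
  have "Topf = (\<lambda>y w. \<Sum>i\<in>UNIV. \<Sum>j\<in>UNIV. (a y $ i $ j) *\<^sub>R (0, (snd w $ j) *\<^sub>R axis i 1))"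
  proof (intro ext)
    fix y and w :: "real \<times> (real^'d)"
    have "a y *v snd w = (\<Sum>i\<in>UNIV. ((a y *v snd w) $ i) *\<^sub>R axis i 1)"
      by (simp add: vec_eq_iff axis_def if_distrib[of "\<lambda>c. _ * c"] cong: if_cong)
    also have "\<dots> = (\<Sum>i\<in>UNIV. \<Sum>j\<in>UNIV. (a y $ i $ j) *\<^sub>R (snd w $ j) *\<^sub>R axis i 1)"
      by (simp add: matrix_vector_mult_def scaleR_sum_left)
    finally show "Topf y w = (\<Sum>i\<in>UNIV. \<Sum>j\<in>UNIV. (a y $ i $ j) *\<^sub>R (0, (snd w $ j) *\<^sub>R axis i 1))"
      by (simp add: Topf_def prod_eq_iff fst_sum snd_sum)
  qed
  then show ?thesis
    by (simp only:) (intro bounded_field_sum bounded_field_entry finite_class.finite_UNIV linearI,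
      simp_all add: scaleR_add_left)
qed

lemma bounded_field_Divf: "bounded_field (Divf i)"
proof -
  have "Divf i = (\<lambda>y w. \<Sum>j\<in>UNIV. (a y $ i $ j) *\<^sub>R (snd w $ j, 0))"
    by (intro ext) (simp add: Divf_def prod_eq_iff fst_sum snd_sum matrix_vector_mult_def)
  then show ?thesis
    by (simp only:) (intro bounded_field_sum bounded_field_entry finite_class.finite_UNIV linearI, simp_all)
qed

lemma bounded_field_Fluxf: "bounded_field (Fluxf i)"
proof -
  have "Fluxf i = (\<lambda>y w. \<Sum>l\<in>UNIV. (a y $ l $ i) *\<^sub>R (0, fst w *\<^sub>R axis l 1))"
    by (intro ext) (simp add: Fluxf_def prod_eq_iff fst_sum snd_sum vec_eq_iff matrix_vector_mult_def axis_def
        if_distrib[of "\<lambda>c. _ * c"] cong: if_cong)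
  then show ?thesis
    by (simp only:) (intro bounded_field_sum bounded_field_entry finite_class.finite_UNIV linearI,
      simp_all add: scaleR_add_left)
qed

lemma bounded_field_Coeff: "bounded_field (Coeff i j)"
proof -
  have "Coeff i j = (\<lambda>y w. (a y $ i $ j) *\<^sub>R (fst w, 0))"
    by (intro ext) (simp add: Coeff_def)
  then show ?thesis by (simp only:) (intro bounded_field_entry linearI, simp_all)
qed

lemma bounded_field_Rhof: "bounded_field Rhof"
proof -
  obtain C where C: "AE y in lebesgue_on cube. \<bar>\<rho> y\<bar> \<le> C" using rho_bdd by blast
  have "Rhof = (\<lambda>y w. \<rho> y *\<^sub>R (fst w, 0))" by (intro ext) (simp add: Rhof_def)
  then show ?thesis by (simp only:) (intro bounded_field_scale[OF rho_meas C] linearI, simp_all)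
qed

definition "Top = mulop Topf"
definition "Div i = mulop (Divf i)"
definition "Flux i = mulop (Fluxf i)"
definition "Coef i j = mulop (Coeff i j)"
definition "Rho = mulop Rhof"

lemma bounded_linear_ops:
  "bounded_linear Top" "bounded_linear (Div i)" "bounded_linear (Flux i)" "bounded_linear (Coef i j)"
  "bounded_linear Rho"
  unfolding Top_def Div_def Flux_def Coef_def Rho_def
  by (intro bounded_linear_mulop bounded_field_Topf bounded_field_Divf bounded_field_Fluxf
      bounded_field_Coeff bounded_field_Rhof)+

lemmas linear_ops = bounded_linear_ops[THEN bounded_linear.linear]

lemma ayy_eq: "in_H1 v \<Longrightarrow> ptest \<phi> \<Longrightarrow> ayy a v \<phi> = - (Top (emb v) \<bullet> jet \<phi>)"
  by (simp add: ayy_def Top_def inner_mulop_emb[OF bounded_field_Topf] Topf_def inner_prod_def)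

text \<open>Derivatives belonging to the operator are appended at the innermost end and those of the
  family prefixed, so differentiating the image never reorders derivatives. \<open>Flux\<close>
  carries a minus sign because its divergence in y was moved to the test function.\<close>

definition "KXY \<Phi> ps tx = (\<Sum>i\<in>UNIV. Div i (\<Phi> (ps @ [Some i]) tx) - Flux i (\<Phi> (ps @ [Some i]) tx))"
definition "KXX \<Phi> ps tx = (\<Sum>i\<in>UNIV. \<Sum>j\<in>UNIV. Coef i j (\<Phi> (ps @ [Some i, Some j]) tx))"
definition "KTT \<Phi> ps tx = Rho (\<Phi> (ps @ [None, None]) tx)"

lemma Axy_eq:
  assumes F: "H1_family \<Phi>" and U: "represents U (\<Phi> [])" and \<phi>: "ptest \<phi>"
  shows "Axy a U t x \<phi> = KXY \<Phi> [] (t, x) \<bullet> jet \<phi>"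
proof -
  define V where "V i = hpd (Some i) U t x" for i
  have V: "in_H1 (V i)" "emb (V i) = \<Phi> [Some i] (t, x)" for i
    using represents_hpd[OF F U, of "Some i"] by (auto simp: represents_def V_def)
  have mv: "a y *v (\<chi> j. V j y) = (\<Sum>i\<in>UNIV. a y *v (V i y *\<^sub>R axis i 1))" for y
  proof -
    have "(\<chi> j. V j y) = (\<Sum>i\<in>UNIV. V i y *\<^sub>R axis i 1)"
      by (simp add: vec_eq_iff axis_def if_distrib[of "\<lambda>c. _ * c"] cong: if_cong)
    then show ?thesis by (simp add: linear_sum[OF matrix_vector_mul_linear])
  qed
  have "(\<Sum>i\<in>UNIV. Div i (emb (V i)) \<bullet> jet \<phi>) = yint (\<lambda>y. (\<Sum>i\<in>UNIV. (a y *v wgrad (V i) y) $ i) * \<phi> y)"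
    using inner_mulop_emb(2)[OF bounded_field_Divf V(1) \<phi>]
    by (simp add: Div_def inner_mulop_emb(1)[OF bounded_field_Divf V(1) \<phi>] Divf_def inner_prod_def
        sum_distrib_right yint_def)
  moreover have "(\<Sum>i\<in>UNIV. Flux i (emb (V i)) \<bullet> jet \<phi>) = yint (\<lambda>y. (a y *v (\<chi> j. V j y)) \<bullet> ygrad \<phi> y)"
    using inner_mulop_emb(2)[OF bounded_field_Fluxf V(1) \<phi>]
    by (simp add: Flux_def inner_mulop_emb(1)[OF bounded_field_Fluxf V(1) \<phi>] Fluxf_def inner_prod_def
        mv inner_sum_left yint_def)
  ultimately show ?thesis
    by (simp add: Axy_def KXY_def V(2)[symmetric] V_def[symmetric] inner_sum_left inner_diff_left sum_subtractf)
qed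

lemma Axx_eq:
  assumes F: "H1_family \<Phi>" and U: "represents U (\<Phi> [])" and \<phi>: "ptest \<phi>"
  shows "Axx a U t x \<phi> = KXX \<Phi> [] (t, x) \<bullet> jet \<phi>"
proof -
  define V where "V i j = hpd (Some i) (hpd (Some j) U) t x" for i j
  have V: "in_H1 (V i j)" "emb (V i j) = \<Phi> [Some i, Some j] (t, x)" for i j
    using represents_hpd[OF F represents_hpd[OF F U, of "Some j"], of "Some i"]
    by (auto simp: represents_def V_def)
  show ?thesis
    using inner_mulop_emb(2)[OF bounded_field_Coeff V(1) \<phi>]
    by (simp add: Axx_def fdist_def KXX_def V(2)[symmetric] V_def[symmetric] inner_sum_left Coef_def
        inner_mulop_emb(1)[OF bounded_field_Coeff V(1) \<phi>] Coeff_def inner_prod_def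
        sum_distrib_right yint_def)
qed

lemma Rtt_eq:
  assumes F: "H1_family \<Phi>" and U: "represents U (\<Phi> [])" and \<phi>: "ptest \<phi>"
  shows "Rtt \<rho> U t x \<phi> = KTT \<Phi> [] (t, x) \<bullet> jet \<phi>"
proof -
  define V where "V = hpd None (hpd None U) t x"
  have V: "in_H1 V" "emb V = \<Phi> [None, None] (t, x)"
    using represents_hpd[OF F represents_hpd[OF F U, of None], of None]
    by (auto simp: represents_def V_def)
  show ?thesis
    by (simp add: Rtt_def fdist_def KTT_def V(2)[symmetric] V_def[symmetric] Rho_def
        inner_mulop_emb(1)[OF bounded_field_Rhof V(1) \<phi>] Rhof_def inner_prod_def)
qed

lemma hder_KXY: "smooth_family \<Phi> \<Longrightarrow> hder (KXY \<Phi> ps) p (KXY \<Phi> (p # ps))"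
  unfolding KXY_def by (auto intro!: hder_sum hder_diff hder_bounded_linear[OF bounded_linear_ops(2)]
      hder_bounded_linear[OF bounded_linear_ops(3)] dest: smooth_familyD)

lemma hder_KXX: "smooth_family \<Phi> \<Longrightarrow> hder (KXX \<Phi> ps) p (KXX \<Phi> (p # ps))"
  unfolding KXX_def by (auto intro!: hder_sum hder_bounded_linear[OF bounded_linear_ops(4)] dest: smooth_familyD)

lemma hder_KTT: "smooth_family \<Phi> \<Longrightarrow> hder (KTT \<Phi> ps) p (KTT \<Phi> (p # ps))"
  unfolding KTT_def by (auto intro!: hder_bounded_linear[OF bounded_linear_ops(5)] dest: smooth_familyD)

lemma KXY_sum: "KXY (\<lambda>ps tx. \<Sum>n\<in>A. \<Phi> n ps tx) ps tx = (\<Sum>n\<in>A. KXY (\<Phi> n) ps tx)"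
  by (simp add: KXY_def linear_sum[OF linear_ops(2)] linear_sum[OF linear_ops(3)] sum_subtractf
      sum.swap[of _ A UNIV])

lemma KXX_sum: "KXX (\<lambda>ps tx. \<Sum>n\<in>A. \<Phi> n ps tx) ps tx = (\<Sum>n\<in>A. KXX (\<Phi> n) ps tx)"
  by (simp add: KXX_def linear_sum[OF linear_ops(4)] sum.swap[of _ A UNIV])

lemma KTT_sum: "KTT (\<lambda>ps tx. \<Sum>n\<in>A. \<Phi> n ps tx) ps tx = (\<Sum>n\<in>A. KTT (\<Phi> n) ps tx)"
  by (simp add: KTT_def linear_sum[OF linear_ops(5)])

text \<open>The cell problem is solved in the space of mean-zero functions, where Poincare's inequality
  makes the form coercive.\<close>

abbreviation J1 :: "'d jets" where "J1 \<equiv> jet (\<lambda>_. 1)"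

definition "S0 = {w \<in> H1S. w \<bullet> J1 = 0}"

lemma subspace_S0: "subspace S0"
  using subspace_H1S by (auto simp: S0_def subspace_def inner_add_left)

lemma closed_S0: "closed S0"
proof -
  have eq: "S0 = H1S \<inter> {w. w \<bullet> J1 = 0}" by (auto simp: S0_def)
  show ?thesis unfolding eq by (intro closed_Int closed_H1S closed_Collect_eq continuous_intros)
qed

lemma Top_sym: "Top u \<bullet> v = Top v \<bullet> u"
proof (cases u, cases v)
  fix f g assume f: "square_integrable f" "u = cl f" and g: "square_integrable g" "v = cl g"
  note s = square_integrable_bounded_field[OF bounded_field_Topf]
  have "integral\<^sup>L (lebesgue_on cube) (\<lambda>y. Topf y (f y) \<bullet> g y) = integral\<^sup>L (lebesgue_on cube) (\<lambda>y. Topf y (g y) \<bullet> f y)"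
  proof (rule integral_cong_AE)
    show "AE y in lebesgue_on cube. Topf y (f y) \<bullet> g y = Topf y (g y) \<bullet> f y"
      using a_sym
    proof (rule eventually_mono)
      fix y assume "transpose (a y) = a y"
      then show "Topf y (f y) \<bullet> g y = Topf y (g y) \<bullet> f y"
        using inner_matrix_transpose[of "a y" "snd (f y)" "snd (g y)"] by (simp add: Topf_def inner_prod_def)
    qed
  qed (use square_integrable_inner[OF s[OF f(1)] g(1)] square_integrable_inner[OF s[OF g(1)] f(1)] in auto)
  then show ?thesis
    by (simp add: Top_def f g mulop_cl[OF bounded_field_Topf] inner_cl s)
qed

lemma Top_elliptic: "m1 * (\<Sum>i\<in>UNIV. (norm (ci i w))\<^sup>2) \<le> Top w \<bullet> w"
proof (cases w)
  case (cl f)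
  note s = square_integrable_bounded_field[OF bounded_field_Topf cl(1)]
  have i: "integrable (lebesgue_on cube) (\<lambda>y. (snd (f y) $ i)\<^sup>2)" for i
    using square_integrable_snd_nth[OF cl(1), of i] by (simp add: square_integrable_def)
  have "m1 * (\<Sum>i\<in>UNIV. (norm (ci i w))\<^sup>2) = integral\<^sup>L (lebesgue_on cube) (\<lambda>y. m1 * (\<Sum>i\<in>UNIV. (snd (f y) $ i)\<^sup>2))"
    using i by (simp add: cl(2) ci_cl[OF cl(1)] norm_cl[OF square_integrable_snd_nth[OF cl(1)]])
  also have "\<dots> \<le> integral\<^sup>L (lebesgue_on cube) (\<lambda>y. Topf y (f y) \<bullet> f y)"
  proof (rule integral_mono_AE)
    show "integrable (lebesgue_on cube) (\<lambda>y. m1 * (\<Sum>i\<in>UNIV. (snd (f y) $ i)\<^sup>2))" using i by simp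
    show "integrable (lebesgue_on cube) (\<lambda>y. Topf y (f y) \<bullet> f y)" by (rule square_integrable_inner[OF s cl(1)])
    show "AE y in lebesgue_on cube. m1 * (\<Sum>i\<in>UNIV. (snd (f y) $ i)\<^sup>2) \<le> Topf y (f y) \<bullet> f y"
      using a_ell
    proof (rule eventually_mono)
      fix y assume "\<forall>\<xi>. (a y *v \<xi>) \<bullet> \<xi> \<ge> m1 * (norm \<xi>)^2"
      then have "m1 * (norm (snd (f y)))^2 \<le> (a y *v snd (f y)) \<bullet> snd (f y)" by blast
      moreover have "(norm (snd (f y)))^2 = (\<Sum>i\<in>UNIV. (snd (f y) $ i)\<^sup>2)"
        by (simp only: power2_norm_eq_inner inner_vec_def) (simp add: power2_eq_square)
      ultimately show "m1 * (\<Sum>i\<in>UNIV. (snd (f y) $ i)\<^sup>2) \<le> Topf y (f y) \<bullet> f y"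
        by (simp add: Topf_def inner_prod_def)
    qed
  qed
  also have "\<dots> = Top w \<bullet> w" by (simp add: Top_def cl mulop_cl[OF bounded_field_Topf cl(1)] inner_cl s)
  finally show ?thesis .
qed

text \<open>Half of \<open>m1\<close> remains since, by Poincare with constant one, the full squared
  norm is at most twice the gradient part.\<close>

lemma Top_coercive:
  assumes "w \<in> S0"
  shows "m1 / 2 * (norm w)\<^sup>2 \<le> Top w \<bullet> w"
proof -
  have "(norm w)\<^sup>2 \<le> 2 * (\<Sum>i\<in>UNIV. (norm (ci i w))\<^sup>2)"
    using Poincare[of w] assms norm_jets[of w] by (simp add: S0_def)
  then have "m1 / 2 * (norm w)\<^sup>2 \<le> m1 / 2 * (2 * (\<Sum>i\<in>UNIV. (norm (ci i w))\<^sup>2))"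
    using m1_pos by (intro mult_left_mono) auto
  then show ?thesis using Top_elliptic[of w] by simp
qed

lemma Top_J1: "Top w \<bullet> J1 = 0"
proof (cases w)
  case (cl f)
  note s = square_integrable_bounded_field[OF bounded_field_Topf cl(1)]
  have g: "ygrad (\<lambda>_::real^'d. 1) y = 0" for y by (simp add: ygrad_def vec_eq_iff)
  show ?thesis
    unfolding cl(2) Top_def mulop_cl[OF bounded_field_Topf cl(1)] jet_def
    by (subst inner_cl[OF s square_integrable_jet[OF ptest_one]]) (simp add: Topf_def inner_prod_def g)
qed

text \<open>The kernel consists of the constants: density permits testing with w itself, ellipticity
  removes the gradient, and Poincare removes what is left after subtracting the mean.\<close>

lemma Top_unique:
  assumes w: "w \<in> H1S" and T: "\<And>\<phi>. ptest \<phi> \<Longrightarrow> Top w \<bullet> jet \<phi> = 0"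
  shows "w = (w \<bullet> J1) *\<^sub>R J1"
proof -
  have "Top w \<bullet> w = 0" by (rule H1S_density[OF w T])
  then have "m1 * (\<Sum>i\<in>UNIV. (norm (ci i w))\<^sup>2) \<le> 0" using Top_elliptic[of w] by simp
  then have "(\<Sum>i\<in>UNIV. (norm (ci i w))\<^sup>2) \<le> 0" using m1_pos by (simp add: mult_le_0_iff)
  then have sz: "(\<Sum>i\<in>UNIV. (norm (ci i w))\<^sup>2) = 0" by (intro antisym sum_nonneg) auto
  then have z: "ci i w = 0" for i by (simp add: sum_nonneg_eq_0_iff)
  have zJ: "ci i J1 = 0" for i by (simp add: ci_jet ptest_one cl_zero)
  define d where "d = w - (w \<bullet> J1) *\<^sub>R J1"
  have d: "d \<in> H1S" unfolding d_def
    by (intro subspace_diff[OF subspace_H1S] subspace_scale[OF subspace_H1S] w jet_in_H1S ptest_one)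
  have "d \<bullet> J1 = 0" by (simp add: d_def inner_diff_left inner_jet_one_one)
  moreover have cz: "ci i d = 0" for i by (simp add: d_def linear_diff[OF linear_ci] linear_cmul[OF linear_ci] z zJ)
  ultimately have "(norm (c0 d))\<^sup>2 \<le> 0" using Poincare[OF d] by simp
  then have "(norm d)\<^sup>2 = 0" using norm_jets[of d] by (simp add: cz)
  then show ?thesis by (simp add: d_def)
qed

text \<open>The mean-zero solution of -\<open>A_yy\<close> v = (I - pi) h. Testing only with
  mean-zero functions builds the projection in, so every h is admissible and the solution map is
  linear on the whole space.\<close>

definition "sol h = (SOME v. v \<in> S0 \<and> (\<forall>s\<in>S0. Top v \<bullet> s = h \<bullet> s))"

lemma sol: "sol h \<in> S0" "s \<in> S0 \<Longrightarrow> Top (sol h) \<bullet> s = h \<bullet> s"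
proof -
  obtain v where "v \<in> S0" "\<And>s. s \<in> S0 \<Longrightarrow> Top v \<bullet> s = h \<bullet> s"
    by (rule Lax_Milgram_symmetric[of Top S0 "m1 / 2" h])
       (use bounded_linear_ops closed_S0 subspace_S0 Top_sym Top_coercive m1_pos in auto)
  then have "sol h \<in> S0 \<and> (\<forall>s\<in>S0. Top (sol h) \<bullet> s = h \<bullet> s)"
    unfolding sol_def by (intro someI[where P = "\<lambda>v. v \<in> S0 \<and> (\<forall>s\<in>S0. Top v \<bullet> s = h \<bullet> s)"]) auto
  then show "sol h \<in> S0" "s \<in> S0 \<Longrightarrow> Top (sol h) \<bullet> s = h \<bullet> s" by auto
qed

lemma sol_eqI:
  assumes v: "v \<in> S0" "\<And>s. s \<in> S0 \<Longrightarrow> Top v \<bullet> s = h \<bullet> s"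
  shows "sol h = v"
proof -
  have d: "sol h - v \<in> S0" using sol(1) v(1) by (rule subspace_diff[OF subspace_S0])
  have "Top (sol h - v) \<bullet> (sol h - v) = 0"
    using v(2)[OF d] sol(2)[OF d, of h] by (simp add: linear_diff[OF linear_ops(1)] inner_diff_left)
  then have "m1 / 2 * (norm (sol h - v))\<^sup>2 \<le> 0" using Top_coercive[OF d] by simp
  then show ?thesis using m1_pos by (simp add: mult_le_0_iff)
qed

text \<open>Testing with the solution itself gives the bound with constant 2/\<open>m1\<close>.
  Boundedness is what carries derivatives in (t, x) through the cell problem.\<close>

lemma bounded_linear_sol: "bounded_linear sol"
proof (rule bounded_linear_intro)
  fix g h :: "'d jets" and r :: real
  show "sol (g + h) = sol g + sol h"
    by (rule sol_eqI)
       (simp_all add: subspace_add[OF subspace_S0] sol linear_add[OF linear_ops(1)] inner_add_left)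
  show "sol (r *\<^sub>R h) = r *\<^sub>R sol h"
    by (rule sol_eqI)
       (simp_all add: subspace_scale[OF subspace_S0] sol linear_cmul[OF linear_ops(1)])
  have "m1 / 2 * (norm (sol h))\<^sup>2 \<le> h \<bullet> sol h"
    using Top_coercive[OF sol(1)] sol(2)[OF sol(1)] by simp
  also have "\<dots> \<le> norm h * norm (sol h)" by (rule norm_cauchy_schwarz)
  finally have "norm (sol h) * (m1 / 2 * norm (sol h)) \<le> norm (sol h) * norm h"
    by (simp add: power2_eq_square mult_ac)
  then have "m1 / 2 * norm (sol h) \<le> norm h"
    by (cases "sol h = 0") (auto dest: mult_left_le_imp_le)
  then show "norm (sol h) \<le> norm h * (2 / m1)" using m1_pos by (simp add: field_simps)
qed

lemmas linear_sol = bounded_linear_sol[THEN bounded_linear.linear]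

text \<open>Subtracting its mean makes any test admissible in the cell problem; the constant part
  contributes nothing on the left, and on the right it produces the projection.\<close>

lemma Top_sol:
  assumes "ptest \<phi>"
  shows "Top (sol h) \<bullet> jet \<phi> = h \<bullet> jet \<phi> - (h \<bullet> J1) * yint \<phi>"
proof -
  have "jet \<phi> - yint \<phi> *\<^sub>R J1 \<in> S0"
    using assms by (auto simp: S0_def inner_diff_left yint_eq_inner_jet inner_jet_one_one
        intro!: subspace_diff[OF subspace_H1S] subspace_scale[OF subspace_H1S] jet_in_H1S ptest_one)
  from sol(2)[OF this, of h] show ?thesis
    by (simp add: inner_diff_right Top_J1 mult.commute)
qed

text \<open>\<open>sol h\<close> gives existence for the choice in \<open>ayy_inv\<close>, and
  \<open>Top_unique\<close> with the mean condition gives uniqueness. The sign appears because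
  \<open>Top\<close> stands for -\<open>A_yy\<close>.\<close>

lemma ayy_inv_eq:
  assumes F: "\<And>\<phi>. ptest \<phi> \<Longrightarrow> F \<phi> = h \<bullet> jet \<phi>"
  shows "in_H1 (ayy_inv a (Ipi F))" "emb (ayy_inv a (Ipi F)) = - sol h"
proof -
  let ?P = "\<lambda>v. in_H1 v \<and> yint v = 0 \<and> (\<forall>\<phi>. ptest \<phi> \<longrightarrow> ayy a v \<phi> = Ipi F \<phi>)"
  have I: "Ipi F \<phi> = Top (sol h) \<bullet> jet \<phi>" if "ptest \<phi>" for \<phi>
    using that by (simp add: Ipi_def pid_def F ptest_one Top_sol)
  have "- sol h \<in> S0" using sol(1) by (rule subspace_neg[OF subspace_S0])
  then have n: "- sol h \<in> H1S" "- sol h \<bullet> J1 = 0" by (auto simp: S0_def)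
  obtain v where v: "in_H1 v" "emb v = - sol h" using H1S_representative[OF n(1)] .
  have "?P v"
    using v n(2) I by (simp add: yint_eq_inner ayy_eq linear_neg[OF linear_ops(1)])
  then have P: "?P (ayy_inv a (Ipi F))" unfolding ayy_inv_def by (rule someI[of ?P])
  then show H: "in_H1 (ayy_inv a (Ipi F))" by simp
  let ?w = "emb (ayy_inv a (Ipi F))"
  have "?w + sol h \<in> H1S" using in_H1D(2)[OF H] sol(1)[of h]
    by (intro subspace_add[OF subspace_H1S]) (simp_all add: S0_def)
  moreover have "Top (?w + sol h) \<bullet> jet \<phi> = 0" if "ptest \<phi>" for \<phi>
    using P I[OF that] that ayy_eq[OF H that] by (simp add: linear_add[OF linear_ops(1)] inner_add_left)
  ultimately have "?w + sol h = ((?w + sol h) \<bullet> J1) *\<^sub>R J1" by (rule Top_unique)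
  moreover have "(?w + sol h) \<bullet> J1 = 0"
    using P sol(1)[of h] by (simp add: inner_add_left yint_eq_inner[symmetric] S0_def)
  ultimately show "?w = - sol h" by (simp add: eq_neg_iff_add_eq_0)
qed

text \<open>\<open>cor (n + 1) f\<close> is the family of derivatives of \<open>\<chi>\<^sub>n f\<close>, with the index shift of \<open>chiX\<close>.\<close>

fun cor :: "nat \<Rightarrow> ('d option list \<Rightarrow> real \<times> (real^'d) \<Rightarrow> real) \<Rightarrow> 'd option list \<Rightarrow> real \<times> (real^'d) \<Rightarrow> 'd jets" where
  "cor 0 f = (\<lambda>ps tx. 0)"
| "cor (Suc 0) f = (\<lambda>ps tx. f ps tx *\<^sub>R J1)"
| "cor (Suc (Suc n)) f = (\<lambda>ps tx. sol (KXY (cor (Suc n) f) ps tx + KXX (cor n f) ps tx - KTT (cor n f) ps tx))"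

text \<open>The derivatives of a corrector satisfy the same recursion as the corrector, because
  every operator in it is bounded, linear and independent of (t, x).\<close>

lemma H1_family_cor:
  assumes f: "smooth_family f"
  shows "H1_family (cor n f)"
proof (induction n rule: less_induct)
  case (less n)
  consider "n = 0" | "n = Suc 0" | m where "n = Suc (Suc m)" by (metis not0_implies_Suc)
  then show ?case
  proof cases
    case 1 then show ?thesis
      by (simp add: H1_family_def smooth_family_def hder_zero subspace_0[OF subspace_H1S])
  next
    case 2
    have "hder (\<lambda>tx. f ps tx *\<^sub>R J1) p (\<lambda>tx. f (p # ps) tx *\<^sub>R J1)" for ps p
      by (rule hder_bounded_linear[OF bounded_linear_scaleR_left smooth_familyD[OF f]])
    then show ?thesis
      by (simp add: 2 H1_family_def smooth_family_def subspace_scale[OF subspace_H1S] jet_in_H1S ptest_one)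
  next
    case 3
    have s: "smooth_family (cor (Suc m) f)" "smooth_family (cor m f)"
      using less.IH 3 by (auto simp: H1_family_def)
    have "hder (cor n f ps) p (cor n f (p # ps))" for ps p
      unfolding 3 cor.simps
      by (intro hder_bounded_linear[OF bounded_linear_sol] hder_add hder_diff hder_KXY hder_KXX hder_KTT s)
    moreover have "cor n f ps tx \<in> H1S" for ps tx
      using sol(1) by (simp add: 3 S0_def)
    ultimately show ?thesis by (simp add: H1_family_def smooth_family_def)
  qed
qed

text \<open>The minus sign in the recursion for chi_k cancels the one in \<open>ayy_inv_eq\<close>,
  which is why \<open>cor\<close> has none.\<close>

lemma represents_chiX:
  assumes f: "smooth_family f"
  shows "represents (chiX a \<rho> n (\<lambda>t x. f [] (t, x))) (cor n f [])"
proof (induction n rule: less_induct)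
  case (less n)
  consider "n = 0" | "n = Suc 0" | m where "n = Suc (Suc m)" by (metis not0_implies_Suc)
  then show ?case
  proof cases
    case 1 then show ?thesis by (simp add: represents_def emb_const)
  next
    case 2 then show ?thesis by (simp add: represents_def emb_const)
  next
    case 3
    let ?f = "\<lambda>t x. f [] (t, x)"
    have r: "represents (chiX a \<rho> (Suc m) ?f) (cor (Suc m) f [])" "represents (chiX a \<rho> m ?f) (cor m f [])"
      using less.IH 3 by auto
    define h where "h tx = KXY (cor (Suc m) f) [] tx + KXX (cor m f) [] tx - KTT (cor m f) [] tx" for tx
    define F where "F t x = (\<lambda>\<phi>. Axy a (chiX a \<rho> (Suc m) ?f) t x \<phi> + Axx a (chiX a \<rho> m ?f) t x \<phi>
      - Rtt \<rho> (chiX a \<rho> m ?f) t x \<phi>)" for t x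
    have F: "F t x \<phi> = h (t, x) \<bullet> jet \<phi>" if "ptest \<phi>" for t x \<phi>
      using that by (simp add: F_def h_def inner_add_left inner_diff_left
          Axy_eq[OF H1_family_cor[OF f] r(1)] Axx_eq[OF H1_family_cor[OF f] r(2)] Rtt_eq[OF H1_family_cor[OF f] r(2)])
    have "chiX a \<rho> n ?f = (\<lambda>t x y. - 1 * ayy_inv a (Ipi (F t x)) y)" by (simp add: 3 F_def)
    moreover have "in_H1 (\<lambda>y. - 1 * ayy_inv a (Ipi (F t x)) y)"
      "emb (\<lambda>y. - 1 * ayy_inv a (Ipi (F t x)) y) = sol (h (t, x))" for t x
      using emb_scale[OF ayy_inv_eq(1)[of "F t x" "h (t, x)"], of "-1"] ayy_inv_eq(2)[of "F t x" "h (t, x)"] F by auto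
    ultimately show ?thesis by (simp add: represents_def 3 h_def)
  qed
qed

text \<open>Up to sign, this operator is the mean that I - pi discards from the data of the cell
  problem for chi_(n+2).\<close>

lemma astar_eq:
  assumes f: "smooth_family f"
  shows "astar a \<rho> (n + 2) (\<lambda>t x. f [] (t, x)) t x =
    - ((KXY (cor (n + 2) f) [] (t, x) + KXX (cor (n + 1) f) [] (t, x) - KTT (cor (n + 1) f) [] (t, x)) \<bullet> J1)"
  by (simp add: astar_def pid_def Axy_eq[OF H1_family_cor[OF f] represents_chiX[OF f] ptest_one]
      Axx_eq[OF H1_family_cor[OF f] represents_chiX[OF f] ptest_one]
      Rtt_eq[OF H1_family_cor[OF f] represents_chiX[OF f] ptest_one] inner_add_left inner_diff_left
      del: cor.simps chiX.simps)

text \<open>chi_0 f is constant in y, so the gradient half vanishes; the flux half is a divergence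
  in y and has mean zero. This gives pi w_(-1) = 0 and removes the first term of the later
  sums.\<close>

lemma KXY_cor_1: "KXY (cor (Suc 0) f) ps tx \<bullet> J1 = 0"
proof -
  have d: "Div i J1 = 0" for i
  proof -
    have "Div i J1 = cl (\<lambda>y. Divf i y (1, ygrad (\<lambda>_. 1) y))"
      unfolding Div_def jet_def by (rule mulop_cl[OF bounded_field_Divf square_integrable_jet[OF ptest_one]])
    also have "(\<lambda>y. Divf i y (1, ygrad (\<lambda>_. 1) y)) = (\<lambda>_. 0)"
    proof
      fix y
      have "ygrad (\<lambda>_::real^'d. 1) y = 0" by (simp add: ygrad_def vec_eq_iff)
      then show "Divf i y (1, ygrad (\<lambda>_. 1) y) = 0" by (simp add: Divf_def zero_prod_def)
    qed
    finally show ?thesis by (simp add: cl_zero)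
  qed
  have "Flux i J1 \<bullet> J1 = 0" for i
  proof -
    have "ygrad (\<lambda>_::real^'d. 1) y = 0" for y by (simp add: ygrad_def vec_eq_iff)
    then show ?thesis
      unfolding Flux_def jet_def mulop_cl[OF bounded_field_Fluxf square_integrable_jet[OF ptest_one]]
      by (subst inner_cl[OF square_integrable_bounded_field[OF bounded_field_Fluxf square_integrable_jet[OF ptest_one]]
            square_integrable_jet[OF ptest_one]]) (simp add: Fluxf_def inner_prod_def)
  qed
  then show ?thesis
    by (simp add: KXY_def linear_cmul[OF linear_ops(2)] linear_cmul[OF linear_ops(3)] d inner_sum_left)
qed

text \<open>The coefficient of \<open>\<epsilon>\<^sup>\<ell>\<^sup>-\<^sup>2\<close> in the equation is \<open>Top (U \<ell>) - rhs U \<ell>\<close>.\<close>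

fun rhs :: "(nat \<Rightarrow> 'd option list \<Rightarrow> real \<times> (real^'d) \<Rightarrow> 'd jets) \<Rightarrow> nat \<Rightarrow> 'd option list \<Rightarrow> real \<times> (real^'d) \<Rightarrow> 'd jets" where
  "rhs U 0 = (\<lambda>ps tx. 0)"
| "rhs U (Suc 0) = KXY (U 0)"
| "rhs U (Suc (Suc l)) = (\<lambda>ps tx. KXY (U (Suc l)) ps tx + KXX (U l) ps tx - KTT (U l) ps tx)"

text \<open>For \<open>m\<close> the means of the profiles this is the sum of chi_n pi u_(l-n),
  whose term n = 0 is the mean itself.\<close>

definition expansion where
  "expansion m l ps tx = (\<Sum>n\<le>l. cor (Suc n) (m (l - n)) ps tx)"

text \<open>The convention chi_(-1) = 0 pads the second order sums by a zero term. All sums then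
  share one range, and the n-th summand is the datum of the cell problem for chi_(n+1).\<close>

lemma rhs_expansion:
  assumes U: "\<And>i. i < l \<Longrightarrow> U i = expansion m i"
  shows "rhs U l ps tx = (\<Sum>n<l. KXY (cor (Suc n) (m (l - Suc n))) ps tx
      + KXX (cor n (m (l - Suc n))) ps tx - KTT (cor n (m (l - Suc n))) ps tx)"
proof -
  have z: "KXX (\<lambda>ps tx. 0) ps tx = 0" "KTT (\<lambda>ps tx. 0) ps tx = 0" for ps tx
    by (simp_all add: KXX_def KTT_def linear_0[OF linear_ops(4)] linear_0[OF linear_ops(5)])
  have ex: "expansion m i = (\<lambda>ps tx. \<Sum>n\<le>i. cor (Suc n) (m (i - n)) ps tx)" for i
    by (intro ext) (simp add: expansion_def)
  have shift: "(\<Sum>n<Suc (Suc k). g n) = (\<Sum>n\<le>k. g (Suc n))" if "g 0 = 0" for g :: "nat \<Rightarrow> 'd jets" and k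
    using that by (simp only: lessThan_Suc_atMost sum.atMost_Suc_shift add_0)
  consider "l = 0" | "l = Suc 0" | k where "l = Suc (Suc k)" by (metis not0_implies_Suc)
  then show ?thesis
  proof cases
    case 1 then show ?thesis by simp
  next
    case 2
    have "U 0 = expansion m 0" using U 2 by simp
    then show ?thesis by (simp add: 2 z ex)
  next
    case 3
    have "U k = expansion m k" "U (Suc k) = expansion m (Suc k)" using U 3 by auto
    then have "rhs U l ps tx = (\<Sum>n\<le>Suc k. KXY (cor (Suc n) (m (Suc k - n))) ps tx)
        + (\<Sum>n\<le>k. KXX (cor (Suc n) (m (k - n))) ps tx) - (\<Sum>n\<le>k. KTT (cor (Suc n) (m (k - n))) ps tx)"
      unfolding 3 rhs.simps ex by (simp only: KXY_sum KXX_sum KTT_sum)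
    moreover have "(\<Sum>n\<le>k. KXX (cor (Suc n) (m (k - n))) ps tx) = (\<Sum>n<Suc (Suc k). KXX (cor n (m (Suc k - n))) ps tx)"
      by (subst shift) (simp_all add: z del: sum.lessThan_Suc)
    moreover have "(\<Sum>n\<le>k. KTT (cor (Suc n) (m (k - n))) ps tx) = (\<Sum>n<Suc (Suc k). KTT (cor n (m (Suc k - n))) ps tx)"
      by (subst shift) (simp_all add: z del: sum.lessThan_Suc)
    ultimately show ?thesis
      by (simp only: 3 lessThan_Suc_atMost sum.distrib sum_subtractf diff_Suc_Suc)
  qed
qed

lemma sol_rhs_expansion:
  assumes U: "\<And>i. i < l \<Longrightarrow> U i = expansion m i"
  shows "sol (rhs U l ps tx) + m l ps tx *\<^sub>R J1 = expansion m l ps tx"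
proof -
  have "sol (rhs U l ps tx) = (\<Sum>n<l. cor (Suc (Suc n)) (m (l - Suc n)) ps tx)"
    by (simp add: rhs_expansion[where U = U and m = m and l = l, OF U] linear_sum[OF linear_sol])
  moreover have "expansion m l ps tx = cor (Suc 0) (m l) ps tx + (\<Sum>n<l. cor (Suc (Suc n)) (m (l - Suc n)) ps tx)"
    unfolding expansion_def by (simp add: sum.atMost_shift del: cor.simps)
  ultimately show ?thesis by simp
qed

lemma smooth_family_expansion:
  assumes "\<And>l. smooth_family (m l)"
  shows "smooth_family (expansion m l)"
  unfolding smooth_family_def
proof (intro allI)
  fix ps p
  have "smooth_family (cor n (m i))" for n i using H1_family_cor[OF assms] by (simp add: H1_family_def)
  then show "hder (expansion m l ps) p (expansion m l (p # ps))"
    unfolding expansion_def by (intro hder_sum smooth_familyD)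
qed

section \<open>Residuals, expansion of the profiles and homogenized equations\<close>

lemma wres_eq:
  assumes F: "\<And>n. H1_family (U n)" and u: "\<And>n. represents (u n) (U n [])" and \<phi>: "ptest \<phi>"
  shows "wres a \<rho> u (int l - 2) t x \<phi> = (Top (U l [] (t, x)) - rhs U l [] (t, x)) \<bullet> jet \<phi>"
proof -
  have A: "Ayy a (u n) t x \<phi> = - (Top (U n [] (t, x)) \<bullet> jet \<phi>)" for n
    using u[of n] \<phi> by (simp add: Ayy_def represents_def ayy_eq)
  note eqs = A Axy_eq[OF F u \<phi>] Axx_eq[OF F u \<phi>] Rtt_eq[OF F u \<phi>]
  consider "l = 0" | "l = Suc 0" | k where "l = Suc (Suc k)" by (metis not0_implies_Suc)
  then show ?thesis
  proof cases
    case 1 then show ?thesis by (simp add: wres_def eqs)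
  next
    case 2 then show ?thesis by (simp add: wres_def eqs inner_diff_left)
  next
    case 3
    then have "int l - 2 = int k" by simp
    then show ?thesis by (simp add: wres_def eqs 3 inner_diff_left inner_add_left)
  qed
qed

lemma profile_expansion:
  assumes F: "\<And>n. H1_family (U n)" and u: "\<And>n. represents (u n) (U n [])"
    and hyp: "\<And>l t x. l \<le> N \<Longrightarrow> dzero (Ipi (wres a \<rho> u (int l - 2) t x))"
    and m: "\<And>l ps tx. m l ps tx = U l ps tx \<bullet> J1" and l: "l \<le> N"
  shows "U l = expansion m l"
  using l
proof (induction l rule: less_induct)
  case (less l)
  have IH: "U i = expansion m i" if "i < l" for i using less that by simp
  have sm: "smooth_family (m i)" for i
    unfolding smooth_family_def m
    using F by (auto simp: H1_family_def intro!: hder_bounded_linear[OF bounded_linear_inner_left] dest: smooth_familyD)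
  have "U l [] (t, x) = expansion m l [] (t, x)" for t x
  proof -
    let ?U = "U l [] (t, x)" and ?h = "rhs U l [] (t, x)"
    have "Top (?U - sol ?h) \<bullet> jet \<phi> = 0" if \<phi>: "ptest \<phi>" for \<phi>
    proof -
      have "Ipi (wres a \<rho> u (int l - 2) t x) \<phi> = 0"
        using hyp[OF less.prems, of t x] \<phi> by (simp add: dzero_def)
      then show ?thesis
        by (simp add: Ipi_def pid_def wres_eq[OF F u ptest_one] wres_eq[OF F u \<phi>] inner_diff_left Top_J1
            linear_diff[OF linear_ops(1)] Top_sol[OF \<phi>])
    qed
    moreover have "?U - sol ?h \<in> H1S"
      using F[of l] sol(1)[of ?h] by (intro subspace_diff[OF subspace_H1S]) (auto simp: H1_family_def S0_def)
    \<comment> \<open>The profile and the cell solution differ by an element of the kernel, hence by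
      a constant in y, which is the mean of the profile.\<close>
    ultimately have "?U - sol ?h = ((?U - sol ?h) \<bullet> J1) *\<^sub>R J1" by (intro Top_unique)
    moreover have "(?U - sol ?h) \<bullet> J1 = m l [] (t, x)"
      using sol(1)[of ?h] by (simp add: inner_diff_left m S0_def)
    ultimately have "?U = sol ?h + m l [] (t, x) *\<^sub>R J1" by (simp add: diff_eq_eq add.commute)
    then show ?thesis using sol_rhs_expansion[where l = l and ps = "[]" and tx = "(t, x)", OF IH] by simp
  qed
  then have eq: "U l [] = expansion m l []" by auto
  \<comment> \<open>So far only values agree; the next induction step differentiates
    \<open>U l\<close>, so the equality must be extended to the derivatives.\<close>
  have sU: "smooth_family (U l)" using F[of l] by (simp add: H1_family_def)
  have "smooth_family (expansion m l)" by (rule smooth_family_expansion) (rule sm)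
  from smooth_family_eq[OF sU this eq] show ?case by (rule ext)
qed

lemma homogenized_expansion:
  assumes F: "\<And>n. H1_family (U n)" and u: "\<And>n. represents (u n) (U n [])"
    and hyp: "\<And>l t x. l \<le> N \<Longrightarrow> dzero (Ipi (wres a \<rho> u (int l - 2) t x))"
  shows "pid (wres a \<rho> u (-2) t x) = 0" "pid (wres a \<rho> u (-1) t x) = 0"
    and "j < N \<Longrightarrow> pid (wres a \<rho> u (int j) t x) = (\<Sum>n\<le>j. astar a \<rho> (n + 2) (ymean (u (j - n))) t x)"
proof -
  define m where "m l ps tx = U l ps tx \<bullet> J1" for l ps tx
  have sm: "smooth_family (m i)" for i
    unfolding smooth_family_def m_def
    using F by (auto simp: H1_family_def intro!: hder_bounded_linear[OF bounded_linear_inner_left] dest: smooth_familyD)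
  have mean: "ymean (u i) = (\<lambda>t x. m i [] (t, x))" for i
    using u[of i] by (intro ext) (simp add: ymean_def m_def represents_def yint_eq_inner)
  have P: "U l = expansion m l" if "l \<le> N" for l
    by (rule profile_expansion[OF F u hyp m_def that])
  have pw: "pid (wres a \<rho> u (int l - 2) t x) = - (rhs U l [] (t, x) \<bullet> J1)" for l
    by (simp add: pid_def wres_eq[OF F u ptest_one] inner_diff_left Top_J1)
  show "pid (wres a \<rho> u (-2) t x) = 0" using pw[of 0] by simp
  have "U 0 = cor (Suc 0) (m 0)" using P[of 0] by (simp add: expansion_def[abs_def])
  then show "pid (wres a \<rho> u (-1) t x) = 0" using pw[of "Suc 0"] KXY_cor_1 by simp
  assume j: "j < N"
  have "pid (wres a \<rho> u (int j) t x) = - (rhs U (j + 2) [] (t, x) \<bullet> J1)" using pw[of "j + 2"] by simp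
  \<comment> \<open>The mean of w_j involves profiles only up to index j + 1, as the one of index j
    + 2 enters through \<open>Top\<close> alone. So j < \<open>N\<close> suffices, which lets j
    exceed the last controlled residual by one.\<close>
  also have "rhs U (j + 2) [] (t, x) = (\<Sum>n<j + 2. KXY (cor (Suc n) (m (j + 2 - Suc n))) [] (t, x)
      + KXX (cor n (m (j + 2 - Suc n))) [] (t, x) - KTT (cor n (m (j + 2 - Suc n))) [] (t, x))"
    by (rule rhs_expansion) (use j in \<open>auto intro: P\<close>)
  also have "\<dots> \<bullet> J1 = (\<Sum>n\<le>Suc j. (KXY (cor (Suc n) (m (Suc j - n))) [] (t, x)
      + KXX (cor n (m (Suc j - n))) [] (t, x) - KTT (cor n (m (Suc j - n))) [] (t, x)) \<bullet> J1)"
    by (simp only: add_2_eq_Suc' lessThan_Suc_atMost inner_sum_left diff_Suc_Suc)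
  \<comment> \<open>The term n = 0 drops out: chi_(-1) is zero and \<open>KXY_cor_1\<close> handles
    chi_0. Shifting the index then produces a coefficient of order n + 2.\<close>
  also have "\<dots> = (\<Sum>n\<le>j. (KXY (cor (n + 2) (m (j - n))) [] (t, x)
      + KXX (cor (n + 1) (m (j - n))) [] (t, x) - KTT (cor (n + 1) (m (j - n))) [] (t, x)) \<bullet> J1)"
  proof -
    have "KXX (cor 0 (m (Suc j))) [] (t, x) = 0" "KTT (cor 0 (m (Suc j))) [] (t, x) = 0"
      by (simp_all add: KXX_def KTT_def linear_0[OF linear_ops(4)] linear_0[OF linear_ops(5)])
    then show ?thesis
      unfolding sum.atMost_Suc_shift by (simp add: KXY_cor_1 del: cor.simps)
  qed
  finally show "pid (wres a \<rho> u (int j) t x) = (\<Sum>n\<le>j. astar a \<rho> (n + 2) (ymean (u (j - n))) t x)"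
    unfolding mean astar_eq[OF sm] by (simp only: sum_negf)
qed

end

theorem theorem2p10:
  fixes a :: "real^'d \<Rightarrow> real^'d^'d" and \<rho> :: "real^'d \<Rightarrow> real" and m1 :: real
    and u :: "nat \<Rightarrow> real \<Rightarrow> real^'d \<Rightarrow> real^'d \<Rightarrow> real" and k :: int
  assumes m1_pos: "m1 > 0"
    and a_meas: "\<forall>i j. (\<lambda>y. a y $ i $ j) \<in> borel_measurable (lebesgue_on cube)"
    and a_bdd: "\<exists>C. AE y in lebesgue_on cube. \<forall>i j. \<bar>a y $ i $ j\<bar> \<le> C"
    and a_sym: "AE y in lebesgue_on cube. transpose (a y) = a y"
    and a_ell: "AE y in lebesgue_on cube. \<forall>\<xi>. (a y *v \<xi>) \<bullet> \<xi> \<ge> m1 * (norm \<xi>)^2"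
    and rho_meas: "\<rho> \<in> borel_measurable (lebesgue_on cube)"
    and rho_bdd: "\<exists>C. AE y in lebesgue_on cube. \<bar>\<rho> y\<bar> \<le> C"
    and rho_ell: "AE y in lebesgue_on cube. \<rho> y \<ge> m1"
    and u_smooth: "\<forall>n. hsmooth (u n)"
    and k_ge: "k \<ge> -2"
    and hyp: "\<forall>j. -2 \<le> j \<and> j \<le> k \<longrightarrow> (\<forall>t x. dzero (Ipi (wres a \<rho> u j t x)))"
  shows "(\<forall>t x. pid (wres a \<rho> u (-2) t x) = 0 \<and> pid (wres a \<rho> u (-1) t x) = 0) \<and>
         (\<forall>j::nat. int j \<le> k + 1 \<longrightarrow> (\<forall>t x.
            pid (wres a \<rho> u (int j) t x) =
              (\<Sum>n\<le>j. astar a \<rho> (n + 2) (ymean (u (j - n))) t x)))"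
proof -
  interpret elliptic a \<rho> m1
    by unfold_locales (fact m1_pos a_meas a_bdd a_sym a_ell rho_meas rho_bdd)+
  have "\<exists>\<Phi>. H1_family \<Phi> \<and> represents (u n) (\<Phi> [])" for n
    using u_smooth hsmooth_family by metis
  then obtain U where U: "\<And>n. H1_family (U n)" "\<And>n. represents (u n) (U n [])" by metis
  \<comment> \<open>With l = j + 2 the hypothesis covers all l up to k + 2, which is a natural
    number because k is at least -2.\<close>
  have hyp': "dzero (Ipi (wres a \<rho> u (int l - 2) t x))" if "l \<le> nat (k + 2)" for l t x
    using hyp k_ge that by (simp add: le_nat_iff)
  note expansion = homogenized_expansion[where N = "nat (k + 2)", OF U hyp']
  show ?thesis
  proof (intro conjI allI impI)
    fix j :: nat and t x assume "int j \<le> k + 1"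
    then show "pid (wres a \<rho> u (int j) t x) = (\<Sum>n\<le>j. astar a \<rho> (n + 2) (ymean (u (j - n))) t x)"
      by (intro expansion(3)) auto
  qed (rule expansion(1), assumption, rule expansion(2), assumption)
qed

end
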